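(* Let $E$ be a separable metric space with distance $d$, let $(u(t))_{t\ge0}$ be a càdlàg Markov process on $E$ with a stationary probability measure $m$ of full support, and let $(u_N)_{N\ge1}$ be Markov processes on spaces $E_N$ with invariant probability measures $m_N$ of full support, all as described in the context. Assume that conditions (A1)–(A5) of the context hold. Let each $u_N$ be started from its invariant measure $m_N$. Then the sequence $(u_N)_{N\ge1}$ converges in law in the Skorokhod space $\mathbb{D}([0,\infty),E^-)$ to the process $u$ started from its invariant measure $m$.
   Context: Setting. $E$ is a separable (not necessarily complete) metric space with distance $d$. $(u(t))_{t\ge 0}$ is a càdlàg Markov process on $E$, with law $\mathbb P_x$ when started from $x$, admitting a stationary (not necessarily reversible) probability measure $m$ with full support on $E$. For bounded measurable $f:E\to\mathbb R$ set $P_tf(x)=\mathbb E_x[f(u(t))]$; it is assumed that $(P_t)_{t\ge0}$ extends to a strongly continuous semigroup of bounded operators on $L^2(E,m)$, with resolvents $\mathcal R_\lambda f=\int_0^\infty e^{-\lambda t}P_tf\,dt$, $\lambda>0$. For each $N\ge1$, $u_N$ is a Markov process on a set $E_N$ with an invariant probability measure $m_N$ of full support on $E_N$ and resolvents $\mathcal R^N_\lambda$. For $f:E_N\to\mathbb R$ let $[f]_{\mathrm{Lip}(E_N)}=\sup_{x\ne y\in E_N}|f(x)-f(y)|/d(x,y)$ and $\mathrm{Lip}(E_N)$ the set of $f$ with this quantity finite. Weak convergence of finite complex measures means convergence of integrals of all bounded continuous functions. (A1) There is a set $\mathcal C$ of bounded continuous functions $E\to\mathbb C$ and, for each $\psi\in\mathcal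 C$, a finite complex measure $\Sigma^\psi$ on $E$, such that for every $\lambda>0$ and every bounded Lipschitz $f:E\to\mathbb R$, $\mathcal R_\lambda f$ is the unique bounded Lipschitz $F:E\to\mathbb R$ with $-\int_E F\psi\,d\Sigma^\psi+\lambda\int_E F\psi\,dm=\int_E f\psi\,dm$ for all $\psi\in\mathcal C$. (A2) Each $E_N\subset E$, and there is a map $\pi_N:E\to E_N$ (not necessarily unique or continuous) with $d(x,\pi_N(x))=\inf_{y\in E_N}d(x,y)$ for all $x\in E$; moreover $m_N\to m$ weakly. (A3) There is a Polish space $E^-$ into which $E$ is continuously embedded such that, when each $u_N$ starts from $m_N$, $(u_N)_N$ is tight in $\mathbb D([0,\infty),E^-)$. (A4) For every $\lambda>0$ there is $C>0$ such that $[\mathcal R^N_\lambda f]_{\mathrm{Lip}(E_N)}\le C[f]_{\mathrm{Lip}(E_N)}$ for all $N\ge1$ and all $f\in\mathrm{Lip}(E_N)$. (A5) For every $\psi\in\mathcal C$ there is a finite complex measure $\Sigma^\psi_N$ on $E_N$ such that for every $\lambda>0$ and $f\in L^2(E_N,m_N)$, $F=\mathcal R^N_\lambda f$ satisfies $-\int_{E_N}F\psi\,d\Sigma^\psi_N+\lambda\int_{E_N}F\psi\,dm_N=\int_{E_N}f\psi\,dm_N$; and $\Sigma^\psi_N\to\Sigma^\psi$ weakly as $N\to\infty$. *)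

theory Defs
  imports "HOL-Probability.Probability"
begin

definition cadlag :: "(real \<Rightarrow> 'a::topological_space) \<Rightarrow> bool" where
  "cadlag \<omega> \<longleftrightarrow> (\<forall>t\<ge>0. continuous (at_right t) \<omega>) \<and> (\<forall>t>0. \<exists>l. (\<omega> \<longlongrightarrow> l) (at_left t))"

text \<open>Skorokhod J1 convergence in D([0,infinity),X) (Ethier--Kurtz, Prop. 3.5.3).\<close>
definition sko_conv :: "(nat \<Rightarrow> real \<Rightarrow> 'a::metric_space) \<Rightarrow> (real \<Rightarrow> 'a) \<Rightarrow> bool" where
  "sko_conv xs x \<longleftrightarrow> (\<exists>lam :: nat \<Rightarrow> real \<Rightarrow> real.
     (\<forall>n. strict_mono_on {0..} (lam n) \<and> continuous_on {0..} (lam n) \<and> lam n ` {0..} = {0..}) \<and>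
     (\<forall>\<epsilon>>0. eventually (\<lambda>n. \<forall>t\<ge>0. \<bar>lam n t - t\<bar> \<le> \<epsilon>) sequentially) \<and>
     (\<forall>T\<ge>0. \<forall>\<epsilon>>0. eventually (\<lambda>n. \<forall>t\<in>{0..T}. dist (xs n (lam n t)) (x t) \<le> \<epsilon>) sequentially))"

definition sko_continuous :: "((real \<Rightarrow> 'a::metric_space) \<Rightarrow> real) \<Rightarrow> bool" where
  "sko_continuous F \<longleftrightarrow> (\<forall>xs x. (\<forall>n. cadlag (xs n)) \<longrightarrow> cadlag x \<longrightarrow> sko_conv xs x \<longrightarrow>
      (\<lambda>n. F (xs n)) \<longlonglongrightarrow> F x)"

text \<open>(Sequentially) compact subsets of the (metrizable) Skorokhod space.\<close>
definition sko_compact :: "(real \<Rightarrow> 'a::metric_space) set \<Rightarrow> bool" where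
  "sko_compact K \<longleftrightarrow> K \<subseteq> {\<omega>. cadlag \<omega>} \<and>
     (\<forall>xs::nat \<Rightarrow> real \<Rightarrow> 'a. (\<forall>n. xs n \<in> K) \<longrightarrow> (\<exists>(r::nat \<Rightarrow> nat) x. strict_mono r \<and> x \<in> K \<and> sko_conv (xs \<circ> r) x))"

definition path_space :: "(real \<Rightarrow> 'a::topological_space) set \<Rightarrow> (real \<Rightarrow> 'a) measure" where
  "path_space \<Omega> = sigma \<Omega> {{\<omega>\<in>\<Omega>. \<omega> t \<in> A} | t A. 0 \<le> t \<and> A \<in> sets borel}"

definition bdd_meas :: "('e::topological_space \<Rightarrow> real) \<Rightarrow> bool" where
  "bdd_meas f \<longleftrightarrow> bounded (range f) \<and> f \<in> borel_measurable borel"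

definition trans_op :: "('e \<Rightarrow> (real \<Rightarrow> 'e) measure) \<Rightarrow> real \<Rightarrow> ('e \<Rightarrow> real) \<Rightarrow> 'e \<Rightarrow> real" where
  "trans_op P t f x = (\<integral>\<omega>. f (\<omega> t) \<partial>P x)"

definition resolvent :: "('e \<Rightarrow> (real \<Rightarrow> 'e) measure) \<Rightarrow> real \<Rightarrow> ('e \<Rightarrow> real) \<Rightarrow> 'e \<Rightarrow> real" where
  "resolvent P lam f x = (LINT t:{0..}|lborel. exp (- lam * t) * trans_op P t f x)"

definition markov_family :: "'e::topological_space set \<Rightarrow> (real \<Rightarrow> 'e) set \<Rightarrow> ('e \<Rightarrow> (real \<Rightarrow> 'e) measure) \<Rightarrow> bool" where
  "markov_family S \<Omega> P \<longleftrightarrow>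
     \<Omega> \<subseteq> {\<omega>. \<forall>t\<ge>0. \<omega> t \<in> S} \<and>
     P \<in> measurable (restrict_space borel S) (subprob_algebra (path_space \<Omega>)) \<and>
     (\<forall>x\<in>S. prob_space (P x) \<and> (AE \<omega> in P x. \<omega> 0 = x)) \<and>
     (\<forall>x\<in>S. \<forall>(n::nat) (ss::nat \<Rightarrow> real) (gs::nat \<Rightarrow> 'e \<Rightarrow> real) f s t.
        0 \<le> s \<and> 0 \<le> t \<and> (\<forall>i<n. 0 \<le> ss i \<and> ss i \<le> s \<and> bdd_meas (gs i)) \<and> bdd_meas f \<longrightarrow>
        (\<integral>\<omega>. (\<Prod>i<n. gs i (\<omega> (ss i))) * f (\<omega> (s + t)) \<partial>P x)
          = (\<integral>\<omega>. (\<Prod>i<n. gs i (\<omega> (ss i))) * trans_op P t f (\<omega> s) \<partial>P x))"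

definition invariant_measure :: "'e::topological_space measure \<Rightarrow> ('e \<Rightarrow> (real \<Rightarrow> 'e) measure) \<Rightarrow> bool" where
  "invariant_measure \<mu> P \<longleftrightarrow> (\<forall>t\<ge>0. \<forall>f. bdd_meas f \<longrightarrow> (\<integral>x. trans_op P t f x \<partial>\<mu>) = (\<integral>x. f x \<partial>\<mu>))"

text \<open>A finite complex measure on M is represented as h d|mu| with mu a finite (positive)
  measure on M and h a bounded measurable complex density.\<close>
definition cmeasure_on :: "'e measure \<Rightarrow> ('e measure \<times> ('e \<Rightarrow> complex)) \<Rightarrow> bool" where
  "cmeasure_on M \<Sigma> \<longleftrightarrow> finite_measure (fst \<Sigma>) \<and> sets (fst \<Sigma>) = sets M \<and>
     snd \<Sigma> \<in> borel_measurable M \<and> bounded (snd \<Sigma> ` space M)"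

definition cint :: "('e measure \<times> ('e \<Rightarrow> complex)) \<Rightarrow> ('e \<Rightarrow> complex) \<Rightarrow> complex" where
  "cint \<Sigma> g = (\<integral>x. g x * snd \<Sigma> x \<partial>fst \<Sigma>)"

definition weak_conv_cm :: "(nat \<Rightarrow> ('e::topological_space measure \<times> ('e \<Rightarrow> complex))) \<Rightarrow> ('e measure \<times> ('e \<Rightarrow> complex)) \<Rightarrow> bool" where
  "weak_conv_cm \<Sigma>s \<Sigma> \<longleftrightarrow> (\<forall>g::'e \<Rightarrow> real. continuous_on UNIV g \<and> bounded (range g) \<longrightarrow>
      (\<lambda>n. cint (\<Sigma>s n) (\<lambda>x. complex_of_real (g x))) \<longlonglongrightarrow> cint \<Sigma> (\<lambda>x. complex_of_real (g x)))"

definition weak_conv_pm :: "(nat \<Rightarrow> 'e::topological_space measure) \<Rightarrow> 'e measure \<Rightarrow> bool" where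
  "weak_conv_pm \<mu>s \<mu> \<longleftrightarrow> (\<forall>g::'e \<Rightarrow> real. continuous_on UNIV g \<and> bounded (range g) \<longrightarrow>
      (\<lambda>n. \<integral>x. g x \<partial>\<mu>s n) \<longlonglongrightarrow> (\<integral>x. g x \<partial>\<mu>))"

definition resolvent_eq :: "('e measure \<times> ('e \<Rightarrow> complex)) \<Rightarrow> ('e \<Rightarrow> complex) \<Rightarrow> 'e measure \<Rightarrow> real \<Rightarrow> ('e \<Rightarrow> real) \<Rightarrow> ('e \<Rightarrow> real) \<Rightarrow> bool" where
  "resolvent_eq \<Sigma> \<psi> \<mu> lam F f \<longleftrightarrow>
     - cint \<Sigma> (\<lambda>x. complex_of_real (F x) * \<psi> x) + complex_of_real lam * (\<integral>x. complex_of_real (F x) * \<psi> x \<partial>\<mu>)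
       = (\<integral>x. complex_of_real (f x) * \<psi> x \<partial>\<mu>)"

definition bdd_lip :: "('e::metric_space \<Rightarrow> real) \<Rightarrow> bool" where
  "bdd_lip f \<longleftrightarrow> bounded (range f) \<and> (\<exists>L. L-lipschitz_on UNIV f)"

end

theory Submission
  imports Defs
begin

text \<open>Extend \<open>R\<^sup>N\<^sub>\<lambda> f\<close> from \<open>E\<^sub>N\<close> to \<open>E\<close> without changing its Lipschitz constant (McShane); by (A4) a
  subsequence converges pointwise. A sequence of complex measures converging weakly converges uniformly on bounded
  equi-Lipschitz sets (Baire category, applied to locally finite combinations of a partition of unity), so the limit
  solves the equation in (A1) and must be \<open>R\<^sub>\<lambda> f\<close>.

  The paths of \<open>u\<^sub>N\<close> are cadlag only in \<open>E\<^sup>-\<close>, so only functions \<open>g \<circ> \<iota>\<close> may be integrated along them in time, while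
  the resolvent convergence concerns Lipschitz functions on \<open>E\<close>. The two are reconciled by squeezing \<open>g \<circ> \<iota>\<close> between
  Lipschitz functions that are close in \<open>L\<^sup>1(m)\<close>, an operation compatible with sums, products and resolvents. By Kac's
  formula the mixed moments of the functionals \<open>\<integral> e\<^sup>-\<^sup>l\<^sup>t g(\<iota>(u(t))) dt\<close> are iterated resolvents, hence converge.
  Countably many such functionals are Skorokhod continuous and separate paths, and tightness concludes.\<close>

section \<open>Lipschitz functions and compactness\<close>

text \<open>As \<open>E\<close> need not be complete, weakly convergent measures on it need not
  concentrate on compact sets. Uniformity over bounded equi-Lipschitz functions is therefore drawn
  from the countable additivity of each single functional, in the way Schur's theorem on
  \<open>l^1\<close> is proved by category. The limit equation characterises resolvents only, so the
  law of a path has to be rebuilt from them: expectations of products of discounted functionals are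
  resolvents of expressions with one factor less. This recursion leaves the Lipschitz class at once,
  since an observable pulled back from \<open>E^-\<close> is merely continuous on \<open>E\<close>
  and the moments are merely known to be measurable. Widths of brackets are measured in
  \<open>L^1(m)\<close> because stationarity of \<open>m\<close> turns a width \<epsilon> into
  \<open>\<epsilon> / lam\<close> under a resolvent, whatever the Lipschitz constants have become. A
  second obstacle is measurability in time. The time integral in \<open>resolvent\<close> is 0 by
  convention when its integrand is not integrable, and along the approximating paths this cannot be
  excluded for a Lipschitz function on \<open>E\<close>. All comparisons are arranged so that this
  default value does no harm.\<close>

lemma inf_convolution:
  fixes f :: "'e::metric_space \<Rightarrow> real"
  assumes "S \<noteq> {}" "L \<ge> 0" and low: "\<forall>x\<in>S. - B \<le> f x"
  defines "h \<equiv> \<lambda>x. INF y\<in>S. f y + L * dist x y"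
  shows "L-lipschitz_on UNIV h" "\<And>x. - B \<le> h x" "\<And>x y. y \<in> S \<Longrightarrow> h x \<le> f y + L * dist x y"
proof -
  have bdd: "bdd_below ((\<lambda>y. f y + L * dist x y) ` S)" for x
    by (rule bdd_belowI[of _ "- B"]) (use low \<open>L \<ge> 0\<close> in \<open>fastforce intro: add_increasing2\<close>)
  show le: "h x \<le> f y + L * dist x y" if "y \<in> S" for x y
    unfolding h_def by (rule cINF_lower[OF bdd that])
  show "- B \<le> h x" for x
    unfolding h_def by (rule cINF_greatest) (use assms(1,2) low in \<open>auto intro: add_increasing2\<close>)
  have one: "h x \<le> h x' + L * dist x x'" for x x'
  proof -
    have "h x - L * dist x x' \<le> h x'"
      unfolding h_def
    proof (rule cINF_greatest)
      fix y assume y: "y \<in> S"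
      have "L * dist x y \<le> L * (dist x x' + dist x' y)"
        using \<open>L \<ge> 0\<close> by (intro mult_left_mono dist_triangle) auto
      then show "(INF y\<in>S. f y + L * dist x y) - L * dist x x' \<le> f y + L * dist x' y"
        using le[OF y, of x] by (simp add: h_def algebra_simps)
    qed (use assms in auto)
    then show ?thesis by simp
  qed
  show "L-lipschitz_on UNIV h"
  proof (rule lipschitz_onI)
    show "dist (h x) (h y) \<le> L * dist x y" for x y
      using one[of x y] one[of y x] by (simp add: dist_real_def dist_commute abs_le_iff)
  qed fact
qed

lemma lipschitz_on_clamp:
  fixes h :: "'e::metric_space \<Rightarrow> real"
  assumes "L-lipschitz_on S h"
  shows "L-lipschitz_on S (\<lambda>x. max (- B) (min B (h x)))"
proof (rule lipschitz_onI)
  fix x y assume "x \<in> S" "y \<in> S"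
  then have "\<bar>h x - h y\<bar> \<le> L * dist x y"
    using lipschitz_onD[OF assms] by (simp add: dist_real_def)
  then show "dist (max (- B) (min B (h x))) (max (- B) (min B (h y))) \<le> L * dist x y"
    unfolding dist_real_def by linarith
qed (rule lipschitz_on_nonneg[OF assms])

text \<open>The infimal formula extends \<open>f\<close> with the same constant. Clamping to
  \<open>[-B, B]\<close> changes nothing on \<open>S\<close>, where \<open>f\<close> already lies in
  that interval, and keeps the constant.\<close>

lemma lipschitz_extension_bounded:
  fixes f :: "'e::metric_space \<Rightarrow> real"
  assumes "L-lipschitz_on S f" "S \<noteq> {}" "\<And>x. x \<in> S \<Longrightarrow> \<bar>f x\<bar> \<le> B"
  obtains g where "L-lipschitz_on UNIV g" "\<And>x. \<bar>g x\<bar> \<le> B" "\<And>x. x \<in> S \<Longrightarrow> g x = f x"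
proof
  have L: "L \<ge> 0" using lipschitz_on_nonneg[OF assms(1)] .
  have low: "\<forall>x\<in>S. - B \<le> f x" using assms(3) by fastforce
  define h where "h \<equiv> \<lambda>x. INF y\<in>S. f y + L * dist x y"
  note h = inf_convolution[where f = f and B = B, OF assms(2) L low, folded h_def]
  have B: "B \<ge> 0" using assms(2,3) by fastforce
  define g where "g x = max (- B) (min B (h x))" for x
  show "L-lipschitz_on UNIV g"
    using lipschitz_on_clamp[OF h(1)] by (simp add: g_def[abs_def])
  show "\<bar>g x\<bar> \<le> B" for x using B by (auto simp: g_def)
  fix x assume x: "x \<in> S"
  have "f x \<le> h x"
    unfolding h_def
  proof (rule cINF_greatest)
    fix y assume "y \<in> S"
    then show "f x \<le> f y + L * dist x y"
      using lipschitz_onD[OF assms(1) x \<open>y \<in> S\<close>] by (simp add: dist_real_def)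
  qed (rule assms(2))
  then have "h x = f x" using h(3)[OF x, of x] unfolding h_def by simp
  then show "g x = f x" using assms(3)[OF x] by (auto simp: g_def)
qed

text \<open>The approximants are infimal convolutions of slope \<open>n\<close>. Near
  \<open>x\<close> the function changes little by continuity; at far points the penalty
  \<open>n * dist x y\<close> eventually exceeds the oscillation \<open>2 * B\<close>. The
  convergence need not be uniform.\<close>

lemma lipschitz_approx_below:
  fixes f :: "'e::metric_space \<Rightarrow> real"
  assumes cont: "continuous_on UNIV f" and B: "\<And>x. \<bar>f x\<bar> \<le> B"
  obtains h where "\<And>n::nat. (real n)-lipschitz_on UNIV (h n)" "\<And>n x. h n x \<le> f x"
    "\<And>n x. \<bar>h n x\<bar> \<le> B" "\<And>x. (\<lambda>n. h n x) \<longlonglongrightarrow> f x"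
proof
  have low: "- B \<le> f x" for x using B[of x] by auto
  define h where "h \<equiv> \<lambda>(n::nat) x. INF y. f y + real n * dist x y"
  have h: "(real n)-lipschitz_on UNIV (h n)" "\<And>x. - B \<le> h n x" 
     "\<And>x y. h n x \<le> f y + real n * dist x y" for n
    using inf_convolution[of UNIV "real n" B f] low by (auto simp: h_def)
  show "(real n)-lipschitz_on UNIV (h n)" for n by (rule h)
  show le: "h n x \<le> f x" for n x using h(3)[of n x x] by simp
  show "\<bar>h n x\<bar> \<le> B" for n x using le[of n x] h(2)[of n x] B[of x] by auto
  fix x
  show "(\<lambda>n. h n x) \<longlonglongrightarrow> f x"
  proof (rule LIMSEQ_I)
    fix e :: real assume e: "e > 0"
    from cont e obtain d where d: "d > 0" "\<And>y. dist y x < d \<Longrightarrow> dist (f y) (f x) < e/2"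
      unfolding continuous_on_iff by (metis UNIV_I half_gt_zero)
    \<comment> \<open>From this slope on, the penalty at distance \<open>d\<close> is at least
      \<open>2 * B\<close>, the largest possible drop between two values of
      \<open>f\<close>.\<close>
    obtain N :: nat where N: "2 * B / d \<le> real N" using real_arch_simple by blast
    show "\<exists>no. \<forall>n\<ge>no. norm (h n x - f x) < e"
    proof (intro exI allI impI)
      fix n assume n: "n \<ge> N"
      have "f x - e/2 \<le> h n x"
        unfolding h_def
      proof (rule cINF_greatest)
        fix y
        show "f x - e/2 \<le> f y + real n * dist x y"
        proof (cases "dist y x < d")
          case True
          have "real n * dist x y \<ge> 0" by simp
          with d(2)[OF True] show ?thesis unfolding dist_real_def by arith
        next
          case False
          have "2 * B \<le> real N * d" using N d(1) by (simp add: divide_le_eq)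
          also have "\<dots> \<le> real n * dist x y"
            using n False d(1) by (intro mult_mono) (auto simp: dist_commute)
          finally show ?thesis using B[of x] B[of y] e by (simp add: abs_le_iff)
        qed
      qed auto
      then show "norm (h n x - f x) < e" using le[of n x] e by simp
    qed
  qed
qed

section \<open>Baire category and extraction of subsequences\<close>

lemma Baire_closed_cover:
  fixes A :: "nat \<Rightarrow> 'a::complete_space set"
  assumes "\<And>k. closed (A k)" "(\<Union>k. A k) = UNIV"
  obtains k x r where "r > 0" "ball x r \<subseteq> A k"
proof -
  have "\<exists>k. interior (A k) \<noteq> {}"
  proof (rule ccontr)
    assume "\<not> ?thesis"
    then have *: "interior (A k) = {}" for k by auto
    have "euclidean interior_of (\<Union>(range A)) = {}"
      by (rule Baire_category_alt) 
        (use assms(1) * in \<open>auto simp: completely_metrizable_space_euclidean interior_of_def interior_def\<close>)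
    then show False using assms(2) by simp
  qed
  then obtain k x where "x \<in> interior (A k)" by auto
  then show thesis using that by (auto simp: mem_interior)
qed

lemma LIMSEQ_if_subsubsequences:
  fixes f :: "nat \<Rightarrow> 'a::metric_space"
  assumes "\<And>s::nat \<Rightarrow> nat. strict_mono s \<Longrightarrow> \<exists>r. strict_mono (r::nat \<Rightarrow> nat) \<and> (\<lambda>n. f (s (r n))) \<longlonglongrightarrow> l"
  shows "f \<longlonglongrightarrow> l"
proof (rule ccontr)
  assume "\<not> ?thesis"
  then obtain e where e: "e > 0" "\<And>N. \<exists>n\<ge>N. dist (f n) l \<ge> e"
    unfolding lim_sequentially by (meson not_less)
  then have "infinite {n. dist (f n) l \<ge> e}" unfolding infinite_nat_iff_unbounded_le by auto
  then obtain s where s: "strict_mono (s :: nat \<Rightarrow> nat)" "\<And>n. s n \<in> {n. dist (f n) l \<ge> e}"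
    using infinite_enumerate by blast
  obtain r where r: "(\<lambda>n. f (s (r n))) \<longlonglongrightarrow> l" using assms[OF s(1)] by blast
  have "\<forall>\<^sub>F n in sequentially. dist (f (s (r n))) l < e" by (rule tendstoD[OF r e(1)])
  then obtain n where "dist (f (s (r n))) l < e" by (auto simp: eventually_sequentially)
  then show False using s(2)[of "r n"] by simp
qed

text \<open>Pointwise form of Arzela-Ascoli: compactness of a countable product of intervals
  replaces the diagonal extraction, and the common Lipschitz constant carries the Cauchy property
  from \<open>D\<close> to every point. Completeness enters only through the real values.\<close>

lemma pointwise_convergent_subsequence:
  fixes F :: "nat \<Rightarrow> 'e::metric_space \<Rightarrow> real"
  assumes D: "countable D" "closure D = (UNIV :: 'e set)"
    and lip: "\<And>n. L-lipschitz_on UNIV (F n)" and B: "\<And>n x. \<bar>F n x\<bar> \<le> B"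
  obtains r G where "strict_mono (r::nat \<Rightarrow> nat)" "\<And>x. (\<lambda>n. F (r n) x) \<longlonglongrightarrow> G x"
proof -
  have Dne: "D \<noteq> {}" using D(2) by auto
  define e where "e = from_nat_into D"
  have e: "range e = D" unfolding e_def by (rule range_from_nat_into[OF Dne D(1)])
  have L: "L \<ge> 0" by (rule lipschitz_on_nonneg[OF lip[of 0]])
  have cpt: "compact (PiE UNIV (\<lambda>_::nat. {-B..B}))"
    using compactin_PiE[of "\<lambda>_::nat. euclidean :: real topology" UNIV "\<lambda>_. {-B..B}"]
    by (simp add: euclidean_product_topology)
  have "\<forall>n. (\<lambda>k. F n (e k)) \<in> PiE UNIV (\<lambda>_::nat. {-B..B})"
    using B by (auto simp: abs_le_iff minus_le_iff)
  then obtain l r where r: "strict_mono (r::nat \<Rightarrow> nat)" "((\<lambda>n k. F n (e k)) \<circ> r) \<longlonglongrightarrow> l"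
    using cpt unfolding compact_eq_seq_compact_metric seq_compact_def by metis
  have lim: "(\<lambda>n. F (r n) (e k)) \<longlonglongrightarrow> l k" for k
    using continuous_on_tendsto_compose[OF continuous_on_product_coordinates[of k] r(2)]
    by (simp add: o_def)
  have "Cauchy (\<lambda>n. F (r n) x)" for x
  proof (rule metric_CauchyI)
    fix \<epsilon> :: real assume eps: "\<epsilon> > 0"
    have "x \<in> closure D" using D(2) by simp
    \<comment> \<open>The summand 1 covers \<open>L = 0\<close>. With the factor 4, moving from
      \<open>x\<close> to \<open>d\<close> costs at most a quarter of \<epsilon>, and three quarters
      are spent in all.\<close>
    then obtain d where d: "d \<in> D" "dist d x < \<epsilon> / (4 * (L + 1))"
      using eps L unfolding closure_approachable by (metis add_nonneg_pos divide_pos_pos mult_pos_pos zero_less_numeral zero_less_one)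
    have Ld: "L * dist d x \<le> \<epsilon> / 4"
    proof -
      have "L * dist d x \<le> (L + 1) * (\<epsilon> / (4 * (L + 1)))"
        using d(2) L by (intro mult_mono) auto
      also have "\<dots> = \<epsilon> / 4" using L by (simp add: divide_simps) (simp add: algebra_simps)?
      finally show ?thesis .
    qed
    obtain k where k: "d = e k" using d(1) e by auto
    have "Cauchy (\<lambda>n. F (r n) d)" using lim[of k] k LIMSEQ_imp_Cauchy by blast
    then obtain M where M: "\<And>m n. m \<ge> M \<Longrightarrow> n \<ge> M \<Longrightarrow> dist (F (r m) d) (F (r n) d) < \<epsilon>/4"
      unfolding Cauchy_def using eps by (metis zero_less_divide_iff zero_less_numeral)
    have Fd: "\<bar>F n d - F n x\<bar> \<le> \<epsilon>/4" for n
      using lipschitz_onD[OF lip, of d x n] Ld by (simp add: dist_real_def)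
    show "\<exists>M. \<forall>m\<ge>M. \<forall>n\<ge>M. dist (F (r m) x) (F (r n) x) < \<epsilon>"
    proof (intro exI allI impI)
      fix m n assume "m \<ge> M" "n \<ge> M"
      then show "dist (F (r m) x) (F (r n) x) < \<epsilon>"
        using M[of m n] Fd[of "r m"] Fd[of "r n"] eps unfolding dist_real_def by linarith
    qed
  qed
  then have "\<exists>g. (\<lambda>n. F (r n) x) \<longlonglongrightarrow> g" for x
    using Cauchy_convergent convergent_def by blast
  then obtain G where "\<And>x. (\<lambda>n. F (r n) x) \<longlonglongrightarrow> G x" by metis
  then show thesis using that r(1) by blast
qed

lemma lipschitz_pointwise_limit:
  fixes F :: "nat \<Rightarrow> 'e::metric_space \<Rightarrow> real"
  assumes lip: "\<And>n. L-lipschitz_on UNIV (F n)" and lim: "\<And>x. (\<lambda>n. F n x) \<longlonglongrightarrow> G x"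
  shows "L-lipschitz_on UNIV G"
proof (rule lipschitz_onI)
  fix x y
  have "(\<lambda>n. dist (F n x) (F n y)) \<longlonglongrightarrow> dist (G x) (G y)"
    by (intro tendsto_dist lim)
  then show "dist (G x) (G y) \<le> L * dist x y"
    by (rule LIMSEQ_le_const2) (use lipschitz_onD[OF lip] in auto)
qed (rule lipschitz_on_nonneg[OF lip[of 0]])

lemma bounded_pointwise_limit:
  fixes F :: "nat \<Rightarrow> 'e \<Rightarrow> real"
  assumes B: "\<And>n x. \<bar>F n x\<bar> \<le> B" and lim: "\<And>x. (\<lambda>n. F n x) \<longlonglongrightarrow> G x"
  shows "\<bar>G x\<bar> \<le> B"
  using tendsto_rabs[OF lim[of x]] by (rule LIMSEQ_le_const2) (use B in auto)

section \<open>Weakly null sequences of functionals on bounded continuous functions\<close>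

lemma tendsto_fun_iff:
  fixes f :: "'a \<Rightarrow> nat \<Rightarrow> 'b::topological_space"
  shows "(f \<longlongrightarrow> l) F \<longleftrightarrow> (\<forall>k. ((\<lambda>x. f x k) \<longlongrightarrow> l k) F)"
  using limitin_componentwise[of "\<lambda>_. euclidean" UNIV f l F]
  by (simp add: euclidean_product_topology limitin_canonical_iff)

definition Cb :: "('e::topological_space \<Rightarrow> real) set" where
  "Cb = {f. continuous_on UNIV f \<and> bounded (range f)}"

lemma CbI: "continuous_on UNIV f \<Longrightarrow> (\<And>x. \<bar>f x\<bar> \<le> B) \<Longrightarrow> f \<in> Cb"
  unfolding Cb_def bounded_iff by auto

lemma Cb_bound: "f \<in> Cb \<Longrightarrow> \<exists>B>0. \<forall>x. \<bar>f x\<bar> \<le> B"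
  unfolding Cb_def bounded_pos by auto

lemma Cb_cont: "f \<in> Cb \<Longrightarrow> continuous_on UNIV f"
  unfolding Cb_def by auto

lemma Cb_lin: 
  assumes "f \<in> Cb" "g \<in> Cb" shows "(\<lambda>x. a * f x + g x) \<in> Cb"
proof -
  obtain B C where "\<forall>x. \<bar>f x\<bar> \<le> B" "\<forall>x. \<bar>g x\<bar> \<le> C" using assms Cb_bound by meson
  then have "\<bar>a * f x + g x\<bar> \<le> \<bar>a\<bar> * B + C" for x
    by (metis abs_mult abs_ge_zero abs_triangle_ineq add_mono mult_left_mono order_trans)
  then show ?thesis
    using assms by (intro CbI[where B = "\<bar>a\<bar> * B + C"] continuous_intros) (auto simp: Cb_cont)
qed

lemma Cb_zero: "(\<lambda>_. 0) \<in> Cb" by (rule CbI[where B = 0]) auto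

lemma Cb_lipschitz: "L-lipschitz_on UNIV (f :: _::metric_space \<Rightarrow> real) \<Longrightarrow> (\<And>x. \<bar>f x\<bar> \<le> B) \<Longrightarrow> f \<in> Cb"
  by (rule CbI) (auto intro: lipschitz_on_continuous_on)

text \<open>The functions are increments of running maxima of bumps rather than normalised bumps:
  partial sums telescope, and once some bump equals 1 the maximum is saturated and all later
  increments vanish. Saturation on whole balls yields local finiteness.\<close>

lemma partition_of_unity_separable:
  fixes D :: "'e::metric_space set"
  assumes D: "countable D" "closure D = UNIV" and \<delta>: "\<delta> > 0"
  obtains \<phi> :: "nat \<Rightarrow> 'e \<Rightarrow> real" and p where
    "\<And>k. continuous_on UNIV (\<phi> k)" "\<And>k y. 0 \<le> \<phi> k y" "\<And>k y. \<phi> k y \<noteq> 0 \<Longrightarrow> dist y (p k) < \<delta>"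
    "\<And>y. \<exists>U n. open U \<and> y \<in> U \<and> (\<forall>z\<in>U. \<forall>k\<ge>n. \<phi> k z = 0)"
    "\<And>y n. (\<forall>k\<ge>n. \<phi> k y = 0) \<Longrightarrow> (\<Sum>k<n. \<phi> k y) = 1"
proof -
  have Dne: "D \<noteq> {}" using D(2) by auto
  define p where "p = from_nat_into D"
  have p: "range p = D" unfolding p_def by (rule range_from_nat_into[OF Dne D(1)])
  \<comment> \<open>This bump is 1 within \<open>\<delta> / 2\<close> of \<open>p k\<close> and 0
    from distance \<delta> on.\<close>
  define g where "g k y = max 0 (min 1 (2 - 2 * dist y (p k) / \<delta>))" for k and y :: 'e
  define G where "G = rec_nat (\<lambda>y. 0) (\<lambda>n h y. max (h y) (g n y))"
  have G0: "G 0 y = 0" and GS: "G (Suc n) y = max (G n y) (g n y)" for n y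
    by (simp_all add: G_def)
  have contg: "continuous_on UNIV (g k)" for k
    unfolding g_def using \<delta> by (auto intro!: continuous_intros)
  have contG: "continuous_on UNIV (G n)" for n
    by (induction n) (auto simp: G0 GS[abs_def] fun_eq_iff intro!: continuous_intros contg cong: continuous_on_cong)
  have Gb: "0 \<le> G n y \<and> G n y \<le> 1" for n y
    by (induction n) (auto simp: G0 GS g_def)
  have mono: "G n y \<le> G m y" if "n \<le> m" for n m y
    using that by (induction m rule: dec_induct) (auto simp: GS)
  have G1: "G n y = 1" if "dist y (p k) \<le> \<delta> / 2" "k < n" for n y k
  proof -
    have "g k y = 1" using that(1) \<delta> by (auto simp: g_def field_simps)
    then have "G (Suc k) y = 1" using Gb[of k y] by (simp add: GS)
    then show ?thesis using mono[of "Suc k" n y] Gb[of n y] that(2) by auto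
  qed
  have near: "\<exists>k. dist y (p k) < \<delta>/2" for y
  proof -
    have "y \<in> closure D" using D(2) by simp
    then obtain d where "d \<in> D" "dist d y < \<delta>/2" 
      using \<delta> unfolding closure_approachable by (metis half_gt_zero)
    then show ?thesis using p by (metis dist_commute imageE)
  qed
  define \<phi> where "\<phi> k y = G (Suc k) y - G k y" for k y
  show thesis
  proof (rule that[of \<phi> p])
    show "continuous_on UNIV (\<phi> k)" for k
      unfolding \<phi>_def by (intro continuous_intros contG)
    show "0 \<le> \<phi> k y" for k y using mono[of k "Suc k" y] by (simp add: \<phi>_def)
    show "dist y (p k) < \<delta>" if "\<phi> k y \<noteq> 0" for k y
    proof -
      have "g k y > 0" using that Gb[of k y] by (auto simp: \<phi>_def GS max_def split: if_splits)
      then have "2 * dist y (p k) / \<delta> < 2" by (auto simp: g_def)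
      then show ?thesis using \<delta> by (simp add: divide_less_eq)
    qed
    show "\<exists>U n. open U \<and> y \<in> U \<and> (\<forall>z\<in>U. \<forall>k\<ge>n. \<phi> k z = 0)" for y
    proof -
      obtain j where j: "dist y (p j) < \<delta>/2" using near by blast
      have "\<forall>z\<in>ball (p j) (\<delta>/2). \<forall>k\<ge>Suc j. \<phi> k z = 0"
        using G1[of _ j] by (auto simp: \<phi>_def dist_commute less_imp_le)
      then show ?thesis using j by (intro exI[of _ "ball (p j) (\<delta>/2)"] exI[of _ "Suc j"]) (auto simp: dist_commute)
    qed
    fix y n assume *: "\<forall>k\<ge>n. \<phi> k y = 0"
    have "(\<Sum>k<n. \<phi> k y) = G n y" unfolding \<phi>_def using sum_lessThan_telescope[of "\<lambda>k. G k y" n] by (simp add: G0)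
    moreover have "G m y = G n y" if "m \<ge> n" for m
      using that * by (induction m rule: dec_induct) (auto simp: \<phi>_def)
    moreover obtain j where "dist y (p j) < \<delta>/2" using near by blast
    then have "G (max n (Suc j)) y = 1" using G1[of y j] by auto
    ultimately show "(\<Sum>k<n. \<phi> k y) = 1" by (metis max.cobounded1)
  qed
qed

text \<open>Models the real or imaginary part of the difference between an approximating complex
  measure and its limit, both weighted by a test function. \<open>sig\<close> is countable
  additivity in the form of bounded pointwise convergence; a general bounded functional on
  \<open>Cb\<close> can lack it.\<close>

locale weakly_null_functionals =
  fixes \<Lambda> :: "nat \<Rightarrow> ('e::metric_space \<Rightarrow> real) \<Rightarrow> real"
  assumes lin: "f \<in> Cb \<Longrightarrow> g \<in> Cb \<Longrightarrow> \<Lambda> n (\<lambda>x. a * f x + g x) = a * \<Lambda> n f + \<Lambda> n g"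
    and bnd: "\<exists>c\<ge>0. \<forall>f\<in>Cb. \<forall>B. (\<forall>x. \<bar>f x\<bar> \<le> B) \<longrightarrow> \<bar>\<Lambda> n f\<bar> \<le> c * B"
    and sig: "(\<And>k. h k \<in> Cb) \<Longrightarrow> (\<And>k x. \<bar>h k x\<bar> \<le> B) \<Longrightarrow> (\<And>x. (\<lambda>k. h k x) \<longlonglongrightarrow> g x) \<Longrightarrow> g \<in> Cb \<Longrightarrow>
       (\<lambda>k::nat. \<Lambda> n (h k)) \<longlonglongrightarrow> \<Lambda> n g"
    and null: "f \<in> Cb \<Longrightarrow> (\<lambda>n. \<Lambda> n f) \<longlonglongrightarrow> 0"
begin

lemma zero: "\<Lambda> n (\<lambda>_. 0) = 0"
  using lin[OF Cb_zero Cb_zero, of n 1] by simp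

lemma diff: "f \<in> Cb \<Longrightarrow> g \<in> Cb \<Longrightarrow> \<Lambda> n (\<lambda>x. f x - g x) = \<Lambda> n f - \<Lambda> n g"
  using lin[of g f n "-1"] by simp

lemma finite_sum: 
  assumes "\<And>k::nat. k < n \<Longrightarrow> f k \<in> Cb"
  shows "(\<lambda>x. \<Sum>k<n. c k * f k x) \<in> Cb \<and> \<Lambda> N (\<lambda>x. \<Sum>k<n. c k * f k x) = (\<Sum>k<n. c k * \<Lambda> N (f k))"
  using assms
proof (induction n)
  case (Suc n)
  then show ?case
    using Cb_lin[of "f n" "\<lambda>x. \<Sum>k<n. c k * f k x" "c n"] lin[of "f n" "\<lambda>x. \<Sum>k<n. c k * f k x" N "c n"]
    by (simp add: add.commute)
qed (simp add: zero Cb_zero)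

text \<open>Banach-Steinhaus on the complete space of bounded continuous functions:
  \<open>null\<close> makes every orbit bounded, and Baire's theorem provides a ball on which all
  functionals are bounded by one \<open>k\<close>.\<close>

lemma uniformly_bounded: "\<exists>M\<ge>0. \<forall>n. \<forall>f\<in>Cb. \<forall>B. (\<forall>x. \<bar>f x\<bar> \<le> B) \<longrightarrow> \<bar>\<Lambda> n f\<bar> \<le> M * B"
proof -
  define A where "A k = {\<phi>::'e \<Rightarrow>\<^sub>C real. \<forall>n. \<bar>\<Lambda> n (apply_bcontfun \<phi>)\<bar> \<le> real k}" for k
  have Cb: "apply_bcontfun \<phi> \<in> Cb" for \<phi> :: "'e \<Rightarrow>\<^sub>C real"
    using apply_bcontfun[of \<phi>] by (auto simp: bcontfun_def Cb_def)
  have cont: "continuous_on UNIV (\<lambda>\<phi>. \<Lambda> n (apply_bcontfun \<phi>))" for n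
  proof -
    obtain c where c: "c \<ge> 0" "\<And>f B. f\<in>Cb \<Longrightarrow> (\<forall>x. \<bar>f x\<bar> \<le> B) \<Longrightarrow> \<bar>\<Lambda> n f\<bar> \<le> c * B"
      using bnd[of n] by blast
    have "c-lipschitz_on UNIV (\<lambda>\<phi>. \<Lambda> n (apply_bcontfun \<phi>))"
    proof (rule lipschitz_onI)
      fix \<phi> \<psi> :: "'e \<Rightarrow>\<^sub>C real"
      have "\<bar>\<Lambda> n (\<lambda>x. \<phi> x - \<psi> x)\<bar> \<le> c * dist \<phi> \<psi>"
      proof (rule c(2))
        show "(\<lambda>x. \<phi> x - \<psi> x) \<in> Cb" using Cb_lin[OF Cb[of \<psi>] Cb[of \<phi>], of "-1"] by simp
        show "\<forall>x. \<bar>\<phi> x - \<psi> x\<bar> \<le> dist \<phi> \<psi>" using dist_bounded[of \<phi> _ \<psi>] by (simp add: dist_real_def)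
      qed
      then show "dist (\<Lambda> n \<phi>) (\<Lambda> n \<psi>) \<le> c * dist \<phi> \<psi>"
        by (simp add: diff[OF Cb Cb] dist_real_def)
    qed fact
    then show ?thesis by (rule lipschitz_on_continuous_on)
  qed
  have "closed (A k)" for k
    unfolding A_def by (intro closed_Collect_all closed_Collect_le continuous_intros cont)
  moreover have "\<exists>k. \<phi> \<in> A k" for \<phi>
  proof -
    have "Bseq (\<lambda>n. \<Lambda> n (apply_bcontfun \<phi>))" using null[OF Cb] convergentI convergent_imp_Bseq by blast
    then obtain K where "\<And>n. \<bar>\<Lambda> n \<phi>\<bar> \<le> K" unfolding Bseq_def by auto
    moreover obtain k :: nat where "K \<le> real k" using real_arch_simple by blast
    ultimately show ?thesis unfolding A_def by (auto intro: order_trans)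
  qed
  then have "(\<Union>k. A k) = UNIV" by auto
  ultimately obtain k \<phi> r where r: "r > 0" and ball: "ball \<phi> r \<subseteq> A k"
    using Baire_closed_cover by metis
  \<comment> \<open>The centre of the ball and its translate by \<open>f\<close>, scaled to norm at
    most \<open>r / 2\<close>, both lie in the ball. Hence
    \<open>r / (2 * B) * \<Lambda> n f\<close> is a difference of two values bounded by
    \<open>k\<close>, which gives the constant \<open>4 * k / r\<close>.\<close>
  have "\<bar>\<Lambda> n f\<bar> \<le> (4 * real k / r) * B" if f: "f \<in> Cb" and B: "\<forall>x. \<bar>f x\<bar> \<le> B" for n f B
  proof (cases "B > 0")
    case False
    obtain c where "\<bar>\<Lambda> n f\<bar> \<le> c * 0" using bnd[of n] f B False
      by (metis abs_ge_zero antisym_conv not_less order_trans)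
    then show ?thesis using False B by (metis abs_ge_zero abs_le_zero_iff antisym_conv mult_zero_right not_less order_refl order_trans)
  next
    case True
    define \<psi> where "\<psi> = Bcontfun f"
    have \<psi>: "apply_bcontfun \<psi> = f" unfolding \<psi>_def
      using f by (subst Bcontfun_inverse) (auto simp: bcontfun_def Cb_def)
    define \<xi> where "\<xi> = \<phi> + (r / (2 * B)) *\<^sub>R \<psi>"
    have \<xi>: "apply_bcontfun \<xi> = (\<lambda>x. (r / (2 * B)) * f x + \<phi> x)"
      by (auto simp: \<xi>_def plus_bcontfun.rep_eq scaleR_bcontfun.rep_eq \<psi>)
    have "dist \<phi> \<xi> \<le> r / 2"
    proof (rule dist_bound)
      fix x
      have "r / (2 * B) * \<bar>f x\<bar> \<le> r / (2 * B) * B" using B r True by (intro mult_left_mono) auto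
      then show "dist (\<phi> x) (\<xi> x) \<le> r / 2"
        using True r by (simp add: \<xi> dist_real_def abs_mult)
    qed
    then have "\<xi> \<in> A k" "\<phi> \<in> A k" using ball r by auto
    then have "\<bar>\<Lambda> n \<xi>\<bar> \<le> k" "\<bar>\<Lambda> n \<phi>\<bar> \<le> k" by (auto simp: A_def)
    then have "\<bar>r / (2 * B) * \<Lambda> n f\<bar> \<le> 2 * real k"
      unfolding \<xi> lin[OF f Cb] by linarith
    then have "r / (2 * B) * \<bar>\<Lambda> n f\<bar> \<le> 2 * real k" using r True by (simp add: abs_mult)
    then show ?thesis using r True by (simp add: field_simps)
  qed
  then show ?thesis using r by (intro exI[of _ "4 * real k / r"]) auto
qed

text \<open>A Schur property: a partition of unity codes functions close to \<open>F n\<close> by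
  coefficient sequences in \<open>[-B, B]\<close>, on which the functionals act like elements of
  \<open>l^1\<close>. Finitely many coefficients are handled by \<open>null\<close>, the remaining
  ones by Baire's theorem, uniformly in the sequence.\<close>

lemma equilipschitz_tendsto_zero:
  assumes D: "countable D" "closure D = (UNIV :: 'e set)"
    and lip: "\<And>n. L-lipschitz_on UNIV (F n)" and FB: "\<And>n x. \<bar>F n x\<bar> \<le> B"
  shows "(\<lambda>n. \<Lambda> n (F n)) \<longlonglongrightarrow> 0"
proof -
  obtain M where M: "M \<ge> 0" "\<And>n f B. f \<in> Cb \<Longrightarrow> (\<forall>x. \<bar>f x\<bar> \<le> B) \<Longrightarrow> \<bar>\<Lambda> n f\<bar> \<le> M * B"
    using uniformly_bounded by blast
  have L: "L \<ge> 0" by (rule lipschitz_on_nonneg[OF lip[of 0]])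
  have B: "B \<ge> 0" using FB[of 0 undefined] by simp
  have "\<forall>\<^sub>F n in sequentially. \<bar>\<Lambda> n (F n)\<bar> \<le> 4 * \<epsilon>" if \<epsilon>: "\<epsilon> > 0" for \<epsilon>
  proof -
    \<comment> \<open>Radius of the supports for which replacing \<open>F n\<close> by its values at
      the points \<open>p k\<close> costs at most \<open>M * L * \<delta>\<close>, hence at most
      \<epsilon>. The summand 1 keeps the denominator positive.\<close>
    define \<delta> where "\<delta> = \<epsilon> / (M * L + 1)"
    have \<delta>: "\<delta> > 0" using \<epsilon> M(1) L by (auto simp: \<delta>_def add_nonneg_pos)
    have MLdelta: "M * (L * \<delta>) \<le> \<epsilon>"
    proof -
      have "M * (L * \<delta>) \<le> (M * L + 1) * \<delta>" using \<delta> by (simp add: algebra_simps)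
      also have "\<dots> = \<epsilon>" using M(1) L unfolding \<delta>_def
        by (metis add_nonneg_pos less_irrefl mult_nonneg_nonneg nonzero_mult_div_cancel_left times_divide_eq_right zero_less_one)
      finally show ?thesis .
    qed
    obtain \<phi> :: "nat \<Rightarrow> 'e \<Rightarrow> real" and p where
      \<phi>: "\<And>k. continuous_on UNIV (\<phi> k)" "\<And>k y. 0 \<le> \<phi> k y" "\<And>k y. \<phi> k y \<noteq> 0 \<Longrightarrow> dist y (p k) < \<delta>"
      and fin: "\<And>y. \<exists>U n. open U \<and> y \<in> U \<and> (\<forall>z\<in>U. \<forall>k\<ge>n. \<phi> k z = 0)"
      and one: "\<And>y n. (\<forall>k\<ge>n. \<phi> k y = 0) \<Longrightarrow> (\<Sum>k<n. \<phi> k y) = 1"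
      using partition_of_unity_separable[OF D \<delta>] by blast
    define g where "g a y = (\<Sum>k. a k * \<phi> k y)" for a :: "nat \<Rightarrow> real" and y
    have g_fin: "g a y = (\<Sum>k<n. a k * \<phi> k y)" if "\<forall>k\<ge>n. \<phi> k y = 0" for a y n
      unfolding g_def by (rule suminf_finite) (use that in auto)
    have fin1: "\<exists>n. \<forall>k\<ge>n. \<phi> k y = 0" for y using fin[of y] by blast
    have g_bnd: "\<bar>g a y\<bar> \<le> C" if "\<And>k. \<bar>a k\<bar> \<le> C" for a y C
    proof -
      obtain n where n: "\<forall>k\<ge>n. \<phi> k y = 0" using fin1 by blast
      have "\<bar>g a y\<bar> \<le> (\<Sum>k<n. C * \<phi> k y)"
        unfolding g_fin[OF n] using that \<phi>(2)
        by (intro order_trans[OF sum_abs] sum_mono) (auto simp: abs_mult intro: mult_right_mono)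
      also have "\<dots> = C" by (simp add: sum_distrib_left[symmetric] one[OF n])
      finally show ?thesis .
    qed
    have g_cont: "continuous_on UNIV (g a)" for a
    proof -
      have "isCont (g a) y" for y
      proof -
        obtain U n where U: "open U" "y \<in> U" "\<forall>z\<in>U. \<forall>k\<ge>n. \<phi> k z = 0" using fin[of y] by blast
        have "continuous_on U (g a)"
          by (subst continuous_on_cong[OF refl, of U _ "\<lambda>z. \<Sum>k<n. a k * \<phi> k z"])
            (use U g_fin in \<open>auto intro!: continuous_intros continuous_on_subset[OF \<phi>(1)]\<close>)
        then show ?thesis using U(1,2) continuous_on_eq_continuous_at by blast
      qed
      then show ?thesis by (simp add: continuous_at_imp_continuous_on)
    qed
    have g_Cb: "g a \<in> Cb" if "\<And>k. \<bar>a k\<bar> \<le> C" for a C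
      by (rule CbI[OF g_cont g_bnd[OF that]])
    have g_diff: "g a y - g b y = g (\<lambda>k. a k - b k) y" for a b y
    proof -
      obtain n where n: "\<forall>k\<ge>n. \<phi> k y = 0" using fin1 by blast
      show ?thesis unfolding g_fin[OF n] by (simp add: sum_subtractf left_diff_distrib)
    qed
    have g_lim: "(\<lambda>j. g (a j) y) \<longlonglongrightarrow> g b y" if "\<And>k. (\<lambda>j. a j k) \<longlonglongrightarrow> b k" for a b y
    proof -
      obtain n where n: "\<forall>k\<ge>n. \<phi> k y = 0" using fin1 by blast
      show ?thesis unfolding g_fin[OF n] by (intro tendsto_intros that)
    qed
    define cl where "cl a k = max (- B) (min B (a k))" for a :: "nat \<Rightarrow> real" and k :: nat
    have cl_b: "\<bar>cl a k\<bar> \<le> B" for a k using B by (auto simp: cl_def)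
    have cl_id: "cl a k = a k" if "\<bar>a k\<bar> \<le> B" for a k using that by (auto simp: cl_def)
    \<comment> \<open>Clamping the coefficients makes all of \<open>nat \<Rightarrow> real\<close>, a complete metric space, available for Baire's theorem.
      A ball contains a cylinder, so subtracting two of its points isolates the tail of \<open>g a\<close>.\<close>
    define A where "A k = {a::nat \<Rightarrow> real. \<forall>N\<ge>k. \<bar>\<Lambda> N (g (cl a))\<bar> \<le> \<epsilon>}" for k :: nat
    \<comment> \<open>Each point meets finitely many \<open>\<phi> k\<close>, so coordinatewise
      convergence of clamped coefficients is bounded pointwise convergence of the functions; this is
      where \<open>sig\<close> enters.\<close>
    have cont: "continuous_on UNIV (\<lambda>a. \<Lambda> N (g (cl a)))" for N
      unfolding continuous_on_sequentially
    proof (intro allI ballI impI)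
      fix a b assume "(\<forall>n. a n \<in> (UNIV :: (nat \<Rightarrow> real) set)) \<and> a \<longlonglongrightarrow> b"
      then have "(\<lambda>j. a j k) \<longlonglongrightarrow> b k" for k by (simp add: tendsto_fun_iff)
      then have "(\<lambda>j. cl (a j) k) \<longlonglongrightarrow> cl b k" for k unfolding cl_def by (intro tendsto_intros)
      then have "(\<lambda>j. g (cl (a j)) y) \<longlonglongrightarrow> g (cl b) y" for y by (rule g_lim)
      then show "((\<lambda>a. \<Lambda> N (g (cl a))) \<circ> a) \<longlonglongrightarrow> \<Lambda> N (g (cl b))"
        unfolding o_def by (intro sig[where B = B] g_Cb[where C = B] g_bnd cl_b) auto
    qed
    have "closed (A k)" for k
    proof -
      have "A k = (\<Inter>N\<in>{k..}. {a. \<bar>\<Lambda> N (g (cl a))\<bar> \<le> \<epsilon>})" by (auto simp: A_def)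
      then show ?thesis by (auto intro!: closed_INT closed_Collect_le continuous_intros cont)
    qed
    moreover have "\<exists>k. a \<in> A k" for a
    proof -
      have "(\<lambda>N. \<bar>\<Lambda> N (g (cl a))\<bar>) \<longlonglongrightarrow> 0" using null[OF g_Cb[OF cl_b]] by (rule tendsto_rabs_zero)
      then have "\<forall>\<^sub>F N in sequentially. \<bar>\<Lambda> N (g (cl a))\<bar> < \<epsilon>" by (rule order_tendstoD) (rule \<epsilon>)
      then show ?thesis unfolding A_def eventually_sequentially by (auto intro: less_imp_le)
    qed
    then have "(\<Union>k. A k) = UNIV" by auto
    ultimately obtain k0 a0 r where r: "r > 0" and ball: "ball a0 r \<subseteq> A k0"
      using Baire_closed_cover by metis
    have "\<exists>n. \<forall>a. (\<forall>k<n. a k = a0 k) \<longrightarrow> a \<in> ball a0 r"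
    proof (rule ccontr)
      assume "\<not> ?thesis"
      then obtain b where b: "\<And>n k. k < n \<Longrightarrow> b n k = a0 k" "\<And>n. b n \<notin> ball a0 r" by metis
      have "b \<longlonglongrightarrow> a0"
        unfolding tendsto_fun_iff
      proof
        fix k
        have "\<forall>\<^sub>F n in sequentially. b n k = a0 k" using eventually_gt_at_top[of k] by eventually_elim (rule b(1))
        then show "(\<lambda>n. b n k) \<longlonglongrightarrow> a0 k" by (rule tendsto_eventually)
      qed
      then have "\<forall>\<^sub>F n in sequentially. b n \<in> ball a0 r"
        by (rule topological_tendstoD) (use r in auto)
      then show False using b(2) by (auto simp: eventually_sequentially)
    qed
    then obtain n where n: "\<And>a. (\<forall>k<n. a k = a0 k) \<Longrightarrow> a \<in> A k0" using ball by blast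
    have tail: "\<bar>\<Lambda> N (g (\<lambda>k. if k < n then 0 else a k))\<bar> \<le> 2 * \<epsilon>" if a: "\<And>k. \<bar>a k\<bar> \<le> B" and N: "N \<ge> k0" for a N
    proof -
      define b where "b k = (if k < n then a0 k else a k)" for k
      define c where "c k = (if k < n then a0 k else 0)" for k
      have "b \<in> A k0" "c \<in> A k0" by (auto intro!: n simp: b_def c_def)
      then have "\<bar>\<Lambda> N (g (cl b))\<bar> \<le> \<epsilon>" "\<bar>\<Lambda> N (g (cl c))\<bar> \<le> \<epsilon>" using N by (auto simp: A_def)
      moreover have "(\<lambda>k. if k < n then 0 else a k) = (\<lambda>k. cl b k - cl c k)"
      proof
        fix k
        show "(if k < n then 0 else a k) = cl b k - cl c k"
          using a[of k] B by (simp add: b_def c_def cl_def)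
      qed
      then have "\<Lambda> N (g (\<lambda>k. if k < n then 0 else a k)) = \<Lambda> N (g (cl b)) - \<Lambda> N (g (cl c))"
        using diff[OF g_Cb[where a = "cl b", OF cl_b] g_Cb[where a = "cl c", OF cl_b], of N] by (simp add: g_diff)
      ultimately show ?thesis by linarith
    qed
    have \<phi>_Cb: "\<phi> k \<in> Cb" for k
    proof (rule CbI[OF \<phi>(1)])
      fix y
      obtain n where n: "\<forall>k\<ge>n. \<phi> k y = 0" using fin1 by blast
      then have "\<phi> k y \<le> (\<Sum>k<max n (Suc k). \<phi> k y)"
        by (intro member_le_sum) (use \<phi>(2) in auto)
      also have "\<dots> = 1" using n by (intro one) auto
      finally show "\<bar>\<phi> k y\<bar> \<le> 1" using \<phi>(2)[of k y] by simp
    qed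
    \<comment> \<open>One \<epsilon> pays for replacing \<open>F N\<close> by \<open>g a\<close> and
      two for the tail. The head remains as a finite sum that vanishes as \<open>N\<close>
      grows.\<close>
    have main: "\<bar>\<Lambda> N (F N)\<bar> \<le> 3 * \<epsilon> + (\<Sum>k<n. B * \<bar>\<Lambda> N (\<phi> k)\<bar>)" if N: "N \<ge> k0" for N
    proof -
      define a where "a k = F N (p k)" for k
      have a: "\<bar>a k\<bar> \<le> B" for k by (simp add: a_def FB)
      have F_Cb: "F N \<in> Cb" by (rule Cb_lipschitz[OF lip FB])
      have "\<bar>F N y - g a y\<bar> \<le> L * \<delta>" for y
      proof -
        obtain n where n: "\<forall>k\<ge>n. \<phi> k y = 0" using fin1 by blast
        have "F N y = (\<Sum>k<n. F N y * \<phi> k y)" by (simp add: sum_distrib_left[symmetric] one[OF n])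
        then have "F N y - g a y = (\<Sum>k<n. (F N y - a k) * \<phi> k y)"
          unfolding g_fin[OF n] by (simp add: sum_subtractf left_diff_distrib)
        also have "\<bar>\<dots>\<bar> \<le> (\<Sum>k<n. (L * \<delta>) * \<phi> k y)"
        proof (intro order_trans[OF sum_abs] sum_mono)
          fix k
          show "\<bar>(F N y - a k) * \<phi> k y\<bar> \<le> L * \<delta> * \<phi> k y"
          proof (cases "\<phi> k y = 0")
            case False
            have "\<bar>F N y - a k\<bar> \<le> L * dist y (p k)"
              using lipschitz_onD[OF lip, of y "p k" N] by (simp add: a_def dist_real_def)
            also have "\<dots> \<le> L * \<delta>" using \<phi>(3)[OF False] L by (intro mult_left_mono) auto
            finally show ?thesis using \<phi>(2)[of k y] by (auto simp: abs_mult intro: mult_right_mono)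
          qed simp
        qed
        also have "\<dots> = L * \<delta>" by (simp add: sum_distrib_left[symmetric] one[OF n])
        finally show ?thesis .
      qed
      then have 1: "\<bar>\<Lambda> N (\<lambda>y. F N y - g a y)\<bar> \<le> M * (L * \<delta>)"
        using Cb_lin[OF g_Cb[OF a] F_Cb, of "-1"] by (intro M(2)) auto
      define t where "t = g (\<lambda>k. if k < n then 0 else a k)"
      have t_Cb: "t \<in> Cb" unfolding t_def by (rule g_Cb[where C = B]) (use a B in auto)
      have "g a y - t y = (\<Sum>k<n. a k * \<phi> k y)" for y
        unfolding t_def g_diff unfolding g_def by (subst suminf_finite[of "{..<n}"]) (auto intro: sum.cong)
      then have "\<Lambda> N (g a) - \<Lambda> N t = (\<Sum>k<n. a k * \<Lambda> N (\<phi> k))"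
        using diff[OF g_Cb[where a = a, OF a] t_Cb, of N] finite_sum[of n \<phi> a N] \<phi>_Cb by simp
      moreover have "\<bar>\<Sum>k<n. a k * \<Lambda> N (\<phi> k)\<bar> \<le> (\<Sum>k<n. B * \<bar>\<Lambda> N (\<phi> k)\<bar>)"
        using a by (intro order_trans[OF sum_abs] sum_mono) (auto simp: abs_mult intro: mult_right_mono)
      moreover have "\<bar>\<Lambda> N t\<bar> \<le> 2 * \<epsilon>" unfolding t_def by (rule tail[OF a N])
      moreover have "\<Lambda> N (\<lambda>y. F N y - g a y) = \<Lambda> N (F N) - \<Lambda> N (g a)"
        by (rule diff[OF F_Cb g_Cb[OF a]])
      ultimately show ?thesis using 1 MLdelta by linarith
    qed
    have "(\<lambda>N. \<Sum>k<n. B * \<bar>\<Lambda> N (\<phi> k)\<bar>) \<longlonglongrightarrow> (\<Sum>k<n. B * 0)"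
      by (intro tendsto_intros tendsto_rabs_zero null \<phi>_Cb)
    then have "\<forall>\<^sub>F N in sequentially. (\<Sum>k<n. B * \<bar>\<Lambda> N (\<phi> k)\<bar>) < \<epsilon>"
      by (intro order_tendstoD(2)[where a = \<epsilon>]) (use \<epsilon> in auto)
    then show ?thesis
      using eventually_ge_at_top[of k0] by eventually_elim (use main in fastforce)
  qed
  then have "\<forall>\<^sub>F n in sequentially. \<bar>\<Lambda> n (F n)\<bar> < e" if "e > 0" for e
    using that by (auto dest!: meta_spec[of _ "e / 8"] elim!: eventually_mono)
  then show ?thesis by (intro tendstoI) (auto simp: dist_real_def)
qed

end

section \<open>Path spaces and the Markov property\<close>

text \<open>\<open>S\<close> may fail to be measurable, and then extension by zero may fail too. The
  superlevel sets of \<open>f\<close> at rational heights are traces on \<open>S\<close> of sets of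
  \<open>M\<close>, and these sets rebuild an extension as a supremum of step functions.\<close>

lemma borel_measurable_restrict_extend:
  fixes f :: "'a \<Rightarrow> real"
  assumes f: "f \<in> borel_measurable (restrict_space M S)" and S: "S \<subseteq> space M"
    and B: "\<And>x. x \<in> S \<Longrightarrow> \<bar>f x\<bar> \<le> B"
  obtains g where "g \<in> borel_measurable M" "\<And>x. \<bar>g x\<bar> \<le> \<bar>B\<bar>" "\<And>x. x \<in> S \<Longrightarrow> g x = f x"
proof -
  have "\<exists>A\<in>sets M. {x\<in>S. of_rat q < f x} = S \<inter> A" for q :: rat
  proof -
    have "{x\<in>space (restrict_space M S). of_rat q < f x} \<in> sets (restrict_space M S)"
      using f by measurable
    then show ?thesis using S by (auto simp: sets_restrict_space space_restrict_space Int_absorb1 Int_absorb2)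
  qed
  then obtain A where A: "\<And>q. A q \<in> sets M" "\<And>q. {x\<in>S. of_rat q < f x} = S \<inter> A q" by metis
  define B' where "B' = \<bar>B\<bar>"
  \<comment> \<open>Heights above \<open>B'\<close> are discarded and the default is
    \<open>- B'\<close>, because off \<open>S\<close> the chosen sets \<open>A q\<close> need not be
    nested and give no bound by themselves.\<close>
  define G where "G (q::rat) x = (if x \<in> A q \<and> of_rat q \<le> B' then max (- B') (of_rat q) else - B')" for q x
  define g where "g x = (SUP q. G q x)" for x
  have B0: "B' \<ge> 0" by (simp add: B'_def)
  have Gb: "- B' \<le> G q x" "G q x \<le> B'" for q x using B0 by (auto simp: G_def)
  have bdd: "bdd_above (range (\<lambda>q. G q x))" for x using Gb by (intro bdd_aboveI[of _ B']) auto
  have "(\<lambda>x. G q x) \<in> borel_measurable M" for q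
    unfolding G_def using A(1)[of q] by measurable
  then have 1: "g \<in> borel_measurable M"
    unfolding g_def by (intro borel_measurable_cSUP bdd) auto
  have "- B' \<le> g x" for x
    unfolding g_def by (rule cSUP_upper2[OF bdd UNIV_I]) (rule Gb(1)[of 0])
  moreover have "g x \<le> B'" for x unfolding g_def by (rule cSUP_least) (use Gb in auto)
  ultimately have 2: "\<bar>g x\<bar> \<le> \<bar>B\<bar>" for x by (simp add: abs_le_iff minus_le_iff B'_def)
  have "g x = f x" if x: "x \<in> S" for x
  proof (rule antisym)
    have xA: "x \<in> A q \<longleftrightarrow> of_rat q < f x" for q using A(2)[of q] x by auto
    have fB: "- B' \<le> f x" "f x \<le> B'" using B[OF x] by (auto simp: B'_def abs_le_iff)
    show "g x \<le> f x" unfolding g_def by (rule cSUP_least) (use xA fB in \<open>auto simp: G_def\<close>)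
    show "f x \<le> g x"
    proof (rule dense_le)
      fix y assume "y < f x"
      then obtain q where q: "y < of_rat q" "of_rat q < f x" using of_rat_dense by blast
      have "G q x = max (- B') (of_rat q)" using q fB xA by (auto simp: G_def)
      then have "y \<le> G q x" using q by auto
      also have "\<dots> \<le> g x" unfolding g_def by (rule cSUP_upper[OF UNIV_I bdd])
      finally show "y \<le> g x" .
    qed
  qed
  then show thesis using that[OF 1 2] by blast
qed

text \<open>Rounding \<open>t\<close> up to a grid of mesh \<open>1 / Suc n\<close> gives functions
  of the pair that are pieced together from countably many sections measurable in \<open>w\<close>;
  right continuity identifies their limit.\<close>

lemma measurable_right_continuous:
  fixes \<phi> :: "real \<Rightarrow> 'w \<Rightarrow> real"
  assumes m[measurable]: "\<And>t. t \<ge> 0 \<Longrightarrow> \<phi> t \<in> borel_measurable M"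
    and rc: "\<And>t w. t \<ge> 0 \<Longrightarrow> w \<in> space M \<Longrightarrow> continuous (at_right t) (\<lambda>s. \<phi> s w)"
  shows "(\<lambda>(t, w). \<phi> (max 0 t) w) \<in> borel_measurable (borel \<Otimes>\<^sub>M M)"
proof -
  \<comment> \<open>The summand 1 makes the grid time strictly larger than \<open>max 0 t\<close>,
    so the approach is from the right only.\<close>
  define s where "s n t = (real (nat \<lfloor>real (Suc n) * max 0 t\<rfloor>) + 1) / real (Suc n)" for n t
  have s0: "s n t > max 0 t" "s n t \<le> max 0 t + 1 / real (Suc n)" for n t
  proof -
    have "real (nat \<lfloor>real (Suc n) * max 0 t\<rfloor>) = of_int \<lfloor>real (Suc n) * max 0 t\<rfloor>" by simp
    then have "real (Suc n) * max 0 t < real (nat \<lfloor>real (Suc n) * max 0 t\<rfloor>) + 1"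
      "real (nat \<lfloor>real (Suc n) * max 0 t\<rfloor>) \<le> real (Suc n) * max 0 t" by linarith+
    then show "s n t > max 0 t" "s n t \<le> max 0 t + 1 / real (Suc n)"
      unfolding s_def by (simp_all add: less_divide_eq divide_le_eq algebra_simps del: of_nat_Suc)
  qed
  have lim: "(\<lambda>n. \<phi> (s n t) w) \<longlonglongrightarrow> \<phi> (max 0 t) w" if "w \<in> space M" for t w
  proof -
    have "filterlim (\<lambda>n. s n t) (at_right (max 0 t)) sequentially"
      unfolding filterlim_at
    proof
      have up: "(\<lambda>n. max 0 t + 1 / real (Suc n)) \<longlonglongrightarrow> max 0 t"
        using tendsto_add[OF tendsto_const[of "max 0 t"] LIMSEQ_inverse_real_of_nat] by (simp add: inverse_eq_divide)
      show "(\<lambda>n. s n t) \<longlonglongrightarrow> max 0 t"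
      proof (rule tendsto_sandwich[OF _ _ tendsto_const up])
        show "\<forall>\<^sub>F n in sequentially. max 0 t \<le> s n t" 
          by (rule always_eventually) (simp only: s0(1) less_imp_le simp_thms)
        show "\<forall>\<^sub>F n in sequentially. s n t \<le> max 0 t + 1 / real (Suc n)" 
          by (rule always_eventually) (simp only: s0(2) simp_thms)
      qed
      show "\<forall>\<^sub>F n in sequentially. s n t \<in> {max 0 t<..} \<and> s n t \<noteq> max 0 t"
        using s0 by (intro always_eventually allI) (metis greaterThan_iff less_irrefl)
    qed
    moreover have "((\<lambda>s. \<phi> s w) \<longlongrightarrow> \<phi> (max 0 t) w) (at_right (max 0 t))"
      using rc[of "max 0 t" w] that by (simp add: continuous_within)
    ultimately show ?thesis using filterlim_compose by blast
  qed
  show ?thesis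
  proof (rule borel_measurable_LIMSEQ_real)
    show "(\<lambda>n. (case x of (t, w) \<Rightarrow> \<phi> (s n t) w)) \<longlonglongrightarrow> (case x of (t, w) \<Rightarrow> \<phi> (max 0 t) w)"
      if "x \<in> space (borel \<Otimes>\<^sub>M M)" for x
      using that lim by (auto simp: space_pair_measure)
    fix n
    have "(\<lambda>x. \<phi> ((real (nat \<lfloor>real (Suc n) * max 0 (fst x)\<rfloor>) + 1) / real (Suc n)) (snd x)) \<in> borel_measurable (borel \<Otimes>\<^sub>M M)"
    proof (rule measurable_compose_countable[where g = "\<lambda>x. nat \<lfloor>real (Suc n) * max 0 (fst x)\<rfloor>"])
      fix k :: nat
      have "\<phi> ((real k + 1) / real (Suc n)) \<in> borel_measurable M" by (rule m) simp
      then show "(\<lambda>x. \<phi> ((real k + 1) / real (Suc n)) (snd x)) \<in> borel_measurable (borel \<Otimes>\<^sub>M M)"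
        by (rule measurable_compose[OF measurable_snd])
    qed measurable
    then show "(\<lambda>x. case x of (t, w) \<Rightarrow> \<phi> (s n t) w) \<in> borel_measurable (borel \<Otimes>\<^sub>M M)"
      by (simp add: s_def split_beta)
  qed
qed

section \<open>Sigma-algebras on path spaces and the Markov property for laws\<close>

lemma space_path_space[simp]: "space (path_space \<Omega>) = \<Omega>"
  unfolding path_space_def by (rule space_measure_of) auto

lemma measurable_eval_path_space:
  assumes "t \<ge> 0" shows "(\<lambda>\<omega>. \<omega> t) \<in> measurable (path_space \<Omega>) borel"
proof (rule measurableI)
  fix A :: "'a set" assume "A \<in> sets borel"
  then have "{\<omega>\<in>\<Omega>. \<omega> t \<in> A} \<in> sets (path_space \<Omega>)"
    unfolding path_space_def by (subst sets_measure_of) (use assms in \<open>auto intro!: sigma_sets.Basic\<close>)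
  moreover have "(\<lambda>\<omega>. \<omega> t) -` A \<inter> space (path_space \<Omega>) = {\<omega>\<in>\<Omega>. \<omega> t \<in> A}" by auto
  ultimately show "(\<lambda>\<omega>. \<omega> t) -` A \<inter> space (path_space \<Omega>) \<in> sets (path_space \<Omega>)" by simp
qed auto

lemma measurable_into_path_space:
  assumes "\<And>x. x \<in> space M \<Longrightarrow> X x \<in> \<Omega>" "\<And>t. t \<ge> 0 \<Longrightarrow> (\<lambda>x. X x t) \<in> measurable M borel"
  shows "X \<in> measurable M (path_space \<Omega>)"
  unfolding path_space_def
proof (rule measurable_measure_of)
  show "X \<in> space M \<rightarrow> \<Omega>" using assms(1) by auto
  fix y assume "y \<in> {{\<omega> \<in> \<Omega>. \<omega> t \<in> A} |t A. 0 \<le> t \<and> A \<in> sets borel}"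
  then obtain t A where y: "y = {\<omega> \<in> \<Omega>. \<omega> t \<in> A}" "0 \<le> t" "A \<in> sets borel" by auto
  have "X -` y \<inter> space M = (\<lambda>x. X x t) -` A \<inter> space M" using assms(1) y(1) by auto
  then show "X -` y \<inter> space M \<in> sets M" using measurable_sets[OF assms(2)[OF y(2)] y(3)] by simp
qed auto

text \<open>Single-time events are not stable under intersection. Cylinders over finitely many times
  are, as the uniqueness theorem for measures requires.\<close>

lemma sets_path_space_cylinders:
  "sets (path_space \<Omega>) = sigma_sets \<Omega> {{\<omega>\<in>\<Omega>. \<forall>r\<in>R. \<omega> r \<in> A r} | R A. finite R \<and> R \<subseteq> {0..} \<and> (\<forall>r. A r \<in> sets borel)}"
  (is "_ = sigma_sets \<Omega> ?E")
proof
  show "sets (path_space \<Omega>) \<subseteq> sigma_sets \<Omega> ?E"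
    unfolding path_space_def
  proof (subst sets_measure_of, force, rule sigma_sets_mono', rule subsetI)
    fix X assume "X \<in> {{\<omega> \<in> \<Omega>. \<omega> t \<in> A} |t A. 0 \<le> t \<and> A \<in> sets borel}"
    then obtain t A where "X = {\<omega> \<in> \<Omega>. \<omega> t \<in> A}" "0 \<le> t" "A \<in> sets borel" by auto
    then show "X \<in> ?E" by (intro CollectI exI[of _ "{t}"] exI[of _ "\<lambda>_. A"]) auto
  qed
  have "?E \<subseteq> sets (path_space \<Omega>)"
  proof
    fix X assume "X \<in> ?E"
    then obtain R A where X: "X = {\<omega>\<in>\<Omega>. \<forall>r\<in>R. \<omega> r \<in> A r}" "finite R" "R \<subseteq> {0..}" "\<And>r. A r \<in> sets borel" by auto
    have "{\<omega>\<in>space (path_space \<Omega>). \<forall>r\<in>R. \<omega> r \<in> A r} \<in> sets (path_space \<Omega>)"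
    proof (rule sets.sets_Collect_finite_All[OF _ X(2)])
      fix r assume "r \<in> R"
      then have "(\<lambda>\<omega>. \<omega> r) -` A r \<inter> space (path_space \<Omega>) \<in> sets (path_space \<Omega>)"
        using X(3,4) by (intro measurable_sets[OF measurable_eval_path_space]) auto
      then show "{\<omega> \<in> space (path_space \<Omega>). \<omega> r \<in> A r} \<in> sets (path_space \<Omega>)"
        by (simp add: vimage_def Int_def conj_commute)
    qed
    then show "X \<in> sets (path_space \<Omega>)" by (simp add: X(1))
  qed
  then show "sigma_sets \<Omega> ?E \<subseteq> sets (path_space \<Omega>)"
    using sets.sigma_sets_subset[of ?E "path_space \<Omega>"] by simp
qed

lemma bdd_measI: "f \<in> borel_measurable borel \<Longrightarrow> (\<And>x. \<bar>f x\<bar> \<le> B) \<Longrightarrow> bdd_meas f"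
  unfolding bdd_meas_def bounded_iff by auto

lemma bdd_meas_mult: "bdd_meas f \<Longrightarrow> bdd_meas g \<Longrightarrow> bdd_meas (\<lambda>x. f x * g x)"
proof -
  assume f: "bdd_meas f" and g: "bdd_meas g"
  then obtain B C where "\<And>x. \<bar>f x\<bar> \<le> B" "\<And>x. \<bar>g x\<bar> \<le> C" unfolding bdd_meas_def bounded_iff by auto
  then have "\<bar>f x * g x\<bar> \<le> B * C" for x unfolding abs_mult by (intro mult_mono) (auto intro: order_trans[OF abs_ge_zero])
  then show ?thesis using f g by (intro bdd_measI) (auto simp: bdd_meas_def)
qed

text \<open>Closure under shifts puts a shifted path back into \<open>\<Omega>\<close>, so that the
  Markov property can be turned into an identity between laws on
  \<open>path_space \<Omega>\<close>.\<close>

locale markov_paths =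
  fixes S :: "'e::topological_space set" and \<Omega> :: "(real \<Rightarrow> 'e) set" and P
  assumes markov_fam: "markov_family S \<Omega> P"
    and shift_closed: "\<omega> \<in> \<Omega> \<Longrightarrow> 0 \<le> t \<Longrightarrow> (\<lambda>s. \<omega> (t + s)) \<in> \<Omega>"
begin

lemma path_in: "\<omega> \<in> \<Omega> \<Longrightarrow> 0 \<le> t \<Longrightarrow> \<omega> t \<in> S"
  using markov_fam unfolding markov_family_def by auto

lemma kernel[measurable]: "P \<in> measurable (restrict_space borel S) (subprob_algebra (path_space \<Omega>))"
  using markov_fam unfolding markov_family_def by auto

lemma prob: "x \<in> S \<Longrightarrow> prob_space (P x)"
  using markov_fam unfolding markov_family_def by auto

lemma start: "x \<in> S \<Longrightarrow> AE \<omega> in P x. \<omega> 0 = x"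
  using markov_fam unfolding markov_family_def by auto

lemma markov: 
  assumes "x \<in> S" "0 \<le> s" "0 \<le> t" "\<And>i::nat. i < n \<Longrightarrow> 0 \<le> ss i \<and> ss i \<le> s \<and> bdd_meas (gs i)" "bdd_meas f"
  shows "(\<integral>\<omega>. (\<Prod>i<n. gs i (\<omega> (ss i))) * f (\<omega> (s + t)) \<partial>P x)
          = (\<integral>\<omega>. (\<Prod>i<n. gs i (\<omega> (ss i))) * trans_op P t f (\<omega> s) \<partial>P x)"
  using markov_fam assms unfolding markov_family_def by blast

lemma space_restrict_S[simp]: "space (restrict_space borel S) = S"
  by (simp add: space_restrict_space)

lemma sets_P[measurable_cong]: "x \<in> S \<Longrightarrow> sets (P x) = sets (path_space \<Omega>)"
  using sets_kernel[OF kernel] by auto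

lemma space_P: "x \<in> S \<Longrightarrow> space (P x) = \<Omega>"
  using sets_eq_imp_space_eq[OF sets_P] by simp

lemma eval_S: "t \<ge> 0 \<Longrightarrow> (\<lambda>\<omega>. \<omega> t) \<in> measurable (path_space \<Omega>) (restrict_space borel S)"
  by (rule measurable_restrict_space2) (auto intro: path_in measurable_eval_path_space)

lemma shift_measurable: "t \<ge> 0 \<Longrightarrow> (\<lambda>\<omega> s. \<omega> (t + s)) \<in> measurable (path_space \<Omega>) (path_space \<Omega>)"
  by (rule measurable_into_path_space) (auto intro: shift_closed measurable_eval_path_space)

lemma trans_op_measurable:
  assumes "f \<in> borel_measurable (restrict_space borel S)" "t \<ge> 0"
  shows "trans_op P t f \<in> borel_measurable (restrict_space borel S)"
  unfolding trans_op_def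
  by (rule measurable_compose[OF kernel integral_measurable_subprob_algebra])
    (rule measurable_compose[OF eval_S[OF assms(2)] assms(1)])

text \<open>When \<open>H\<close> is not integrable its integral is 0 by convention, and
  \<open>B \<ge> 0\<close> settles that case.\<close>

lemma integral_bound:
  fixes H :: "_ \<Rightarrow> real"
  assumes "x \<in> S" "\<And>\<omega>. \<omega> \<in> \<Omega> \<Longrightarrow> \<bar>H \<omega>\<bar> \<le> B" "B \<ge> 0"
  shows "\<bar>\<integral>\<omega>. H \<omega> \<partial>P x\<bar> \<le> B"
proof (cases "integrable (P x) H")
  case True
  interpret prob_space "P x" by (rule prob[OF assms(1)])
  have "\<bar>\<integral>\<omega>. H \<omega> \<partial>P x\<bar> \<le> (\<integral>\<omega>. \<bar>H \<omega>\<bar> \<partial>P x)"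
    using integral_norm_bound[of "P x" H] by simp
  also have "\<dots> \<le> B"
    by (rule integral_le_const) (use True assms in \<open>auto simp: space_P\<close>)
  finally show ?thesis .
next
  case False
  then show ?thesis using assms(3) by (simp add: not_integrable_integral_eq)
qed

lemma trans_op_bound:
  assumes "x \<in> S" "t \<ge> 0" "\<And>y. y \<in> S \<Longrightarrow> \<bar>f y\<bar> \<le> B" "B \<ge> 0"
  shows "\<bar>trans_op P t f x\<bar> \<le> B"
  unfolding trans_op_def by (rule integral_bound) (use assms in \<open>auto intro: path_in\<close>)

text \<open>Induction removes the largest time \<open>b\<close>: the Markov property at the
  preceding time \<open>c\<close> replaces the factor at \<open>b\<close> by its transition
  operator, which is merged into the factor at \<open>c\<close>.\<close>

lemma finite_markov:
  assumes "finite R" "R \<noteq> {}" "R \<subseteq> {0..}" "\<And>r. bdd_meas (h r)" "x \<in> S" "t \<ge> 0"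
  shows "(\<integral>\<omega>. (\<Prod>r\<in>R. h r (\<omega> (t + r))) \<partial>P x) = (\<integral>\<omega>. (\<integral>\<omega>'. (\<Prod>r\<in>R. h r (\<omega>' r)) \<partial>P (\<omega> t)) \<partial>P x)"
  using assms
proof (induction R arbitrary: h rule: finite_linorder_max_induct)
  case empty
  then show ?case by simp
next
  case (insert b R)
  then have b: "b \<ge> 0" by auto
  show ?case
  proof (cases "R = {}")
    case True
    then show ?thesis using markov[of x t b 0 undefined undefined "h b"] insert.prems b
      by (simp add: trans_op_def)
  next
    case False
    define c where "c = Max R"
    have c: "c \<in> R" "c < b" "\<And>r. r \<in> R \<Longrightarrow> r \<le> c"
      using insert.hyps False by (auto simp: c_def)
    then have c0: "c \<ge> 0" using insert.prems by auto
    have hb: "bdd_meas (h b)" by (rule insert.prems)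
    then obtain B where B: "\<And>y. \<bar>h b y\<bar> \<le> B" unfolding bdd_meas_def bounded_iff by auto
    then have B0: "B \<ge> 0" by (meson abs_ge_zero order_trans)
    \<comment> \<open>The induction hypothesis takes bounded Borel functions on the whole space,
      whereas the transition operator is known to be measurable on \<open>S\<close> only.
      \<open>Q\<close> agrees with it wherever paths live.\<close>
    obtain Q where Q: "Q \<in> borel_measurable borel" "\<And>y. \<bar>Q y\<bar> \<le> \<bar>B\<bar>"
       "\<And>y. y \<in> S \<Longrightarrow> Q y = trans_op P (b - c) (h b) y"
    proof (rule borel_measurable_restrict_extend)
      show "trans_op P (b - c) (h b) \<in> borel_measurable (restrict_space borel S)"
        using hb c(2) by (intro trans_op_measurable measurable_restrict_space1) (auto simp: bdd_meas_def)
      show "\<bar>trans_op P (b - c) (h b) y\<bar> \<le> B" if "y \<in> S" for y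
        using c(2) that B B0 by (intro trans_op_bound) auto
    qed auto
    define h' where "h' = h(c := (\<lambda>y. h c y * Q y))"
    have bQ: "bdd_meas Q" by (rule bdd_measI[OF Q(1,2)])
    have bh': "bdd_meas (h' r)" for r
      using insert.prems(3)[of r] bdd_meas_mult[OF insert.prems(3) bQ, of c] by (cases "r = c") (simp_all add: h'_def)
    obtain e where e: "bij_betw e {0..<card R} R" using ex_bij_betw_nat_finite[OF insert.hyps(1)] by blast
    have re: "(\<Prod>r\<in>R. k r) = (\<Prod>i<card R. k (e i))" for k :: "real \<Rightarrow> real"
      using prod.reindex_bij_betw[OF e, of k] by (simp add: lessThan_atLeast0)
    have eR: "e i \<in> R" if "i < card R" for i using e that by (auto dest: bij_betwE)
    \<comment> \<open>Stated for all starting points and offsets, because it is used with offset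
      \<open>t\<close> under \<open>P x\<close> and with offset 0 under
      \<open>P (\<omega> t)\<close>.\<close>
    have step: "(\<integral>\<omega>. (\<Prod>r\<in>insert b R. h r (\<omega> (u + r))) \<partial>P y) = (\<integral>\<omega>. (\<Prod>r\<in>R. h' r (\<omega> (u + r))) \<partial>P y)"
      if y: "y \<in> S" and u: "u \<ge> 0" for y u
    proof -
      have bR: "b \<notin> R" using insert.hyps(2) by auto
      have "(\<integral>\<omega>. (\<Prod>r\<in>insert b R. h r (\<omega> (u + r))) \<partial>P y) =
        (\<integral>\<omega>. (\<Prod>i<card R. h (e i) (\<omega> (u + e i))) * h b (\<omega> ((u + c) + (b - c))) \<partial>P y)"
        using insert.hyps(1) bR by (simp add: re mult.commute)
      also have "\<dots> = (\<integral>\<omega>. (\<Prod>i<card R. h (e i) (\<omega> (u + e i))) * trans_op P (b - c) (h b) (\<omega> (u + c)) \<partial>P y)"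
      proof (rule markov)
        fix i assume "i < card R"
        then have "e i \<in> R" by (rule eR)
        then show "0 \<le> u + e i \<and> u + e i \<le> u + c \<and> bdd_meas (h (e i))"
          using insert.prems c u by auto
      qed (use y u c c0 hb in auto)
      also have "\<dots> = (\<integral>\<omega>. (\<Prod>r\<in>R. h' r (\<omega> (u + r))) \<partial>P y)"
      proof (rule Bochner_Integration.integral_cong[OF refl])
        fix \<omega> assume "\<omega> \<in> space (P y)"
        then have w: "\<omega> \<in> \<Omega>" using space_P[OF y] by simp
        have "(\<Prod>r\<in>R. h' r (\<omega> (u + r))) = h c (\<omega> (u + c)) * Q (\<omega> (u + c)) * (\<Prod>r\<in>R-{c}. h r (\<omega> (u + r)))"
          using insert.hyps(1) c(1) by (subst prod.remove[of R c]) (auto simp: h'_def)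
        also have "\<dots> = (\<Prod>r\<in>R. h r (\<omega> (u + r))) * Q (\<omega> (u + c))"
          using prod.remove[OF insert.hyps(1) c(1), of "\<lambda>r. h r (\<omega> (u + r))"] by simp
        also have "\<dots> = (\<Prod>r\<in>R. h r (\<omega> (u + r))) * trans_op P (b - c) (h b) (\<omega> (u + c))"
          using Q(3) path_in[OF w] u c0 by simp
        finally show "(\<Prod>i<card R. h (e i) (\<omega> (u + e i))) * trans_op P (b - c) (h b) (\<omega> (u + c)) = (\<Prod>r\<in>R. h' r (\<omega> (u + r)))"
          by (simp add: re)
      qed
      finally show ?thesis .
    qed
    have "(\<integral>\<omega>. (\<Prod>r\<in>insert b R. h r (\<omega> (t + r))) \<partial>P x) = (\<integral>\<omega>. (\<integral>\<omega>'. (\<Prod>r\<in>R. h' r (\<omega>' r)) \<partial>P (\<omega> t)) \<partial>P x)"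
      unfolding step[OF insert.prems(4,5)] by (rule insert.IH[OF False _ bh' insert.prems(4,5)]) (use insert.prems in auto)
    also have "\<dots> = (\<integral>\<omega>. (\<integral>\<omega>'. (\<Prod>r\<in>insert b R. h r (\<omega>' r)) \<partial>P (\<omega> t)) \<partial>P x)"
      proof (rule Bochner_Integration.integral_cong[OF refl])
      fix \<omega> assume "\<omega> \<in> space (P x)"
      then have "\<omega> t \<in> S" using insert.prems by (simp add: space_P path_in)
      then show "(\<integral>\<omega>'. (\<Prod>r\<in>R. h' r (\<omega>' r)) \<partial>P (\<omega> t)) = (\<integral>\<omega>'. (\<Prod>r\<in>insert b R. h r (\<omega>' r)) \<partial>P (\<omega> t))"
        using step[of "\<omega> t" 0] by simp
    qed
    finally show ?thesis .
  qed
qed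

text \<open>On a cylinder the claim is \<open>finite_markov\<close> for indicators, and cylinders
  determine finite measures. In this form the Markov property applies to functionals of the whole
  future, such as time integrals.\<close>

lemma shift_law:
  assumes x: "x \<in> S" and t: "t \<ge> 0"
  shows "distr (P x) (path_space \<Omega>) (\<lambda>\<omega> s. \<omega> (t + s)) = P x \<bind> (\<lambda>\<omega>. P (\<omega> t))"
proof -
  interpret prob_space "P x" by (rule prob[OF x])
  have K: "(\<lambda>\<omega>. P (\<omega> t)) \<in> measurable (P x) (subprob_algebra (path_space \<Omega>))"
    using measurable_compose[OF eval_S[OF t] kernel] by (simp add: measurable_cong_sets[OF sets_P[OF x] refl])
  have sh: "(\<lambda>\<omega> s. \<omega> (t + s)) \<in> measurable (P x) (path_space \<Omega>)"
    using shift_measurable[OF t] by (simp add: measurable_cong_sets[OF sets_P[OF x] refl])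
  have ne: "space (P x) \<noteq> {}" by (rule not_empty)
  let ?E = "{{\<omega>\<in>\<Omega>. \<forall>r\<in>R. \<omega> r \<in> A r} | R A. finite R \<and> R \<subseteq> {0..} \<and> (\<forall>r. A r \<in> sets (borel :: 'e measure))}"
  have cyl_sets: "X \<in> sets (path_space \<Omega>)" if "X \<in> ?E" for X
    unfolding sets_path_space_cylinders using that by (rule sigma_sets.Basic)
  show ?thesis
  proof (rule measure_eqI_generator_eq[where \<Omega> = \<Omega> and E = ?E and A = "\<lambda>_. \<Omega>"])
    show "Int_stable ?E"
    proof (rule Int_stableI)
      fix X Y assume "X \<in> ?E" "Y \<in> ?E"
      then obtain R A R' A' where X: "X = {\<omega>\<in>\<Omega>. \<forall>r\<in>R. \<omega> r \<in> A r}" "finite R" "R \<subseteq> {0..}" "\<And>r. A r \<in> sets borel"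
        and Y: "Y = {\<omega>\<in>\<Omega>. \<forall>r\<in>R'. \<omega> r \<in> A' r}" "finite R'" "R' \<subseteq> {0..}" "\<And>r. A' r \<in> sets borel" by auto
      define C where "C r = (if r \<in> R then A r else UNIV) \<inter> (if r \<in> R' then A' r else UNIV)" for r
      have "X \<inter> Y = {\<omega>\<in>\<Omega>. \<forall>r\<in>R\<union>R'. \<omega> r \<in> C r}" unfolding X(1) Y(1) C_def by auto
      moreover have "C r \<in> sets borel" for r unfolding C_def using X(4) Y(4) by auto
      ultimately show "X \<inter> Y \<in> ?E" using X(2,3) Y(2,3) by (intro CollectI exI[of _ "R \<union> R'"] exI[of _ C]) auto
    qed
    show "?E \<subseteq> Pow \<Omega>" by auto
    show "sets (distr (P x) (path_space \<Omega>) (\<lambda>\<omega> s. \<omega> (t + s))) = sigma_sets \<Omega> ?E"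
      by (simp add: sets_path_space_cylinders)
    show "sets (P x \<bind> (\<lambda>\<omega>. P (\<omega> t))) = sigma_sets \<Omega> ?E"
      by (subst sets_bind[OF _ ne, of _ "path_space \<Omega>"]) 
        (use x t in \<open>auto simp: sets_path_space_cylinders[symmetric] space_P sets_P path_in\<close>)
    show "range (\<lambda>_::nat. \<Omega>) \<subseteq> ?E"
      by (rule image_subsetI, intro CollectI exI[of _ "{}"] exI[of _ "\<lambda>_. UNIV"]) auto
    show "(\<Union>i::nat. \<Omega>) = \<Omega>" by auto
    show "emeasure (distr (P x) (path_space \<Omega>) (\<lambda>\<omega> s. \<omega> (t + s))) \<Omega> \<noteq> \<infinity>" for i :: nat
      using finite_measure.emeasure_finite[OF prob_space.finite_measure[OF prob_space_distr[OF sh]]] by simp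
    fix X assume XE: "X \<in> ?E"
    then obtain R A where X: "X = {\<omega>\<in>\<Omega>. \<forall>r\<in>R. \<omega> r \<in> A r}" "finite R" "R \<subseteq> {0..}" "\<And>r. A r \<in> sets borel" by auto
    \<comment> \<open>Time 0 is added, unconstrained unless it already belongs to \<open>R\<close>,
      because \<open>finite_markov\<close> asks for a nonempty set of times.\<close>
    define R' A' where "R' = insert 0 R" and "A' r = (if r \<in> R then A r else UNIV)" for r
    have R': "finite R'" "R' \<noteq> {}" "R' \<subseteq> {0..}" and A': "\<And>r. A' r \<in> sets borel"
      using X by (auto simp: R'_def A'_def)
    have X': "X = {\<omega>\<in>\<Omega>. \<forall>r\<in>R'. \<omega> r \<in> A' r}" by (auto simp: X(1) R'_def A'_def)
    have ind: "indicator X \<omega> = (\<Prod>r\<in>R'. indicator (A' r) (\<omega> r) :: real)" if w: "\<omega> \<in> \<Omega>" for \<omega>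
    proof (cases "\<omega> \<in> X")
      case True
      then show ?thesis by (auto simp: X' prod.neutral)
    next
      case False
      then obtain r where "r \<in> R'" "\<omega> r \<notin> A' r" using w by (auto simp: X')
      then have "\<exists>r\<in>R'. indicator (A' r) (\<omega> r) = (0::real)" by (intro bexI[of _ r]) auto
      then show ?thesis using False R'(1) by (metis indicator_simps(2) prod_zero)
    qed
    have Xm: "X \<in> sets (path_space \<Omega>)" by (rule cyl_sets[OF XE])
    have meas: "measure (P y) X = (\<integral>\<omega>. (\<Prod>r\<in>R'. indicator (A' r) (\<omega> r)) \<partial>P y)" if "y \<in> S" for y
    proof -
      have "measure (P y) X = (\<integral>\<omega>. indicator X \<omega> \<partial>P y)"
        using sets.sets_into_space[OF Xm] space_P[OF that] by (simp add: Int_absorb2)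
      also have "\<dots> = (\<integral>\<omega>. (\<Prod>r\<in>R'. indicator (A' r) (\<omega> r)) \<partial>P y)"
        by (rule Bochner_Integration.integral_cong[OF refl]) (simp add: ind space_P[OF that])
      finally show ?thesis .
    qed
    have "emeasure (distr (P x) (path_space \<Omega>) (\<lambda>\<omega> s. \<omega> (t + s))) X = 
      ennreal (measure (P x) ((\<lambda>\<omega> s. \<omega> (t + s)) -` X \<inter> space (P x)))"
      by (simp add: emeasure_distr[OF sh Xm] emeasure_eq_measure)
    also have "measure (P x) ((\<lambda>\<omega> s. \<omega> (t + s)) -` X \<inter> space (P x)) = (\<integral>\<omega>. indicator X (\<lambda>s. \<omega> (t + s)) \<partial>P x)"
      using measurable_sets[OF sh Xm]
      by (subst Bochner_Integration.integral_cong[OF refl, of _ _ "indicator ((\<lambda>\<omega> s. \<omega> (t + s)) -` X \<inter> space (P x))"])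
        (auto simp: indicator_def Int_absorb2)
    also have "\<dots> = (\<integral>\<omega>. (\<Prod>r\<in>R'. indicator (A' r) (\<omega> (t + r))) \<partial>P x)"
      by (rule Bochner_Integration.integral_cong) (use ind shift_closed t x in \<open>auto simp: space_P\<close>)
    also have "\<dots> = (\<integral>\<omega>. (\<integral>\<omega>'. (\<Prod>r\<in>R'. indicator (A' r) (\<omega>' r)) \<partial>P (\<omega> t)) \<partial>P x)"
      by (rule finite_markov[OF R' _ x t]) (rule bdd_measI[where B = 1], use A' in \<open>auto simp: indicator_def\<close>)
    also have "\<dots> = (\<integral>\<omega>. measure (P (\<omega> t)) X \<partial>P x)"
      by (rule Bochner_Integration.integral_cong) (use meas t x in \<open>auto simp: space_P path_in\<close>)
    also have "ennreal \<dots> = (\<integral>\<^sup>+\<omega>. ennreal (measure (P (\<omega> t)) X) \<partial>P x)"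
    proof (rule nn_integral_eq_integral[symmetric])
      show "integrable (P x) (\<lambda>\<omega>. measure (P (\<omega> t)) X)"
      proof (rule integrable_const_bound[where B = 1])
        show "(\<lambda>\<omega>. measure (P (\<omega> t)) X) \<in> borel_measurable (P x)"
          by (rule measurable_compose[OF K measurable_measure_subprob_algebra[OF Xm]])
        show "AE \<omega> in P x. norm (measure (P (\<omega> t)) X) \<le> 1"
          using prob_space.prob_le_1[OF prob] x t by (intro AE_I2) (auto simp: space_P path_in)
      qed
    qed auto
    also have "\<dots> = (\<integral>\<^sup>+\<omega>. emeasure (P (\<omega> t)) X \<partial>P x)"
      by (rule nn_integral_cong) 
        (use x t in \<open>auto simp: space_P path_in intro!: finite_measure.emeasure_eq_measure[symmetric] prob_space.finite_measure[OF prob]\<close>)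
    also have "\<dots> = emeasure (P x \<bind> (\<lambda>\<omega>. P (\<omega> t))) X"
      by (rule emeasure_bind[OF ne K Xm, symmetric])
    finally show "emeasure (distr (P x) (path_space \<Omega>) (\<lambda>\<omega> s. \<omega> (t + s))) X = emeasure (P x \<bind> (\<lambda>\<omega>. P (\<omega> t))) X" .
  qed
qed

lemma nn_integral_shift:
  assumes x: "x \<in> S" and t: "t \<ge> 0" and H: "H \<in> borel_measurable (path_space \<Omega>)"
  shows "(\<integral>\<^sup>+\<omega>. H (\<lambda>s. \<omega> (t + s)) \<partial>P x) = (\<integral>\<^sup>+\<omega>. (\<integral>\<^sup>+\<omega>'. H \<omega>' \<partial>P (\<omega> t)) \<partial>P x)"
proof -
  have K: "(\<lambda>\<omega>. P (\<omega> t)) \<in> measurable (P x) (subprob_algebra (path_space \<Omega>))"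
    using measurable_compose[OF eval_S[OF t] kernel] by (simp add: measurable_cong_sets[OF sets_P[OF x] refl])
  have sh: "(\<lambda>\<omega> s. \<omega> (t + s)) \<in> measurable (P x) (path_space \<Omega>)"
    using shift_measurable[OF t] by (simp add: measurable_cong_sets[OF sets_P[OF x] refl])
  have Hd: "H \<in> borel_measurable (distr (P x) (path_space \<Omega>) (\<lambda>\<omega> s. \<omega> (t + s)))"
    using H by simp
  show ?thesis
    using nn_integral_distr[OF sh Hd] nn_integral_bind[OF H K] by (simp only: shift_law[OF x t])
qed

end

section \<open>Moments of discounted functionals\<close>

text \<open>The double integral is cut along the diagonal, and on each half the smaller variable
  becomes the outer one. This is integration by parts for the decreasing functions \<open>A\<close>
  and \<open>B\<close>, whose derivatives are \<open>- a\<close> and \<open>- b\<close>.\<close>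

lemma nn_integral_tail_mult:
  fixes a b :: "real \<Rightarrow> ennreal"
  assumes [measurable]: "a \<in> borel_measurable borel" "b \<in> borel_measurable borel"
  defines "A \<equiv> \<lambda>t. \<integral>\<^sup>+s. (if t \<le> s then a s else 0) \<partial>lborel"
    and "B \<equiv> \<lambda>t. \<integral>\<^sup>+s. (if t \<le> s then b s else 0) \<partial>lborel"
  shows "A t * B t = (\<integral>\<^sup>+s. (if t \<le> s then a s * B s + b s * A s else 0) \<partial>lborel)"
proof -
  have [measurable]: "A \<in> borel_measurable borel" "B \<in> borel_measurable borel"
    unfolding A_def B_def by measurable
  have "A t * B t = (\<integral>\<^sup>+s. \<integral>\<^sup>+u. (if t \<le> s then a s else 0) * (if t \<le> u then b u else 0) \<partial>lborel \<partial>lborel)"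
    unfolding A_def B_def by (simp add: nn_integral_multc nn_integral_cmult)
  also have "\<dots> = (\<integral>\<^sup>+s. (if t \<le> s then a s * B s else 0) + 
      (\<integral>\<^sup>+u. (if t \<le> u \<and> u < s then a s * b u else 0) \<partial>lborel) \<partial>lborel)"
  proof (rule nn_integral_cong)
    fix s :: real
    have "(\<integral>\<^sup>+u. (if t \<le> s then a s else 0) * (if t \<le> u then b u else 0) \<partial>lborel) =
      (\<integral>\<^sup>+u. (if t \<le> s then a s * (if s \<le> u then b u else 0) else 0) + (if t \<le> u \<and> u < s then a s * b u else 0) \<partial>lborel)"
      by (rule nn_integral_cong) auto
    also have "\<dots> = (if t \<le> s then a s * B s else 0) + (\<integral>\<^sup>+u. (if t \<le> u \<and> u < s then a s * b u else 0) \<partial>lborel)"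
      unfolding B_def by (subst nn_integral_add) (auto simp: nn_integral_cmult)
    finally show "(\<integral>\<^sup>+u. (if t \<le> s then a s else 0) * (if t \<le> u then b u else 0) \<partial>lborel) = \<dots>" .
  qed
  also have "\<dots> = (\<integral>\<^sup>+s. (if t \<le> s then a s * B s else 0) \<partial>lborel) + 
     (\<integral>\<^sup>+s. \<integral>\<^sup>+u. (if t \<le> u \<and> u < s then a s * b u else 0) \<partial>lborel \<partial>lborel)"
    by (subst nn_integral_add) auto
  also have "(\<integral>\<^sup>+s. \<integral>\<^sup>+u. (if t \<le> u \<and> u < s then a s * b u else 0) \<partial>lborel \<partial>lborel) =
    (\<integral>\<^sup>+u. \<integral>\<^sup>+s. (if t \<le> u \<and> u < s then a s * b u else 0) \<partial>lborel \<partial>lborel)"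
    by (rule lborel_pair.Fubini') measurable
  also have "\<dots> = (\<integral>\<^sup>+u. (if t \<le> u then b u * A u else 0) \<partial>lborel)"
  proof (rule nn_integral_cong)
    fix u :: real
    have "(\<integral>\<^sup>+s. (if t \<le> u \<and> u < s then a s * b u else 0) \<partial>lborel) =
      (\<integral>\<^sup>+s. (if t \<le> u then b u * (if u \<le> s then a s else 0) else 0) \<partial>lborel)"
      \<comment> \<open>The diagonal point \<open>s = u\<close> is a null set, so the strict
        inequality may be replaced by the weak one.\<close>
      by (rule nn_integral_cong_AE) (use AE_lborel_singleton[of u] in \<open>auto simp: mult.commute elim!: eventually_mono\<close>)
    also have "\<dots> = (if t \<le> u then b u * A u else 0)"
      unfolding A_def by (auto simp: nn_integral_cmult)
    finally show "(\<integral>\<^sup>+s. (if t \<le> u \<and> u < s then a s * b u else 0) \<partial>lborel) = \<dots>" .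
  qed
  also have "(\<integral>\<^sup>+s. (if t \<le> s then a s * B s else 0) \<partial>lborel) + (\<integral>\<^sup>+u. (if t \<le> u then b u * A u else 0) \<partial>lborel)
    = (\<integral>\<^sup>+s. (if t \<le> s then a s * B s + b s * A s else 0) \<partial>lborel)"
    by (subst nn_integral_add[symmetric]) (auto intro!: nn_integral_cong)
  finally show ?thesis .
qed

text \<open>The index \<open>j\<close> marks the factor whose integration variable is smallest; the
  others are tails from that time on. This product rule is the pathwise half of Kac's
  formula.\<close>

lemma nn_integral_tail_prod:
  fixes a :: "'i \<Rightarrow> real \<Rightarrow> ennreal"
  assumes J: "finite J" "J \<noteq> {}" and [measurable]: "\<And>j. a j \<in> borel_measurable borel"
  defines "A \<equiv> \<lambda>j t. \<integral>\<^sup>+s. (if t \<le> s then a j s else 0) \<partial>lborel"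
  shows "(\<Prod>j\<in>J. A j t) = (\<integral>\<^sup>+s. (if t \<le> s then (\<Sum>j\<in>J. a j s * (\<Prod>i\<in>J-{j}. A i s)) else 0) \<partial>lborel)"
  using J
proof (induction J arbitrary: t rule: finite_ne_induct)
  case (singleton x)
  then show ?case by (simp add: A_def cong: if_cong)
next
  case (insert k F)
  have [measurable]: "A j \<in> borel_measurable borel" for j
    unfolding A_def by measurable
  define b where "b s = (\<Sum>j\<in>F. a j s * (\<Prod>i\<in>F-{j}. A i s))" for s
  have [measurable]: "b \<in> borel_measurable borel" unfolding b_def by measurable
  have B: "(\<Prod>i\<in>F. A i s) = (\<integral>\<^sup>+u. (if s \<le> u then b u else 0) \<partial>lborel)" for s
    unfolding b_def by (rule insert.IH)
  have "(\<Prod>j\<in>insert k F. A j t) = A k t * (\<integral>\<^sup>+u. (if t \<le> u then b u else 0) \<partial>lborel)"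
    using insert.hyps by (simp add: B)
  also have "\<dots> = (\<integral>\<^sup>+s. (if t \<le> s then a k s * (\<Prod>i\<in>F. A i s) + b s * A k s else 0) \<partial>lborel)"
    unfolding B unfolding A_def by (rule nn_integral_tail_mult) measurable
  also have "\<dots> = (\<integral>\<^sup>+s. (if t \<le> s then (\<Sum>j\<in>insert k F. a j s * (\<Prod>i\<in>insert k F-{j}. A i s)) else 0) \<partial>lborel)"
  proof (rule nn_integral_cong)
    fix s
    have "(\<Sum>j\<in>F. a j s * (\<Prod>i\<in>insert k F-{j}. A i s)) = b s * A k s"
      unfolding b_def sum_distrib_right
    proof (rule sum.cong)
      fix j assume j: "j \<in> F"
      then have "insert k F - {j} = insert k (F - {j})" using insert.hyps by auto
      then show "a j s * (\<Prod>i\<in>insert k F-{j}. A i s) = a j s * (\<Prod>i\<in>F-{j}. A i s) * A k s"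
        using insert.hyps by (simp add: mult.commute mult.left_commute)
    qed simp
    then show "(if t \<le> s then a k s * (\<Prod>i\<in>F. A i s) + b s * A k s else 0) =
      (if t \<le> s then (\<Sum>j\<in>insert k F. a j s * (\<Prod>i\<in>insert k F-{j}. A i s)) else 0)"
      using insert.hyps by simp
  qed
  finally show ?case .
qed

text \<open>Values in \<open>ennreal\<close> let Tonelli be applied before integrability is known.
  \<open>max 0 s\<close> keeps negative times, at which paths are arbitrary, out of the
  integrand.\<close>

definition discounted :: "real \<Rightarrow> ('e \<Rightarrow> real) \<Rightarrow> (real \<Rightarrow> 'e) \<Rightarrow> ennreal" where
  "discounted l g \<omega> = (\<integral>\<^sup>+s. (if 0 \<le> s then ennreal (exp (- l * s) * g (\<omega> (max 0 s))) else 0) \<partial>lborel)"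

lemma discounted_shift:
  assumes t: "t \<ge> 0" and m: "(\<lambda>s. g (\<omega> (max 0 s))) \<in> borel_measurable borel" and g0: "\<And>x. 0 \<le> g x"
  shows "(\<integral>\<^sup>+s. (if t \<le> s then ennreal (exp (- l * s) * g (\<omega> (max 0 s))) else 0) \<partial>lborel) =
    ennreal (exp (- l * t)) * discounted l g (\<lambda>s. \<omega> (t + s))"
proof -
  note m[measurable]
  have "(\<integral>\<^sup>+s. (if t \<le> s then ennreal (exp (- l * s) * g (\<omega> (max 0 s))) else 0) \<partial>lborel) =
    (\<integral>\<^sup>+s. (if t \<le> t + 1 * s then ennreal (exp (- l * (t + 1 * s)) * g (\<omega> (max 0 (t + 1 * s)))) else 0) \<partial>lborel)"
    by (subst nn_integral_real_affine[where t = t and c = 1]) auto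
  also have "\<dots> = (\<integral>\<^sup>+s. ennreal (exp (- l * t)) * (if 0 \<le> s then ennreal (exp (- l * s) * g (\<omega> (t + max 0 s))) else 0) \<partial>lborel)"
    using t g0 by (intro nn_integral_cong) (auto simp: ennreal_mult[symmetric] exp_add[symmetric] algebra_simps)
  also have "\<dots> = ennreal (exp (- l * t)) * discounted l g (\<lambda>s. \<omega> (t + s))"
    unfolding discounted_def
  proof (rule nn_integral_cmult)
    have "(\<lambda>s. g (\<omega> (max 0 (t + max 0 s)))) \<in> borel_measurable borel"
      by (rule measurable_compose[OF _ m]) measurable
    then have [measurable]: "(\<lambda>s. g (\<omega> (t + max 0 s))) \<in> borel_measurable borel"
      using t by (simp add: max_def)
    show "(\<lambda>s. if 0 \<le> s then ennreal (exp (- l * s) * g (\<omega> (t + max 0 s))) else 0) \<in> borel_measurable lborel"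
      by measurable
  qed
  finally show ?thesis .
qed

lemma nn_integral_exp_tail:
  assumes "l > 0" shows "(\<integral>\<^sup>+s. (if 0 \<le> s then ennreal (exp (- l * s)) else 0) \<partial>lborel) = ennreal (1 / l)"
proof -
  have "(\<integral>\<^sup>+s. ennreal (exp (- l * s)) * indicator {0..} s \<partial>lborel) = ennreal (0 - (- exp (- l * 0) / l))"
  proof (rule nn_integral_FTC_atLeast)
    show "DERIV (\<lambda>s. - exp (- l * s) / l) x :> exp (- l * x)" for x
      using assms by (auto intro!: derivative_eq_intros)
    have "((\<lambda>s. - exp (- l * s) / l) \<longlongrightarrow> - 0 / l) at_top"
      using assms by (intro tendsto_intros filterlim_compose[OF exp_at_bot] 
        filterlim_tendsto_neg_mult_at_bot[OF tendsto_const _ filterlim_ident]) auto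
    then show "((\<lambda>s. - exp (- l * s) / l) \<longlongrightarrow> 0) at_top" by simp
  qed auto
  also have "(\<integral>\<^sup>+s. ennreal (exp (- l * s)) * indicator {0..} s \<partial>lborel) =
    (\<integral>\<^sup>+s. (if 0 \<le> s then ennreal (exp (- l * s)) else 0) \<partial>lborel)"
    by (rule nn_integral_cong) (auto simp: indicator_def)
  finally show ?thesis by simp
qed

text \<open>Rates of at least 1 put the functional and all products of such functionals into
  \<open>[0, 1]\<close>, and a sequence of them into the Hilbert cube.\<close>

lemma discounted_le:
  assumes "l \<ge> 1" "\<And>x. g x \<le> 1"
  shows "discounted l g \<omega> \<le> 1"
proof -
  have "discounted l g \<omega> \<le> (\<integral>\<^sup>+s. (if 0 \<le> s then ennreal (exp (- l * s)) else 0) \<partial>lborel)"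
    unfolding discounted_def using assms(2) 
    by (intro nn_integral_mono) (auto intro!: ennreal_leI mult_left_le)
  also have "\<dots> \<le> 1" using assms(1) by (simp add: nn_integral_exp_tail)
  finally show ?thesis .
qed

text \<open>Right continuity is demanded along the paths of \<open>\<Omega>\<close> and not of
  \<open>g\<close> on the space: the approximating paths are right continuous only after embedding
  into \<open>E^-\<close>, so a function that factors through the embedding qualifies where a
  general continuous one might not.\<close>

definition right_cont_obs :: "(real \<Rightarrow> 'e::topological_space) set \<Rightarrow> ('e \<Rightarrow> real) \<Rightarrow> bool" where
  "right_cont_obs \<Omega> g \<longleftrightarrow> g \<in> borel_measurable borel \<and> (\<forall>x. 0 \<le> g x \<and> g x \<le> 1) \<and>
     (\<forall>\<omega>\<in>\<Omega>. \<forall>t\<ge>0. continuous (at_right t) (\<lambda>s. g (\<omega> s)))"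

lemma joint_measurable:
  assumes "right_cont_obs \<Omega> g"
  shows "(\<lambda>(t, \<omega>). g (\<omega> (max 0 t))) \<in> borel_measurable (borel \<Otimes>\<^sub>M path_space \<Omega>)"
  by (rule measurable_right_continuous) 
    (use assms in \<open>auto simp: right_cont_obs_def intro: measurable_compose[OF measurable_eval_path_space]\<close>)

lemma path_measurable:
  assumes "right_cont_obs \<Omega> g" "\<omega> \<in> \<Omega>"
  shows "(\<lambda>s. g (\<omega> (max 0 s))) \<in> borel_measurable borel"
  using measurable_compose[OF measurable_Pair2'[of \<omega> "path_space \<Omega>" borel] joint_measurable[OF assms(1)]] assms(2) by simp

lemma joint_measurable_discounted:
  assumes "right_cont_obs \<Omega> g"
  shows "(\<lambda>(t, \<omega>). discounted l g (\<lambda>s. \<omega> (max 0 t + s))) \<in> borel_measurable (borel \<Otimes>\<^sub>M path_space \<Omega>)"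
proof -
  have "(\<lambda>x::(real \<times> (real \<Rightarrow> 'a)) \<times> real. (\<lambda>(t, \<omega>). g (\<omega> (max 0 t))) (max 0 (fst (fst x)) + max 0 (snd x), snd (fst x)))
    \<in> borel_measurable ((borel \<Otimes>\<^sub>M path_space \<Omega>) \<Otimes>\<^sub>M lborel)"
    by (rule measurable_compose[OF _ joint_measurable[OF assms]]) measurable
  then have [measurable]: "(\<lambda>x::(real \<times> (real \<Rightarrow> 'a)) \<times> real. g (snd (fst x) (max 0 (fst (fst x)) + max 0 (snd x))))
    \<in> borel_measurable ((borel \<Otimes>\<^sub>M path_space \<Omega>) \<Otimes>\<^sub>M lborel)"
    by (simp add: max_def cong: if_cong)
  show ?thesis
    unfolding discounted_def split_beta by measurable
qed

lemma discounted_measurable: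
  assumes "right_cont_obs \<Omega> g"
  shows "discounted l g \<in> borel_measurable (path_space \<Omega>)"
proof -
  have "(\<lambda>\<omega>. (\<lambda>(t, \<omega>). discounted l g (\<lambda>s. \<omega> (max 0 t + s))) (0, \<omega>)) \<in> borel_measurable (path_space \<Omega>)"
    by (rule measurable_compose[OF _ joint_measurable_discounted[OF assms]]) measurable
  then show ?thesis by simp
qed

definition moment :: "('e \<Rightarrow> (real \<Rightarrow> 'e) measure) \<Rightarrow> ('i \<Rightarrow> real) \<Rightarrow> ('i \<Rightarrow> 'e \<Rightarrow> real) \<Rightarrow> 'i set \<Rightarrow> 'e \<Rightarrow> real" where
  "moment P l g J x = (\<integral>\<omega>. (\<Prod>j\<in>J. enn2real (discounted (l j) (g j) \<omega>)) \<partial>P x)"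

text \<open>Guards against the default value 0 of the time integral in \<open>resolvent\<close>. The
  kernel provides measurability in the path at each fixed time, which says nothing about the
  dependence on time.\<close>

definition time_measurable :: "('e \<Rightarrow> (real \<Rightarrow> 'e) measure) \<Rightarrow> ('e \<Rightarrow> real) \<Rightarrow> 'e \<Rightarrow> bool" where
  "time_measurable P f x \<longleftrightarrow> (\<lambda>s. trans_op P (max 0 s) f x) \<in> borel_measurable borel"

context markov_paths
begin

text \<open>Along each path the product rule isolates the factor with the smallest time
  \<open>s\<close>. The other factors are, up to their discounts, the same functionals of the path
  shifted by \<open>s\<close>, and the Markov property at \<open>s\<close> replaces them by their
  moments started from \<open>\<omega> s\<close>.\<close>

lemma kac_nn:
  fixes l :: "'i \<Rightarrow> real" and g :: "'i \<Rightarrow> 'e \<Rightarrow> real"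
  assumes J: "finite J" "J \<noteq> {}" and rc: "\<And>j. right_cont_obs \<Omega> (g j)" and x: "x \<in> S"
  defines "V \<equiv> \<lambda>K y. \<integral>\<^sup>+\<omega>. (\<Prod>j\<in>K. discounted (l j) (g j) \<omega>) \<partial>P y"
  shows "V J x = (\<integral>\<^sup>+s. (if 0 \<le> s then ennreal (exp (- (\<Sum>j\<in>J. l j) * s)) *
        (\<integral>\<^sup>+\<omega>. (\<Sum>j\<in>J. ennreal (g j (\<omega> (max 0 s))) * V (J - {j}) (\<omega> (max 0 s))) \<partial>P x) else 0) \<partial>lborel)"
    and "(\<lambda>s. \<integral>\<^sup>+\<omega>. (\<Sum>j\<in>J. ennreal (g j (\<omega> (max 0 s))) * V (J - {j}) (\<omega> (max 0 s))) \<partial>P x) \<in> borel_measurable borel"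
proof -
  interpret prob_space "P x" by (rule prob[OF x])
  interpret pr: pair_sigma_finite "P x" lborel ..
  have g0: "0 \<le> g j y" for j y using rc[of j] by (auto simp: right_cont_obs_def)
  have [measurable]: "g j \<in> borel_measurable borel" for j using rc[of j] by (auto simp: right_cont_obs_def)
  define D where "D j = discounted (l j) (g j)" for j
  define L where "L = (\<Sum>j\<in>J. l j)"
  \<comment> \<open>The integrand of the product rule seen from time 0. At time \<open>s\<close> it
    is \<open>K\<close> of the shifted path times the total discount
    \<open>exp (- L * s)\<close>.\<close>
  define K where "K \<omega> = (\<Sum>j\<in>J. ennreal (g j (\<omega> 0)) * (\<Prod>i\<in>J-{j}. D i \<omega>))" for \<omega>
  have [measurable]: "D j \<in> borel_measurable (path_space \<Omega>)" for j
    unfolding D_def by (rule discounted_measurable[OF rc])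
  have ev: "(\<lambda>\<omega>. g j (\<omega> t)) \<in> borel_measurable (path_space \<Omega>)" if "t \<ge> 0" for j t
    by (rule measurable_compose[OF measurable_eval_path_space[OF that]]) measurable
  have Km: "K \<in> borel_measurable (path_space \<Omega>)"
    using ev[of 0] unfolding K_def by measurable
  have pathwise: "(\<Prod>j\<in>J. D j \<omega>) = (\<integral>\<^sup>+s. (if 0 \<le> s then ennreal (exp (- L * s)) * K (\<lambda>u. \<omega> (max 0 s + u)) else 0) \<partial>lborel)"
    if w: "\<omega> \<in> \<Omega>" for \<omega>
  proof -
    define a where "a j s = ennreal (exp (- l j * s) * g j (\<omega> (max 0 s)))" for j s
    note path_measurable[OF rc w, measurable]
    have am: "a j \<in> borel_measurable borel" for j
      unfolding a_def by measurable
    have A: "(\<integral>\<^sup>+u. (if s \<le> u then a j u else 0) \<partial>lborel) = ennreal (exp (- l j * s)) * D j (\<lambda>u. \<omega> (s + u))"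
      if "s \<ge> 0" for j s
      unfolding a_def D_def by (rule discounted_shift[where g = "g j" and l = "l j", OF that path_measurable[OF rc w] g0])
    have "(\<Prod>j\<in>J. D j \<omega>) = (\<Prod>j\<in>J. \<integral>\<^sup>+u. (if 0 \<le> u then a j u else 0) \<partial>lborel)"
      by (simp add: A)
    also have "\<dots> = (\<integral>\<^sup>+s. (if 0 \<le> s then (\<Sum>j\<in>J. a j s * (\<Prod>i\<in>J-{j}. \<integral>\<^sup>+u. (if s \<le> u then a i u else 0) \<partial>lborel)) else 0) \<partial>lborel)"
      by (rule nn_integral_tail_prod[OF J am])
    also have "\<dots> = (\<integral>\<^sup>+s. (if 0 \<le> s then ennreal (exp (- L * s)) * K (\<lambda>u. \<omega> (max 0 s + u)) else 0) \<partial>lborel)"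
    proof (rule nn_integral_cong)
      fix s :: real
      have "a j s * (\<Prod>i\<in>J-{j}. \<integral>\<^sup>+u. (if s \<le> u then a i u else 0) \<partial>lborel) =
        ennreal (exp (- L * s)) * (ennreal (g j (\<omega> s)) * (\<Prod>i\<in>J-{j}. D i (\<lambda>u. \<omega> (s + u))))" if "s \<ge> 0" "j \<in> J" for j
      proof -
        have "(\<Prod>i\<in>J-{j}. exp (- l i * s)) = exp (- (\<Sum>i\<in>J-{j}. l i) * s)"
          using J by (simp add: exp_sum[symmetric] sum_negf sum_distrib_right)
        moreover have "L = l j + (\<Sum>i\<in>J-{j}. l i)" unfolding L_def using J(1) that(2) by (rule sum.remove)
        ultimately have "exp (- l j * s) * (\<Prod>i\<in>J-{j}. exp (- l i * s)) = exp (- L * s)"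
          by (simp add: exp_add[symmetric] algebra_simps)
        then have *: "ennreal (exp (- l j * s)) * (\<Prod>i\<in>J-{j}. ennreal (exp (- l i * s))) = ennreal (exp (- L * s))"
          by (simp add: prod_ennreal ennreal_mult[symmetric] prod_nonneg)
        have e: "a j s = ennreal (exp (- l j * s)) * ennreal (g j (\<omega> s))"
          using that(1) g0 by (simp add: a_def ennreal_mult)
        show ?thesis
          unfolding *[symmetric] A[OF that(1)] prod.distrib e by (simp only: mult_ac)
      qed
      then show "(if 0 \<le> s then (\<Sum>j\<in>J. a j s * (\<Prod>i\<in>J-{j}. \<integral>\<^sup>+u. (if s \<le> u then a i u else 0) \<partial>lborel)) else 0) =
        (if 0 \<le> s then ennreal (exp (- L * s)) * K (\<lambda>u. \<omega> (max 0 s + u)) else 0)"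
        by (simp add: K_def sum_distrib_left)
    qed
    finally show ?thesis .
  qed
  have Kj: "(\<lambda>(s, \<omega>). K (\<lambda>u. \<omega> (max 0 s + u))) \<in> borel_measurable (borel \<Otimes>\<^sub>M path_space \<Omega>)"
  proof -
    have 1: "(\<lambda>x. D j (\<lambda>u. snd x (max 0 (fst x) + u))) \<in> borel_measurable (borel \<Otimes>\<^sub>M path_space \<Omega>)" for j
      using joint_measurable_discounted[OF rc, where l = "l j"] by (simp add: D_def split_beta)
    have 2: "(\<lambda>x. g j (snd x (max 0 (fst x)))) \<in> borel_measurable (borel \<Otimes>\<^sub>M path_space \<Omega>)" for j
      using joint_measurable[OF rc[of j]] by (simp add: split_beta)
    show ?thesis unfolding K_def split_beta using 1 2 by simp
  qed
  have sP: "sets (borel \<Otimes>\<^sub>M P x) = sets (borel \<Otimes>\<^sub>M path_space \<Omega>)"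
    by (rule sets_pair_measure_cong[OF refl sets_P[OF x]])
  have Kj'[measurable]: "(\<lambda>z. K (\<lambda>u. snd z (max 0 (fst z) + u))) \<in> borel_measurable (borel \<Otimes>\<^sub>M P x)"
    using Kj by (simp add: split_beta measurable_cong_sets[OF sP refl])
  have Kj''[measurable]: "(\<lambda>z. K (\<lambda>u. fst z (max 0 (snd z) + u))) \<in> borel_measurable (P x \<Otimes>\<^sub>M lborel)"
    using measurable_compose[OF measurable_pair_swap'[of "P x" borel] Kj']
    by (simp add: split_beta measurable_cong_sets[OF sets_pair_measure_cong[OF refl sets_lborel] refl])
  \<comment> \<open>After the Markov property, the path under \<open>P y\<close> starts at
    \<open>y\<close> almost surely, so \<open>g j (\<omega> 0)\<close> becomes a constant and leaves
    the inner integral.\<close>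
  have Vstep: "(\<integral>\<^sup>+\<omega>. K (\<lambda>u. \<omega> (max 0 s + u)) \<partial>P x) = 
    (\<integral>\<^sup>+\<omega>. (\<Sum>j\<in>J. ennreal (g j (\<omega> (max 0 s))) * V (J - {j}) (\<omega> (max 0 s))) \<partial>P x)" for s
  proof -
    have "(\<integral>\<^sup>+\<omega>. K \<omega> \<partial>P y) = (\<Sum>j\<in>J. ennreal (g j y) * V (J - {j}) y)" if y: "y \<in> S" for y
    proof -
      have "(\<integral>\<^sup>+\<omega>. K \<omega> \<partial>P y) = (\<integral>\<^sup>+\<omega>. (\<Sum>j\<in>J. ennreal (g j y) * (\<Prod>i\<in>J-{j}. D i \<omega>)) \<partial>P y)"
        unfolding K_def by (rule nn_integral_cong_AE) (use start[OF y] in eventually_elim, simp)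
      also have "\<dots> = (\<Sum>j\<in>J. ennreal (g j y) * V (J - {j}) y)"
        unfolding V_def D_def[symmetric] using y
        by (simp add: nn_integral_sum nn_integral_cmult measurable_cong_sets[OF sets_P[OF y] refl])
      finally show ?thesis .
    qed
    then show ?thesis
      unfolding nn_integral_shift[OF x max.cobounded1 Km] 
      by (intro nn_integral_cong) (simp add: space_P[OF x] path_in)
  qed
  have "V J x = (\<integral>\<^sup>+\<omega>. (\<integral>\<^sup>+s. (if 0 \<le> s then ennreal (exp (- L * s)) * K (\<lambda>u. \<omega> (max 0 s + u)) else 0) \<partial>lborel) \<partial>P x)"
    unfolding V_def D_def[symmetric] by (rule nn_integral_cong) (simp add: pathwise space_P[OF x])
  also have "\<dots> = (\<integral>\<^sup>+s. (\<integral>\<^sup>+\<omega>. (if 0 \<le> s then ennreal (exp (- L * s)) * K (\<lambda>u. \<omega> (max 0 s + u)) else 0) \<partial>P x) \<partial>lborel)"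
  proof (rule pr.Fubini'[symmetric])
    have e: "(\<lambda>z. ennreal (exp (- L * snd z))) \<in> borel_measurable (P x \<Otimes>\<^sub>M lborel)"
      by (rule measurable_compose[OF measurable_snd, of "\<lambda>s. ennreal (exp (- L * s))"]) simp
    have p: "{z \<in> space (P x \<Otimes>\<^sub>M lborel). (0::real) \<le> snd z} \<in> sets (P x \<Otimes>\<^sub>M lborel)"
      using measurable_sets[OF measurable_snd, of "{0::real..}" lborel "P x"] by (simp add: vimage_def Int_def conj_commute)
    have "(\<lambda>z. if 0 \<le> snd z then ennreal (exp (- L * snd z)) * K (\<lambda>u. fst z (max 0 (snd z) + u)) else 0)
      \<in> borel_measurable (P x \<Otimes>\<^sub>M lborel)"
      by (rule measurable_If[OF borel_measurable_times_ennreal[OF e Kj''] _ p]) simp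
    then show "(\<lambda>(\<omega>, s). if 0 \<le> s then ennreal (exp (- L * s)) * K (\<lambda>u. \<omega> (max 0 s + u)) else 0)
      \<in> borel_measurable (P x \<Otimes>\<^sub>M lborel)"
      by (simp add: split_beta)
  qed
  also have "\<dots> = (\<integral>\<^sup>+s. (if 0 \<le> s then ennreal (exp (- L * s)) * (\<integral>\<^sup>+\<omega>. K (\<lambda>u. \<omega> (max 0 s + u)) \<partial>P x) else 0) \<partial>lborel)"
  proof (rule nn_integral_cong)
    fix s :: real
    have "(\<lambda>\<omega>. K (\<lambda>u. \<omega> (max 0 s + u))) \<in> borel_measurable (P x)"
      using measurable_compose[OF shift_measurable[of "max 0 s"] Km] 
      by (simp add: measurable_cong_sets[OF sets_P[OF x] refl])
    then show "(\<integral>\<^sup>+\<omega>. (if 0 \<le> s then ennreal (exp (- L * s)) * K (\<lambda>u. \<omega> (max 0 s + u)) else 0) \<partial>P x) =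
      (if 0 \<le> s then ennreal (exp (- L * s)) * (\<integral>\<^sup>+\<omega>. K (\<lambda>u. \<omega> (max 0 s + u)) \<partial>P x) else 0)"
      by (cases "0 \<le> s") (simp_all add: nn_integral_cmult)
  qed
  finally show "V J x = (\<integral>\<^sup>+s. (if 0 \<le> s then ennreal (exp (- (\<Sum>j\<in>J. l j) * s)) *
        (\<integral>\<^sup>+\<omega>. (\<Sum>j\<in>J. ennreal (g j (\<omega> (max 0 s))) * V (J - {j}) (\<omega> (max 0 s))) \<partial>P x) else 0) \<partial>lborel)"
    unfolding Vstep L_def .
  have "(\<lambda>s. \<integral>\<^sup>+\<omega>. K (\<lambda>u. \<omega> (max 0 s + u)) \<partial>P x) \<in> borel_measurable borel"
    using Kj' by (intro borel_measurable_nn_integral) (simp add: split_beta)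
  then show "(\<lambda>s. \<integral>\<^sup>+\<omega>. (\<Sum>j\<in>J. ennreal (g j (\<omega> (max 0 s))) * V (J - {j}) (\<omega> (max 0 s))) \<partial>P x) \<in> borel_measurable borel"
    unfolding Vstep .
qed

lemma moment_nn:
  assumes "finite J" and rc: "\<And>j. right_cont_obs \<Omega> (g j)" and l: "\<And>j. l j \<ge> 1" and x: "x \<in> S"
  shows "ennreal (moment P l g J x) = (\<integral>\<^sup>+\<omega>. (\<Prod>j\<in>J. discounted (l j) (g j) \<omega>) \<partial>P x)"
    "0 \<le> moment P l g J x" "moment P l g J x \<le> 1"
proof -
  interpret prob_space "P x" by (rule prob[OF x])
  have le: "discounted (l j) (g j) \<omega> \<le> 1" for j \<omega>
    by (rule discounted_le[OF l]) (use rc[of j] in \<open>auto simp: right_cont_obs_def\<close>)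
  then have fin: "discounted (l j) (g j) \<omega> < \<top>" for j \<omega>
    using le_less_trans ennreal_one_less_top by blast
  have b: "enn2real (discounted (l j) (g j) \<omega>) \<le> 1" for j \<omega>
    using enn2real_mono[OF le[of j \<omega>]] by simp
  have pr: "(\<Prod>j\<in>J. enn2real (discounted (l j) (g j) \<omega>)) \<le> 1" "0 \<le> (\<Prod>j\<in>J. enn2real (discounted (l j) (g j) \<omega>))" for \<omega>
    by (auto intro!: prod_le_1 prod_nonneg b)
  have m: "(\<lambda>\<omega>. enn2real (discounted (l j) (g j) \<omega>)) \<in> borel_measurable (P x)" for j
    using discounted_measurable[OF rc] by (simp add: measurable_cong_sets[OF sets_P[OF x] refl])
  have int: "integrable (P x) (\<lambda>\<omega>. \<Prod>j\<in>J. enn2real (discounted (l j) (g j) \<omega>))"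
    by (rule integrable_const_bound[where B = 1]) (use pr m in auto)
  have "ennreal (moment P l g J x) = (\<integral>\<^sup>+\<omega>. ennreal (\<Prod>j\<in>J. enn2real (discounted (l j) (g j) \<omega>)) \<partial>P x)"
    unfolding moment_def by (rule nn_integral_eq_integral[symmetric, OF int]) (use pr in auto)
  also have "\<dots> = (\<integral>\<^sup>+\<omega>. (\<Prod>j\<in>J. discounted (l j) (g j) \<omega>) \<partial>P x)"
    by (rule nn_integral_cong) (simp add: prod_ennreal[symmetric] fin)
  finally show "ennreal (moment P l g J x) = (\<integral>\<^sup>+\<omega>. (\<Prod>j\<in>J. discounted (l j) (g j) \<omega>) \<partial>P x)" .
  show "0 \<le> moment P l g J x" unfolding moment_def using pr by simp
  show "moment P l g J x \<le> 1" unfolding moment_def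
    by (rule integral_le_const[OF int]) (use pr in auto)
qed

lemma moment_measurable:
  assumes rc: "\<And>j. right_cont_obs \<Omega> (g j)"
  shows "moment P l g J \<in> borel_measurable (restrict_space borel S)"
  unfolding moment_def
  by (rule measurable_compose[OF kernel integral_measurable_subprob_algebra])
    (use discounted_measurable[OF rc] in measurable)

text \<open>The recursion that carries convergence from smaller to larger moments. \<open>h\<close>
  need not be right continuous along paths; its measurability in time comes from Tonelli, because
  its transition function is the inner integral of Kac's formula.\<close>

lemma moment_eq_resolvent:
  assumes J: "finite J" "J \<noteq> {}" and rc: "\<And>j. right_cont_obs \<Omega> (g j)" and l: "\<And>j. l j \<ge> 1" and x: "x \<in> S"
  defines "h \<equiv> \<lambda>y. \<Sum>j\<in>J. g j y * moment P l g (J - {j}) y"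
  shows "moment P l g J x = resolvent P (\<Sum>j\<in>J. l j) h x"
    and "time_measurable P h x"
proof -
  define L where "L = (\<Sum>j\<in>J. l j)"
  define W where "W s = (\<integral>\<^sup>+\<omega>. (\<Sum>j\<in>J. ennreal (g j (\<omega> (max 0 s))) * 
    (\<integral>\<^sup>+\<omega>'. (\<Prod>i\<in>J-{j}. discounted (l i) (g i) \<omega>') \<partial>P (\<omega> (max 0 s)))) \<partial>P x)" for s
  have g0: "0 \<le> g j y" for j y using rc[of j] by (auto simp: right_cont_obs_def)
  have gm: "g j \<in> borel_measurable borel" for j using rc[of j] by (auto simp: right_cont_obs_def)
  note kac = kac_nn[where g = g and l = l, OF J rc x, folded W_def L_def]
  have hm: "h \<in> borel_measurable (restrict_space borel S)"
    unfolding h_def 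
    by (intro borel_measurable_sum borel_measurable_times moment_measurable rc measurable_restrict_space1 gm)
  have J': "finite (J - {j})" for j using J by simp
  have h0: "0 \<le> h y" if "y \<in> S" for y
    unfolding h_def using moment_nn(2)[OF J' rc l that] g0 by (intro sum_nonneg mult_nonneg_nonneg) auto
  have Weq: "(\<integral>\<^sup>+\<omega>. ennreal (h (\<omega> (max 0 s))) \<partial>P x) = W s" for s
    unfolding W_def
  proof (rule nn_integral_cong)
    fix \<omega> assume "\<omega> \<in> space (P x)"
    then have y: "\<omega> (max 0 s) \<in> S" by (simp add: space_P[OF x] path_in)
    show "ennreal (h (\<omega> (max 0 s))) = (\<Sum>j\<in>J. ennreal (g j (\<omega> (max 0 s))) * 
      (\<integral>\<^sup>+\<omega>'. (\<Prod>i\<in>J-{j}. discounted (l i) (g i) \<omega>') \<partial>P (\<omega> (max 0 s))))"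
      unfolding h_def moment_nn(1)[OF J' rc l y, symmetric]
      using moment_nn(2)[OF J' rc l y] g0 by (simp add: sum_ennreal[symmetric] ennreal_mult)
  qed
  have T: "trans_op P (max 0 s) h x = enn2real (W s)" for s
  proof -
    have "trans_op P (max 0 s) h x = enn2real (\<integral>\<^sup>+\<omega>. ennreal (h (\<omega> (max 0 s))) \<partial>P x)"
      unfolding trans_op_def
    proof (rule integral_eq_nn_integral)
      show "(\<lambda>\<omega>. h (\<omega> (max 0 s))) \<in> borel_measurable (P x)"
        using measurable_compose[OF eval_S[of "max 0 s"] hm] by (simp add: measurable_cong_sets[OF sets_P[OF x] refl])
      show "AE \<omega> in P x. 0 \<le> h (\<omega> (max 0 s))"
        by (rule AE_I2) (use h0 in \<open>simp add: space_P[OF x] path_in\<close>)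
    qed
    also note Weq
    finally show ?thesis .
  qed
  then have Tm: "(\<lambda>s. trans_op P (max 0 s) h x) \<in> borel_measurable borel"
    using kac(2) by simp
  then show "time_measurable P h x" by (simp add: time_measurable_def)
  have h1: "h y \<le> card J" if "y \<in> S" for y
  proof -
    have "h y \<le> (\<Sum>j\<in>J. 1)"
      unfolding h_def using moment_nn(2,3)[OF J' rc l that] g0 rc
      by (intro sum_mono mult_le_one) (auto simp: right_cont_obs_def)
    then show ?thesis by simp
  qed
  \<comment> \<open>Boundedness of \<open>h\<close> makes \<open>W s\<close> finite, so that nothing
    was lost in passing through \<open>enn2real\<close>.\<close>
  have Wfin: "W s = ennreal (trans_op P (max 0 s) h x)" for s
  proof -
    interpret prob_space "P x" by (rule prob[OF x])
    have "W s = (\<integral>\<^sup>+\<omega>. ennreal (h (\<omega> (max 0 s))) \<partial>P x)" by (rule Weq[symmetric])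
    also have "\<dots> \<le> (\<integral>\<^sup>+\<omega>. ennreal (card J) \<partial>P x)"
      by (rule nn_integral_mono) (use h1 in \<open>auto simp: space_P[OF x] path_in intro!: ennreal_leI\<close>)
    also have "\<dots> < \<top>" by (simp add: emeasure_space_1)
    finally show ?thesis by (simp add: T)
  qed
  have T0: "0 \<le> trans_op P (max 0 s) h x" for s unfolding T by simp
  have T1: "0 \<le> trans_op P s h x" if "0 \<le> s" for s using T0[of s] that by simp
  have "resolvent P L h x = (\<integral>s. (if 0 \<le> s then exp (- L * s) * trans_op P (max 0 s) h x else 0) \<partial>lborel)"
    unfolding resolvent_def set_lebesgue_integral_def
    by (intro Bochner_Integration.integral_cong) (auto simp: indicator_def)
  also have "\<dots> = enn2real (\<integral>\<^sup>+s. ennreal (if 0 \<le> s then exp (- L * s) * trans_op P (max 0 s) h x else 0) \<partial>lborel)"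
    by (rule integral_eq_nn_integral) (use T1 Tm in auto)
  also have "(\<integral>\<^sup>+s. ennreal (if 0 \<le> s then exp (- L * s) * trans_op P (max 0 s) h x else 0) \<partial>lborel) =
    (\<integral>\<^sup>+s. (if 0 \<le> s then ennreal (exp (- L * s)) * W s else 0) \<partial>lborel)"
    by (rule nn_integral_cong) (simp add: Wfin ennreal_mult T1)
  also have "\<dots> = ennreal (moment P l g J x)"
    unfolding kac(1)[symmetric] moment_nn(1)[OF J(1) rc l x] ..
  finally show "moment P l g J x = resolvent P (\<Sum>j\<in>J. l j) h x"
    using moment_nn(2)[OF J(1) rc l x] by (simp add: L_def)
qed

end

section \<open>Resolvents\<close>

lemma exp_tail_integral:
  assumes "lam > 0"
  shows "integrable lborel (\<lambda>s::real. if 0 \<le> s then exp (- lam * s) else 0)"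
    "(\<integral>s. (if 0 \<le> s then exp (- lam * s) else 0) \<partial>lborel) = 1 / lam"
proof -
  have "(\<integral>\<^sup>+s. ennreal (if 0 \<le> s then exp (- lam * s) else 0) \<partial>lborel) = ennreal (1 / lam)"
    unfolding nn_integral_exp_tail[OF assms, symmetric] by (rule nn_integral_cong) auto
  then have "has_bochner_integral lborel (\<lambda>s::real. if 0 \<le> s then exp (- lam * s) else 0) (1 / lam)"
    using assms by (intro has_bochner_integral_nn_integral) auto
  then show "integrable lborel (\<lambda>s::real. if 0 \<le> s then exp (- lam * s) else 0)"
    "(\<integral>s. (if 0 \<le> s then exp (- lam * s) else 0) \<partial>lborel) = 1 / lam"
    by (auto simp: has_bochner_integral_iff)
qed

lemma resolvent_eq_integral:
  "resolvent P lam f x = (\<integral>s. (if 0 \<le> s then exp (- lam * s) * trans_op P (max 0 s) f x else 0) \<partial>lborel)"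
  unfolding resolvent_def set_lebesgue_integral_def
  by (intro Bochner_Integration.integral_cong) (auto simp: indicator_def)

context markov_paths
begin

lemma eval_measurable_P:
  assumes "f \<in> borel_measurable (restrict_space borel S)" "x \<in> S" "t \<ge> 0"
  shows "(\<lambda>\<omega>. f (\<omega> t)) \<in> borel_measurable (P x)"
  using measurable_compose[OF eval_S[OF assms(3)] assms(1)] by (simp add: measurable_cong_sets[OF sets_P[OF assms(2)] refl])

lemma eval_integrable:
  fixes f :: "'e \<Rightarrow> real"
  assumes "f \<in> borel_measurable (restrict_space borel S)" "x \<in> S" "t \<ge> 0" "\<forall>y\<in>S. \<bar>f y\<bar> \<le> B"
  shows "integrable (P x) (\<lambda>\<omega>. f (\<omega> t))"
proof -
  interpret prob_space "P x" by (rule prob[OF assms(2)])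
  show ?thesis
    by (rule integrable_const_bound[where B = B])
      (use assms in \<open>auto intro!: eval_measurable_P simp: space_P path_in\<close>)
qed

lemma resolvent_integrand_le:
  assumes "x \<in> S" "\<forall>y\<in>S. \<bar>f y\<bar> \<le> B" "B \<ge> 0"
  shows "\<bar>if 0 \<le> s then exp (- lam * s) * trans_op P (max 0 s) f x else 0\<bar> \<le> B * (if 0 \<le> s then exp (- lam * s) else 0)"
  using trans_op_bound[of x "max 0 s" f B] assms by (auto simp: abs_mult)

lemma resolvent_integrable:
  assumes "lam > 0" "x \<in> S" "\<forall>y\<in>S. \<bar>f y\<bar> \<le> B" "B \<ge> 0" "time_measurable P f x"
  shows "integrable lborel (\<lambda>s. if 0 \<le> s then exp (- lam * s) * trans_op P (max 0 s) f x else 0)"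
proof (rule Bochner_Integration.integrable_bound)
  show "integrable lborel (\<lambda>s. B * (if 0 \<le> s then exp (- lam * s) else 0))"
    using exp_tail_integral(1)[OF assms(1)] by simp
  note assms(5)[unfolded time_measurable_def, measurable]
  show "(\<lambda>s. if 0 \<le> s then exp (- lam * s) * trans_op P (max 0 s) f x else 0) \<in> borel_measurable lborel"
    by measurable
  show "AE s in lborel. norm (if 0 \<le> s then exp (- lam * s) * trans_op P (max 0 s) f x else 0)
      \<le> norm (B * (if 0 \<le> s then exp (- lam * s) else 0))"
    using resolvent_integrand_le[OF assms(2,3,4), of _ lam] assms(4)
    by (intro AE_I2) (simp add: abs_mult)
qed

text \<open>If the time integrand is not integrable, the resolvent is 0 by convention and respects
  the bound. The bound is thus available for the approximating resolvents of arbitrary bounded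
  functions.\<close>

lemma resolvent_bound:
  assumes "lam > 0" "x \<in> S" "\<forall>y\<in>S. \<bar>f y\<bar> \<le> B" "B \<ge> 0"
  shows "\<bar>resolvent P lam f x\<bar> \<le> B / lam"
proof (cases "integrable lborel (\<lambda>s. if 0 \<le> s then exp (- lam * s) * trans_op P (max 0 s) f x else 0)")
  case True
  have "\<bar>resolvent P lam f x\<bar> \<le> (\<integral>s. \<bar>if 0 \<le> s then exp (- lam * s) * trans_op P (max 0 s) f x else 0\<bar> \<partial>lborel)"
    unfolding resolvent_eq_integral by (rule integral_abs_bound)
  also have "\<dots> \<le> (\<integral>s. B * (if 0 \<le> s then exp (- lam * s) else 0) \<partial>lborel)"
    by (rule integral_mono) (use True exp_tail_integral(1)[OF assms(1)] resolvent_integrand_le[OF assms(2,3,4)] in auto)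
  also have "\<dots> = B / lam" using exp_tail_integral(2)[OF assms(1)] by simp
  finally show ?thesis .
next
  case False
  then show ?thesis using assms(1,4) by (simp add: resolvent_eq_integral not_integrable_integral_eq)
qed

text \<open>The time integral defining the left-hand resolvent may be a junk value \<open>0\<close>, as \<open>t \<mapsto> P\<^sub>t f x\<close>
  need not be measurable; the inequality survives because both functions are nonnegative.\<close>
lemma resolvent_mono:
  assumes "lam > 0" "x \<in> S" "f \<in> borel_measurable (restrict_space borel S)" "g \<in> borel_measurable (restrict_space borel S)"
    "\<forall>y\<in>S. 0 \<le> f y \<and> f y \<le> g y \<and> g y \<le> c" "time_measurable P g x"
  shows "0 \<le> resolvent P lam f x \<and> resolvent P lam f x \<le> resolvent P lam g x"
proof -
  have c0: "c \<ge> 0" using assms(2,5) by (meson order_trans)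
  have fb: "\<forall>y\<in>S. \<bar>f y\<bar> \<le> c" and gb: "\<forall>y\<in>S. \<bar>g y\<bar> \<le> c" using assms(5) by force+
  have Tf: "0 \<le> trans_op P t f x" "trans_op P t f x \<le> trans_op P t g x" if "t \<ge> 0" for t
  proof -
    show "0 \<le> trans_op P t f x"
      unfolding trans_op_def using assms(2,5) that
      by (intro Bochner_Integration.integral_nonneg_AE AE_I2) (auto simp: space_P path_in)
    show "trans_op P t f x \<le> trans_op P t g x"
      unfolding trans_op_def using assms that
      by (intro integral_mono eval_integrable[where B = c] fb gb) (auto simp: space_P path_in)
  qed
  have ig: "integrable lborel (\<lambda>s. if 0 \<le> s then exp (- lam * s) * trans_op P (max 0 s) g x else 0)"
    by (rule resolvent_integrable[OF assms(1,2) gb c0 assms(6)])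
  have f0: "0 \<le> resolvent P lam f x" and g0: "0 \<le> resolvent P lam g x"
    unfolding resolvent_eq_integral using Tf order_trans[OF Tf]
    by (auto intro!: Bochner_Integration.integral_nonneg mult_nonneg_nonneg)
  show ?thesis
  proof (cases "integrable lborel (\<lambda>s. if 0 \<le> s then exp (- lam * s) * trans_op P (max 0 s) f x else 0)")
    case True
    have "resolvent P lam f x \<le> resolvent P lam g x"
      unfolding resolvent_eq_integral by (rule integral_mono[OF True ig]) (use Tf in auto)
    then show ?thesis using f0 by simp
  next
    case False
    then have "resolvent P lam f x = 0" by (simp add: resolvent_eq_integral not_integrable_integral_eq)
    then show ?thesis using g0 by simp
  qed
qed

lemma trans_op_const_minus:
  assumes "x \<in> S" "t \<ge> 0" "f \<in> borel_measurable (restrict_space borel S)" "\<forall>y\<in>S. \<bar>f y\<bar> \<le> B"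
  shows "trans_op P t (\<lambda>y. c - f y) x = c - trans_op P t f x"
proof -
  interpret prob_space "P x" by (rule prob[OF assms(1)])
  show ?thesis
    unfolding trans_op_def using eval_integrable[OF assms(3,1,2,4)] by (simp add: prob_space)
qed

text \<open>\<open>resolvent_mono\<close> demands measurability in time of the larger function.
  Reflection at the constant \<open>c\<close> exchanges the roles of larger and smaller and so gives
  access to estimates from above.\<close>

lemma resolvent_const_minus:
  assumes "lam > 0" "x \<in> S" "f \<in> borel_measurable (restrict_space borel S)" 
    "\<forall>y\<in>S. \<bar>f y\<bar> \<le> B" "B \<ge> 0" "time_measurable P f x"
  shows "resolvent P lam (\<lambda>y. c - f y) x = c / lam - resolvent P lam f x"
    and "time_measurable P (\<lambda>y. c - f y) x"
proof -
  have T: "trans_op P (max 0 s) (\<lambda>y. c - f y) x = c - trans_op P (max 0 s) f x" for s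
    by (rule trans_op_const_minus[OF assms(2) max.cobounded1 assms(3,4)])
  show "time_measurable P (\<lambda>y. c - f y) x"
    using assms(6) by (simp add: time_measurable_def T)
  have "resolvent P lam (\<lambda>y. c - f y) x = (\<integral>s. c * (if 0 \<le> s then exp (- lam * s) else 0) -
     (if 0 \<le> s then exp (- lam * s) * trans_op P (max 0 s) f x else 0) \<partial>lborel)"
    unfolding resolvent_eq_integral T by (rule Bochner_Integration.integral_cong) (auto simp: algebra_simps)
  also have "\<dots> = c * (1 / lam) - resolvent P lam f x"
    unfolding resolvent_eq_integral
    using resolvent_integrable[OF assms(1,2,4,5,6)] exp_tail_integral[OF assms(1)] by simp
  finally show "resolvent P lam (\<lambda>y. c - f y) x = c / lam - resolvent P lam f x" by simp
qed

lemma trans_op_joint_measurable: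
  assumes f: "f \<in> borel_measurable borel" and f0: "\<And>y. 0 \<le> f y" 
    and rc: "\<And>\<omega> t. \<omega> \<in> \<Omega> \<Longrightarrow> t \<ge> 0 \<Longrightarrow> continuous (at_right t) (\<lambda>s. f (\<omega> s))"
  shows "(\<lambda>(s, x). trans_op P (max 0 s) f x) \<in> borel_measurable (borel \<Otimes>\<^sub>M restrict_space borel S)"
proof -
  have j: "(\<lambda>(t, \<omega>). f (\<omega> (max 0 t))) \<in> borel_measurable (borel \<Otimes>\<^sub>M path_space \<Omega>)"
    by (rule measurable_right_continuous)
      (use rc in \<open>auto intro: measurable_compose[OF measurable_eval_path_space f]\<close>)
  have k: "(\<lambda>(t, x). P x) \<in> measurable (borel \<Otimes>\<^sub>M restrict_space borel S) (subprob_algebra (path_space \<Omega>))"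
    unfolding split_beta by (rule measurable_compose[OF measurable_snd kernel])
  have "(\<lambda>((t, x), \<omega>). f (\<omega> (max 0 t))) \<in> 
    borel_measurable ((borel \<Otimes>\<^sub>M restrict_space borel S) \<Otimes>\<^sub>M path_space \<Omega>)"
  proof -
    have "(\<lambda>z::(real \<times> 'e) \<times> (real \<Rightarrow> 'e). (\<lambda>(t, \<omega>). f (\<omega> (max 0 t))) (fst (fst z), snd z)) \<in> 
      borel_measurable ((borel \<Otimes>\<^sub>M restrict_space borel S) \<Otimes>\<^sub>M path_space \<Omega>)"
      by (rule measurable_compose[OF _ j]) measurable
    then show ?thesis by (simp add: case_prod_unfold)
  qed
  then have "(\<lambda>z. \<integral>\<^sup>+\<omega>. ennreal ((\<lambda>(t, x) \<omega>. f (\<omega> (max 0 t))) z \<omega>) \<partial>(\<lambda>(t, x). P x) z) 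
      \<in> borel_measurable (borel \<Otimes>\<^sub>M restrict_space borel S)"
    by (intro nn_integral_measurable_subprob_algebra2[OF _ k]) (simp add: case_prod_unfold)
  then have m: "(\<lambda>(t, x). \<integral>\<^sup>+\<omega>. ennreal (f (\<omega> (max 0 t))) \<partial>P x) \<in> borel_measurable (borel \<Otimes>\<^sub>M restrict_space borel S)"
    by (simp add: split_beta)
  have T: "trans_op P (max 0 t) f x = enn2real (\<integral>\<^sup>+\<omega>. ennreal (f (\<omega> (max 0 t))) \<partial>P x)" if "x \<in> S" for t x
    unfolding trans_op_def using f0 f that
    by (intro integral_eq_nn_integral) (auto intro!: eval_measurable_P measurable_restrict_space1)
  show ?thesis
    using borel_measurable_enn2real[OF m]
    by (subst measurable_cong[where g = "\<lambda>(t, x). enn2real (\<integral>\<^sup>+\<omega>. ennreal (f (\<omega> (max 0 t))) \<partial>P x)"])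
      (auto simp: space_pair_measure T split_beta)
qed

lemma time_measurableI:
  assumes "f \<in> borel_measurable borel" "\<And>y. 0 \<le> f y" 
    "\<And>\<omega> t. \<omega> \<in> \<Omega> \<Longrightarrow> t \<ge> 0 \<Longrightarrow> continuous (at_right t) (\<lambda>s. f (\<omega> s))" "x \<in> S"
  shows "time_measurable P f x"
  using measurable_compose[OF measurable_Pair2'[of x "restrict_space borel S" borel] trans_op_joint_measurable[OF assms(1-3)]] assms(4)
  by (simp add: time_measurable_def)

text \<open>Tonelli moves the time integral outside and stationarity makes the space integral
  independent of time. Applied to both sides of a bracket, this is the control of its
  \<open>L^1(m)\<close> width under a resolvent.\<close>

lemma integral_resolvent_stationary:
  assumes S: "S = UNIV" and \<mu>: "prob_space \<mu>" "sets \<mu> = sets borel" and inv: "invariant_measure \<mu> P"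
    and lam: "lam > 0"
    and f: "f \<in> borel_measurable borel" and f0: "\<And>y. 0 \<le> f y" and fB: "\<And>y. f y \<le> B"
    and rc: "\<And>\<omega> t. \<omega> \<in> \<Omega> \<Longrightarrow> t \<ge> 0 \<Longrightarrow> continuous (at_right t) (\<lambda>s. f (\<omega> s))"
  shows "integrable \<mu> (resolvent P lam f)" "(\<integral>x. resolvent P lam f x \<partial>\<mu>) = (\<integral>x. f x \<partial>\<mu>) / lam"
proof -
  interpret prob_space \<mu> by (rule \<mu>)
  interpret pr: pair_sigma_finite \<mu> lborel ..
  have fb: "\<bar>f y\<bar> \<le> B" for y using f0[of y] fB[of y] by simp
  then have fbS: "\<forall>y\<in>S. \<bar>f y\<bar> \<le> B" by simp
  have B: "B \<ge> 0" using f0 fB order_trans by blast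
  have T0: "0 \<le> trans_op P t f x" for t x
    unfolding trans_op_def using f0 by simp
  have [measurable]: "f \<in> borel_measurable \<mu>" using f \<mu>(2) by (simp cong: measurable_cong_sets)
  have j: "(\<lambda>(s, x). trans_op P (max 0 s) f x) \<in> borel_measurable (borel \<Otimes>\<^sub>M borel)"
    using trans_op_joint_measurable[OF f f0 rc] S by simp
  have sp: "sets (\<mu> \<Otimes>\<^sub>M lborel) = sets (borel \<Otimes>\<^sub>M (borel :: real measure))"
    by (rule sets_pair_measure_cong[OF \<mu>(2) sets_lborel])
  have j': "(\<lambda>(x, s). trans_op P (max 0 s) f x) \<in> borel_measurable (\<mu> \<Otimes>\<^sub>M lborel)"
    using measurable_compose[OF measurable_pair_swap' j] 
    by (simp add: split_beta measurable_cong_sets[OF sp refl])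
  define G where "G x s = ennreal (if 0 \<le> s then exp (- lam * s) * trans_op P (max 0 s) f x else 0)" for x s
  have Gm: "case_prod G \<in> borel_measurable (\<mu> \<Otimes>\<^sub>M lborel)"
  proof -
    have "(\<lambda>z. if (0::real) \<le> snd z then exp (- lam * snd z) * trans_op P (max 0 (snd z)) f (fst z) else 0) \<in> borel_measurable (\<mu> \<Otimes>\<^sub>M lborel)"
      using j' by (simp add: split_beta)
    then show ?thesis unfolding G_def split_beta by measurable
  qed
  have tm: "time_measurable P f x" for x
    by (rule time_measurableI[OF f f0 rc]) (use S in auto)
  have R: "ennreal (resolvent P lam f x) = (\<integral>\<^sup>+s. G x s \<partial>lborel)" for x
    unfolding G_def resolvent_eq_integral 
    by (rule nn_integral_eq_integral[symmetric, OF resolvent_integrable[OF lam _ fbS B tm]])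
      (use S T0 in auto)
  have R0: "0 \<le> resolvent P lam f x" for x
    unfolding resolvent_eq_integral by (rule Bochner_Integration.integral_nonneg) (use T0 in auto)
  have Rm: "resolvent P lam f \<in> borel_measurable \<mu>"
  proof -
    have "(\<lambda>x. enn2real (\<integral>\<^sup>+s. G x s \<partial>lborel)) \<in> borel_measurable \<mu>"
      using lborel.borel_measurable_nn_integral[OF Gm] by measurable
    then show ?thesis using R0 by (simp add: R[symmetric])
  qed
  have "(\<integral>\<^sup>+x. ennreal (resolvent P lam f x) \<partial>\<mu>) = (\<integral>\<^sup>+s. \<integral>\<^sup>+x. G x s \<partial>\<mu> \<partial>lborel)"
    unfolding R by (rule pr.Fubini'[OF Gm, symmetric])
  also have "\<dots> = (\<integral>\<^sup>+s. (if 0 \<le> s then ennreal (exp (- lam * s)) else 0) * ennreal (\<integral>x. f x \<partial>\<mu>) \<partial>lborel)"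
  proof (rule nn_integral_cong)
    fix s :: real
    have "bdd_meas f" by (rule bdd_measI[OF f fb])
    then have 1: "(\<integral>x. trans_op P (max 0 s) f x \<partial>\<mu>) = (\<integral>x. f x \<partial>\<mu>)"
      using inv unfolding invariant_measure_def by auto
    have "integrable \<mu> (trans_op P (max 0 s) f)"
    proof (rule integrable_const_bound[where B = B])
      show "trans_op P (max 0 s) f \<in> borel_measurable \<mu>"
        using trans_op_measurable[of f "max 0 s"] f S \<mu>(2) by (simp cong: measurable_cong_sets)
      show "AE x in \<mu>. norm (trans_op P (max 0 s) f x) \<le> B"
        using trans_op_bound[OF _ _ fb B] S by simp
    qed
    then have 2: "(\<integral>\<^sup>+x. ennreal (trans_op P (max 0 s) f x) \<partial>\<mu>) = ennreal (\<integral>x. f x \<partial>\<mu>)"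
      unfolding 1[symmetric] using T0 by (intro nn_integral_eq_integral) auto
    have m: "(\<lambda>x. ennreal (trans_op P (max 0 s) f x)) \<in> borel_measurable \<mu>"
      using trans_op_measurable[of f "max 0 s"] f S \<mu>(2) by (simp cong: measurable_cong_sets)
    have "(\<integral>\<^sup>+x. G x s \<partial>\<mu>) = (\<integral>\<^sup>+x. (if 0 \<le> s then ennreal (exp (- lam * s)) else 0) * ennreal (trans_op P (max 0 s) f x) \<partial>\<mu>)"
      unfolding G_def using T0 by (intro nn_integral_cong) (auto simp: ennreal_mult)
    then show "(\<integral>\<^sup>+x. G x s \<partial>\<mu>) = (if 0 \<le> s then ennreal (exp (- lam * s)) else 0) * ennreal (\<integral>x. f x \<partial>\<mu>)"
      by (simp only: nn_integral_cmult[OF m] 2)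
  qed
  also have "\<dots> = ennreal (1 / lam) * ennreal (\<integral>x. f x \<partial>\<mu>)"
    by (subst nn_integral_multc) (auto simp: nn_integral_exp_tail[OF lam])
  also have "\<dots> = ennreal ((\<integral>x. f x \<partial>\<mu>) / lam)"
    using lam f0 by (simp add: ennreal_mult[symmetric])
  finally have "has_bochner_integral \<mu> (resolvent P lam f) ((\<integral>x. f x \<partial>\<mu>) / lam)"
    using Rm R0 lam f0 by (intro has_bochner_integral_nn_integral) auto
  then show "integrable \<mu> (resolvent P lam f)" "(\<integral>x. resolvent P lam f x \<partial>\<mu>) = (\<integral>x. f x \<partial>\<mu>) / lam"
    by (auto simp: has_bochner_integral_iff)
qed

end

section \<open>Weak convergence of complex measures\<close>

lemma Cb_mult:
  assumes "f \<in> Cb" "g \<in> Cb" shows "(\<lambda>x. f x * g x) \<in> Cb"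
proof -
  obtain B C where "\<forall>x. \<bar>f x\<bar> \<le> B" "\<forall>x. \<bar>g x\<bar> \<le> C" using assms Cb_bound by meson
  then have "\<bar>f x * g x\<bar> \<le> B * C" for x
    unfolding abs_mult by (intro mult_mono) (auto intro: order_trans[OF abs_ge_zero])
  then show ?thesis
    using assms by (intro CbI[where B = "B * C"] continuous_intros) (auto simp: Cb_cont)
qed

lemma Cb_measurable: "f \<in> Cb \<Longrightarrow> f \<in> borel_measurable borel"
  by (simp add: Cb_cont borel_measurable_continuous_onI)

lemma cmeasure_cont_measurable:
  assumes "cmeasure_on (restrict_space borel S) \<Sigma>" "f \<in> borel_measurable borel"
  shows "f \<in> borel_measurable (fst \<Sigma>)"
  using assms measurable_restrict_space1[OF assms(2), of S]
  by (simp add: cmeasure_on_def cong: measurable_cong_sets)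

lemma cmeasure_space:
  assumes "cmeasure_on (restrict_space borel S) \<Sigma>"
  shows "space (fst \<Sigma>) = S"
  using assms sets_eq_imp_space_eq[of "fst \<Sigma>" "restrict_space borel S"] by (simp add: cmeasure_on_def space_restrict_space)

text \<open>Together with linearity these are the properties that
  \<open>weakly_null_functionals\<close> demands of each single functional.\<close>

lemma
  fixes \<psi> :: "'e::topological_space \<Rightarrow> complex"
  assumes cm: "cmeasure_on (restrict_space borel S) \<Sigma>"
    and \<psi>: "continuous_on UNIV \<psi>" "bounded (range \<psi>)"
  shows cmeasure_integrable: "f \<in> Cb \<Longrightarrow> integrable (fst \<Sigma>) (\<lambda>x. complex_of_real (f x) * \<psi> x * snd \<Sigma> x)"
    and cmeasure_bound: "\<exists>K\<ge>0. \<forall>f\<in>Cb. \<forall>B. (\<forall>x. \<bar>f x\<bar> \<le> B) \<longrightarrow> norm (cint \<Sigma> (\<lambda>x. complex_of_real (f x) * \<psi> x)) \<le> K * B"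
    and cmeasure_dominated: "(\<And>k::nat. h k \<in> Cb) \<Longrightarrow> (\<And>k x. \<bar>h k x\<bar> \<le> B) \<Longrightarrow> (\<And>x. (\<lambda>k. h k x) \<longlonglongrightarrow> g x) \<Longrightarrow> g \<in> Cb \<Longrightarrow>
      (\<lambda>k. cint \<Sigma> (\<lambda>x. complex_of_real (h k x) * \<psi> x)) \<longlonglongrightarrow> cint \<Sigma> (\<lambda>x. complex_of_real (g x) * \<psi> x)"
proof -
  interpret finite_measure "fst \<Sigma>" using cm by (simp add: cmeasure_on_def)
  obtain A where A: "\<And>x. norm (\<psi> x) \<le> A" using \<psi>(2) by (auto simp: bounded_iff)
  obtain C where C: "\<And>x. x \<in> space (fst \<Sigma>) \<Longrightarrow> norm (snd \<Sigma> x) \<le> C" 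
    using cm cmeasure_space[OF cm] by (auto simp: bounded_iff cmeasure_on_def space_restrict_space)
  \<comment> \<open>On an empty space the bound \<open>C\<close> could be negative; the maximum
    excludes that.\<close>
  define C' where "C' = max C 0"
  have A0: "A \<ge> 0" using A order_trans norm_ge_zero by blast
  have C': "x \<in> space (fst \<Sigma>) \<Longrightarrow> norm (snd \<Sigma> x) \<le> C'" "C' \<ge> 0" for x using C[of x] by (auto simp: C'_def)
  have sm[measurable]: "snd \<Sigma> \<in> borel_measurable (fst \<Sigma>)" 
    using cm by (simp add: cmeasure_on_def cong: measurable_cong_sets)
  have \<psi>m[measurable]: "\<psi> \<in> borel_measurable (fst \<Sigma>)"
    using measurable_restrict_space1[OF borel_measurable_continuous_onI[OF \<psi>(1)], of S] cm 
    by (simp add: cmeasure_on_def cong: measurable_cong_sets)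
  have fm: "f \<in> Cb \<Longrightarrow> f \<in> borel_measurable (fst \<Sigma>)" for f
    by (rule cmeasure_cont_measurable[OF cm Cb_measurable])
  have bd: "norm (complex_of_real (f x) * \<psi> x * snd \<Sigma> x) \<le> B * (A * C')" 
    if "x \<in> space (fst \<Sigma>)" "\<bar>f x\<bar> \<le> B" for f x B
    unfolding norm_mult mult.assoc using A[of x] C'(1)[OF that(1)] that(2) A0 C'(2)
    by (intro mult_mono) (auto intro: order_trans[OF abs_ge_zero])
  have int: "integrable (fst \<Sigma>) (\<lambda>x. complex_of_real (f x) * \<psi> x * snd \<Sigma> x)" if f: "f \<in> Cb" for f
  proof -
    obtain B where B: "\<forall>x. \<bar>f x\<bar> \<le> B" using Cb_bound[OF f] by blast
    show ?thesis
      by (rule integrable_const_bound[where B = "B * (A * C')"]) (use bd B fm[OF f] in auto)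
  qed
  show "f \<in> Cb \<Longrightarrow> integrable (fst \<Sigma>) (\<lambda>x. complex_of_real (f x) * \<psi> x * snd \<Sigma> x)" by (rule int)
  show "\<exists>K\<ge>0. \<forall>f\<in>Cb. \<forall>B. (\<forall>x. \<bar>f x\<bar> \<le> B) \<longrightarrow> norm (cint \<Sigma> (\<lambda>x. complex_of_real (f x) * \<psi> x)) \<le> K * B"
  proof (intro exI[of _ "A * C' * measure (fst \<Sigma>) (space (fst \<Sigma>))"] conjI ballI allI impI)
    show "0 \<le> A * C' * measure (fst \<Sigma>) (space (fst \<Sigma>))" using A0 C'(2) by simp
    fix f :: "'e \<Rightarrow> real" and B assume f: "f \<in> Cb" and B: "\<forall>x. \<bar>f x\<bar> \<le> B"
    have "norm (cint \<Sigma> (\<lambda>x. complex_of_real (f x) * \<psi> x)) \<le> (\<integral>x. norm (complex_of_real (f x) * \<psi> x * snd \<Sigma> x) \<partial>fst \<Sigma>)"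
      unfolding cint_def by (rule integral_norm_bound)
    also have "\<dots> \<le> (\<integral>x. B * (A * C') \<partial>fst \<Sigma>)"
      by (rule integral_mono) (use int[OF f] bd B in auto)
    also have "\<dots> = A * C' * measure (fst \<Sigma>) (space (fst \<Sigma>)) * B" by simp
    finally show "norm (cint \<Sigma> (\<lambda>x. complex_of_real (f x) * \<psi> x)) \<le> A * C' * measure (fst \<Sigma>) (space (fst \<Sigma>)) * B" .
  qed
  assume h: "\<And>k::nat. h k \<in> Cb" and B: "\<And>k x. \<bar>h k x\<bar> \<le> B" and lim: "\<And>x. (\<lambda>k. h k x) \<longlonglongrightarrow> g x" and g: "g \<in> Cb"
  show "(\<lambda>k. cint \<Sigma> (\<lambda>x. complex_of_real (h k x) * \<psi> x)) \<longlonglongrightarrow> cint \<Sigma> (\<lambda>x. complex_of_real (g x) * \<psi> x)"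
    unfolding cint_def
  proof (rule integral_dominated_convergence[where w = "\<lambda>_. B * (A * C')"])
    show "AE x in fst \<Sigma>. (\<lambda>k. complex_of_real (h k x) * \<psi> x * snd \<Sigma> x) \<longlonglongrightarrow> complex_of_real (g x) * \<psi> x * snd \<Sigma> x"
      by (intro AE_I2 tendsto_intros lim)
    show "AE x in fst \<Sigma>. norm (complex_of_real (h k x) * \<psi> x * snd \<Sigma> x) \<le> B * (A * C')" for k
      by (rule AE_I2) (rule bd[OF _ B])
  qed (use int[OF h] int[OF g] in \<open>auto intro: borel_measurable_integrable\<close>)
qed

text \<open>The difference splits into the error of the measures tested on the moving functions
  \<open>F n\<close>, and the error of the functions tested on the fixed limit measure. The first
  vanishes by \<open>equilipschitz_tendsto_zero\<close>, the second by dominated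
  convergence.\<close>

lemma cint_equilipschitz_tendsto:
  fixes \<psi> :: "'e::metric_space \<Rightarrow> complex" and D :: "'e set"
  assumes D: "countable D" "closure D = UNIV"
    and cmN: "\<And>N. cmeasure_on (restrict_space borel (S N)) (\<Sigma>N N)" and cm: "cmeasure_on borel \<Sigma>"
    and wc: "weak_conv_cm \<Sigma>N \<Sigma>"
    and \<psi>: "continuous_on UNIV \<psi>" "bounded (range \<psi>)"
    and lip: "\<And>n. L-lipschitz_on UNIV (F n)" and FB: "\<And>n x. \<bar>F n x\<bar> \<le> B" and lim: "\<And>x. (\<lambda>n. F n x) \<longlonglongrightarrow> G x"
  shows "(\<lambda>n. cint (\<Sigma>N n) (\<lambda>x. complex_of_real (F n x) * \<psi> x)) \<longlonglongrightarrow> cint \<Sigma> (\<lambda>x. complex_of_real (G x) * \<psi> x)"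
proof -
  have cm': "cmeasure_on (restrict_space borel UNIV) \<Sigma>" using cm 
    by (simp add: cmeasure_on_def sets_restrict_UNIV space_restrict_space measurable_cong_sets[OF sets_restrict_UNIV refl])
  define T where "T \<Sigma> f = cint \<Sigma> (\<lambda>x. complex_of_real (f x) * \<psi> x)" for \<Sigma> :: "'e measure \<times> ('e \<Rightarrow> complex)" and f
  have lin: "T \<Theta> (\<lambda>x. a * f x + g x) = a * T \<Theta> f + T \<Theta> g" 
    if \<Theta>: "cmeasure_on (restrict_space borel U) \<Theta>" and fg: "f \<in> Cb" "g \<in> Cb" for \<Theta> U a f g
  proof -
    note int = cmeasure_integrable[OF \<Theta> \<psi>]
    have "T \<Theta> (\<lambda>x. a * f x + g x) = (\<integral>x. a * (complex_of_real (f x) * \<psi> x * snd \<Theta> x) + complex_of_real (g x) * \<psi> x * snd \<Theta> x \<partial>fst \<Theta>)"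
      unfolding T_def cint_def by (rule Bochner_Integration.integral_cong) (auto simp: algebra_simps)
    also have "\<dots> = a * T \<Theta> f + T \<Theta> g"
      unfolding T_def cint_def by (subst Bochner_Integration.integral_add) (use int fg in auto)
    finally show ?thesis .
  qed
  have conv: "(\<lambda>N. T (\<Sigma>N N) f) \<longlonglongrightarrow> T \<Sigma> f" if f: "f \<in> Cb" for f
  proof -
    obtain A where A: "\<And>x. norm (\<psi> x) \<le> A" using \<psi>(2) by (auto simp: bounded_iff)
    have "(\<lambda>x. Re (\<psi> x)) \<in> Cb" 
      by (rule CbI[OF _ order_trans[OF abs_Re_le_cmod A]]) (intro continuous_intros \<psi>(1))
    moreover have "(\<lambda>x. Im (\<psi> x)) \<in> Cb"
      by (rule CbI[OF _ order_trans[OF abs_Im_le_cmod A]]) (intro continuous_intros \<psi>(1))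
    ultimately have re: "(\<lambda>x. f x * Re (\<psi> x)) \<in> Cb" and im: "(\<lambda>x. f x * Im (\<psi> x)) \<in> Cb"
      by (auto intro: Cb_mult f)
    \<comment> \<open>\<open>weak_conv_cm\<close> tests with real functions, so the complex weight
      \<open>\<psi>\<close> is split before weak convergence can be applied.\<close>
    have split: "T \<Theta> f = cint \<Theta> (\<lambda>x. complex_of_real (f x * Re (\<psi> x))) + \<i> * cint \<Theta> (\<lambda>x. complex_of_real (f x * Im (\<psi> x)))"
      if \<Theta>: "cmeasure_on (restrict_space borel U) \<Theta>" for \<Theta> U
    proof -
      have int: "integrable (fst \<Theta>) (\<lambda>x. complex_of_real (h x) * snd \<Theta> x)" if "h \<in> Cb" for h
        using cmeasure_integrable[OF \<Theta>, of "\<lambda>_. 1" h] that by simp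
      have "T \<Theta> f = (\<integral>x. complex_of_real (f x * Re (\<psi> x)) * snd \<Theta> x + \<i> * (complex_of_real (f x * Im (\<psi> x)) * snd \<Theta> x) \<partial>fst \<Theta>)"
        unfolding T_def cint_def
      proof (rule Bochner_Integration.integral_cong[OF refl])
        fix x
        show "complex_of_real (f x) * \<psi> x * snd \<Theta> x = complex_of_real (f x * Re (\<psi> x)) * snd \<Theta> x + \<i> * (complex_of_real (f x * Im (\<psi> x)) * snd \<Theta> x)"
          by (simp add: complex_eq_iff algebra_simps)
      qed
      also have "\<dots> = cint \<Theta> (\<lambda>x. complex_of_real (f x * Re (\<psi> x))) + \<i> * cint \<Theta> (\<lambda>x. complex_of_real (f x * Im (\<psi> x)))"
        unfolding cint_def by (subst Bochner_Integration.integral_add) (use int[OF re] int[OF im] in auto)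
      finally show ?thesis .
    qed
    have wc': "(\<lambda>N. cint (\<Sigma>N N) (\<lambda>x. complex_of_real (h x))) \<longlonglongrightarrow> cint \<Sigma> (\<lambda>x. complex_of_real (h x))" if "h \<in> Cb" for h
      using wc that unfolding weak_conv_cm_def Cb_def by auto
    show ?thesis
      unfolding split[OF cmN] split[OF cm'] by (intro tendsto_intros wc' re im)
  qed
  \<comment> \<open>The locale treats real functionals; \<open>\<rho>\<close> covers real and
    imaginary part at once.\<close>
  have part: "(\<lambda>n. \<rho> (T (\<Sigma>N n) (F n) - T \<Sigma> (F n))) \<longlonglongrightarrow> 0" if \<rho>: "\<rho> = Re \<or> \<rho> = Im" for \<rho>
  proof -
    have \<rho>_le: "\<bar>\<rho> z\<bar> \<le> norm z" and \<rho>_lim: "(f \<longlongrightarrow> z) X \<Longrightarrow> ((\<lambda>x. \<rho> (f x)) \<longlongrightarrow> \<rho> z) X" and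
      \<rho>_lin: "\<rho> (complex_of_real a * z + w - (complex_of_real a * z' + w')) = a * \<rho> (z - z') + \<rho> (w - w')" 
      for z w z' w' :: complex and a and f :: "nat \<Rightarrow> complex" and X
      using \<rho> abs_Re_le_cmod abs_Im_le_cmod by (auto intro: tendsto_intros simp: algebra_simps)
    have "weakly_null_functionals (\<lambda>n f. \<rho> (T (\<Sigma>N n) f - T \<Sigma> f))"
    proof
      show "\<rho> (T (\<Sigma>N n) (\<lambda>x. a * f x + g x) - T \<Sigma> (\<lambda>x. a * f x + g x)) =
        a * \<rho> (T (\<Sigma>N n) f - T \<Sigma> f) + \<rho> (T (\<Sigma>N n) g - T \<Sigma> g)" if "f \<in> Cb" "g \<in> Cb" for n a f g
        unfolding lin[OF cmN that] lin[OF cm' that] by (rule \<rho>_lin)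
      show "(\<lambda>n. \<rho> (T (\<Sigma>N n) f - T \<Sigma> f)) \<longlonglongrightarrow> 0" if "f \<in> Cb" for f
      proof -
        have "(\<lambda>n. \<rho> (T (\<Sigma>N n) f - T \<Sigma> f)) \<longlonglongrightarrow> \<rho> (T \<Sigma> f - T \<Sigma> f)"
          by (intro \<rho>_lim tendsto_intros conv that)
        then show ?thesis using \<rho> by auto
      qed
      fix n
      obtain K1 where K1: "K1 \<ge> 0" "\<And>f B. f \<in> Cb \<Longrightarrow> (\<forall>x. \<bar>f x\<bar> \<le> B) \<Longrightarrow> norm (T (\<Sigma>N n) f) \<le> K1 * B"
        using cmeasure_bound[OF cmN[of n] \<psi>] unfolding T_def by blast
      obtain K2 where K2: "K2 \<ge> 0" "\<And>f B. f \<in> Cb \<Longrightarrow> (\<forall>x. \<bar>f x\<bar> \<le> B) \<Longrightarrow> norm (T \<Sigma> f) \<le> K2 * B"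
        using cmeasure_bound[OF cm' \<psi>] unfolding T_def by blast
      show "\<exists>c\<ge>0. \<forall>f\<in>Cb. \<forall>B. (\<forall>x. \<bar>f x\<bar> \<le> B) \<longrightarrow> \<bar>\<rho> (T (\<Sigma>N n) f - T \<Sigma> f)\<bar> \<le> c * B"
      proof (intro exI[of _ "K1 + K2"] conjI ballI allI impI)
        fix f :: "'e \<Rightarrow> real" and B assume f: "f \<in> Cb" "\<forall>x. \<bar>f x\<bar> \<le> B"
        have "\<bar>\<rho> (T (\<Sigma>N n) f - T \<Sigma> f)\<bar> \<le> norm (T (\<Sigma>N n) f - T \<Sigma> f)" by (rule \<rho>_le)
        also have "\<dots> \<le> norm (T (\<Sigma>N n) f) + norm (T \<Sigma> f)" by (rule norm_triangle_ineq4)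
        also have "\<dots> \<le> (K1 + K2) * B" using K1(2)[OF f] K2(2)[OF f] by (simp add: algebra_simps)
        finally show "\<bar>\<rho> (T (\<Sigma>N n) f - T \<Sigma> f)\<bar> \<le> (K1 + K2) * B" .
      qed (use K1 K2 in auto)
      fix h :: "nat \<Rightarrow> 'e \<Rightarrow> real" and B g
      assume h: "\<And>k. h k \<in> Cb" "\<And>k x. \<bar>h k x\<bar> \<le> B" "\<And>x. (\<lambda>k. h k x) \<longlonglongrightarrow> g x" "g \<in> Cb"
      show "(\<lambda>k. \<rho> (T (\<Sigma>N n) (h k) - T \<Sigma> (h k))) \<longlonglongrightarrow> \<rho> (T (\<Sigma>N n) g - T \<Sigma> g)"
        unfolding T_def
        by (intro \<rho>_lim tendsto_diff cmeasure_dominated[OF cmN \<psi> h] cmeasure_dominated[OF cm' \<psi> h])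
    qed
    then show ?thesis by (rule weakly_null_functionals.equilipschitz_tendsto_zero[OF _ D lip FB])
  qed
  have "(\<lambda>n. T (\<Sigma>N n) (F n) - T \<Sigma> (F n)) \<longlonglongrightarrow> 0"
    using part[of Re] part[of Im] by (simp add: tendsto_complex_iff)
  moreover have "(\<lambda>n. T \<Sigma> (F n)) \<longlonglongrightarrow> T \<Sigma> G"
  proof -
    have F: "\<And>n. F n \<in> Cb" by (rule Cb_lipschitz[OF lip FB])
    have GB: "\<bar>G x\<bar> \<le> B" for x by (rule bounded_pointwise_limit[of F B G x, OF FB lim])
    have G: "G \<in> Cb"
      by (rule Cb_lipschitz[OF lipschitz_pointwise_limit[OF lip lim] GB])
    show ?thesis
      unfolding T_def by (rule cmeasure_dominated[OF cm' \<psi> F FB lim G])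
  qed
  ultimately have "(\<lambda>n. T (\<Sigma>N n) (F n) - T \<Sigma> (F n) + T \<Sigma> (F n)) \<longlonglongrightarrow> 0 + T \<Sigma> G"
    by (rule tendsto_add)
  then show ?thesis by (simp add: T_def)
qed

section \<open>Convergence of resolvents and moments\<close>

lemma bdd_lipI:
  assumes "L-lipschitz_on UNIV f" "\<And>x. \<bar>f x\<bar> \<le> B" shows "bdd_lip f"
  using assms unfolding bdd_lip_def bounded_iff by auto

lemma lipschitz_on_mult_bounded:
  fixes f g :: "'e::metric_space \<Rightarrow> real"
  assumes f: "L-lipschitz_on UNIV f" "\<And>x. \<bar>f x\<bar> \<le> B" and g: "M-lipschitz_on UNIV g" "\<And>x. \<bar>g x\<bar> \<le> C"
  shows "(B * M + C * L)-lipschitz_on UNIV (\<lambda>x. f x * g x)"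
proof (rule lipschitz_onI)
  have B: "B \<ge> 0" and C: "C \<ge> 0" using f(2) g(2) order_trans abs_ge_zero by blast+
  show "0 \<le> B * M + C * L" using B C lipschitz_on_nonneg[OF f(1)] lipschitz_on_nonneg[OF g(1)] by simp
  fix x y
  have "f x * g x - f y * g y = f x * (g x - g y) + g y * (f x - f y)" by (simp add: algebra_simps)
  also have "\<bar>\<dots>\<bar> \<le> \<bar>f x\<bar> * \<bar>g x - g y\<bar> + \<bar>g y\<bar> * \<bar>f x - f y\<bar>"
    by (rule order_trans[OF abs_triangle_ineq]) (simp add: abs_mult)
  also have "\<dots> \<le> B * (M * dist x y) + C * (L * dist x y)"
    using f(2)[of x] g(2)[of y] B C lipschitz_onD[OF f(1), of x y] lipschitz_onD[OF g(1), of x y]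
    by (intro add_mono mult_mono) (auto simp: dist_real_def)
  finally show "dist (f x * g x) (f y * g y) \<le> (B * M + C * L) * dist x y"
    by (simp add: dist_real_def algebra_simps)
qed

locale markov_approximation =
  fixes D :: "'e::metric_space set" and m :: "'e measure" and P :: "'e \<Rightarrow> (real \<Rightarrow> 'e) measure"
    and EN :: "nat \<Rightarrow> 'e set" and mN :: "nat \<Rightarrow> 'e measure" and \<Omega>N :: "nat \<Rightarrow> (real \<Rightarrow> 'e) set"
    and PN :: "nat \<Rightarrow> 'e \<Rightarrow> (real \<Rightarrow> 'e) measure"
    and C :: "('e \<Rightarrow> complex) set" and Sig :: "('e \<Rightarrow> complex) \<Rightarrow> 'e measure \<times> ('e \<Rightarrow> complex)"
    and SigN :: "nat \<Rightarrow> ('e \<Rightarrow> complex) \<Rightarrow> 'e measure \<times> ('e \<Rightarrow> complex)"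
  assumes sep: "countable D" "closure D = UNIV"
    and m: "prob_space m" "sets m = sets borel"
    and limit_markov: "markov_paths UNIV {\<omega>. cadlag \<omega>} P"
    and stat: "invariant_measure m P"
    and mN: "prob_space (mN N)" "sets (mN N) = sets (restrict_space borel (EN N))"
    and pre_markov: "markov_paths (EN N) (\<Omega>N N) (PN N)"
    and wc: "weak_conv_pm mN m"
    and C: "\<psi> \<in> C \<Longrightarrow> continuous_on UNIV \<psi>" "\<psi> \<in> C \<Longrightarrow> bounded (range \<psi>)"
    and Sig: "\<psi> \<in> C \<Longrightarrow> cmeasure_on borel (Sig \<psi>)"
    and unique: "lam > 0 \<Longrightarrow> bdd_lip f \<Longrightarrow> bdd_lip F \<Longrightarrow> (\<And>\<psi>. \<psi> \<in> C \<Longrightarrow> resolvent_eq (Sig \<psi>) \<psi> m lam F f) \<Longrightarrow>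
       F = resolvent P lam f"
    and SigN: "\<psi> \<in> C \<Longrightarrow> cmeasure_on (restrict_space borel (EN N)) (SigN N \<psi>)"
    and eqN: "\<psi> \<in> C \<Longrightarrow> lam > 0 \<Longrightarrow> f \<in> borel_measurable (mN N) \<Longrightarrow> integrable (mN N) (\<lambda>x. (f x)\<^sup>2) \<Longrightarrow>
       resolvent_eq (SigN N \<psi>) \<psi> (mN N) lam (resolvent (PN N) lam f) f"
    and Sig_conv: "\<psi> \<in> C \<Longrightarrow> weak_conv_cm (\<lambda>N. SigN N \<psi>) (Sig \<psi>)"
    and lip_resolvent: "lam > 0 \<Longrightarrow> \<exists>K>0. \<forall>N f L. L-lipschitz_on (EN N) f \<longrightarrow> 
       (K * L)-lipschitz_on (EN N) (resolvent (PN N) lam f)"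
begin

sublocale lm: markov_paths UNIV "{\<omega>. cadlag \<omega>}" P by (rule limit_markov)

lemma space_mN: "space (mN N) = EN N"
  using sets_eq_imp_space_eq[OF mN(2)] by (simp add: space_restrict_space)

lemma EN_ne: "EN N \<noteq> {}"
  using prob_space.not_empty[OF mN(1), of N] by (simp add: space_mN)

lemma m_measurable: "f \<in> borel_measurable borel \<Longrightarrow> f \<in> borel_measurable m"
  using m(2) by (simp cong: measurable_cong_sets)

lemma mN_measurable: "f \<in> borel_measurable borel \<Longrightarrow> f \<in> borel_measurable (mN N)"
  unfolding measurable_cong_sets[OF mN(2) refl] by (rule measurable_restrict_space1)

lemma cmeasure_m: "cmeasure_on borel (m, \<lambda>_. 1)"
  using m by (simp add: cmeasure_on_def prob_space.finite_measure)

lemma cmeasure_mN: "cmeasure_on (restrict_space borel (EN N)) (mN N, \<lambda>_. 1)"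
  using mN by (auto simp: cmeasure_on_def prob_space.finite_measure intro!: boundedI[where B = 1])

lemma weak_conv_m: "weak_conv_cm (\<lambda>N. (mN N, \<lambda>_. 1)) (m, \<lambda>_. 1)"
  using wc unfolding weak_conv_cm_def weak_conv_pm_def cint_def by (auto intro: tendsto_of_real)

text \<open>A probability measure is treated as a complex measure with density 1, tested with the
  constant weight 1.\<close>

lemma integral_tendsto:
  fixes F :: "nat \<Rightarrow> 'e \<Rightarrow> real"
  assumes "\<And>n. L-lipschitz_on UNIV (F n)" "\<And>n x. \<bar>F n x\<bar> \<le> B" "\<And>x. (\<lambda>n. F n x) \<longlonglongrightarrow> G x"
  shows "(\<lambda>n. \<integral>x. F n x \<partial>mN n) \<longlonglongrightarrow> (\<integral>x. G x \<partial>m)"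
proof -
  have "(\<lambda>n. cint (mN n, \<lambda>_. 1) (\<lambda>x. complex_of_real (F n x) * 1)) \<longlonglongrightarrow> cint (m, \<lambda>_. 1) (\<lambda>x. complex_of_real (G x) * 1)"
    by (rule cint_equilipschitz_tendsto[where S = EN and \<psi> = "\<lambda>_. 1" and \<Sigma>N = "\<lambda>N. (mN N, \<lambda>_. 1)",
          OF sep cmeasure_mN cmeasure_m weak_conv_m _ _ assms])
      (auto intro: boundedI[where B = 1])
  then show ?thesis by (simp add: cint_def tendsto_of_real_iff)
qed

text \<open>Every subsequence of the extended resolvents has a pointwise convergent further one. Its
  limit is bounded and Lipschitz and solves the limit equation, so uniqueness identifies it and the
  whole sequence converges. The data \<open>f n\<close> vary with \<open>n\<close>, as brackets of
  approximating moments do.\<close>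

lemma resolvent_tendsto:
  assumes lam: "lam > 0" and lip: "\<And>n. L-lipschitz_on UNIV (f n)" and fB: "\<And>n x. \<bar>f n x\<bar> \<le> B"
    and lim: "\<And>x. (\<lambda>n. f n x) \<longlonglongrightarrow> g x"
  obtains R L' where "\<And>n. L'-lipschitz_on UNIV (R n)" "\<And>n x. \<bar>R n x\<bar> \<le> B / lam"
    "\<And>n x. x \<in> EN n \<Longrightarrow> R n x = resolvent (PN n) lam (f n) x" "\<And>x. (\<lambda>n. R n x) \<longlonglongrightarrow> resolvent P lam g x"
proof -
  obtain K where K: "\<And>N f L. L-lipschitz_on (EN N) f \<Longrightarrow> (K * L)-lipschitz_on (EN N) (resolvent (PN N) lam f)"
    using lip_resolvent[OF lam] by blast
  have B: "B \<ge> 0" using fB order_trans abs_ge_zero by blast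
  have "\<exists>r. (K * L)-lipschitz_on UNIV r \<and> (\<forall>x. \<bar>r x\<bar> \<le> B / lam) \<and> (\<forall>x\<in>EN n. r x = resolvent (PN n) lam (f n) x)" for n
  proof -
    have "(K * L)-lipschitz_on (EN n) (resolvent (PN n) lam (f n))"
      by (rule K) (rule lipschitz_on_subset[OF lip subset_UNIV])
    moreover have "\<bar>resolvent (PN n) lam (f n) x\<bar> \<le> B / lam" if "x \<in> EN n" for x
      by (rule markov_paths.resolvent_bound[OF pre_markov lam that _ B]) (use fB in auto)
    ultimately show ?thesis
      using lipschitz_extension_bounded[OF _ EN_ne, of "K * L" n "resolvent (PN n) lam (f n)" "B / lam"] by metis
  qed
  then obtain R where R: "\<And>n. (K * L)-lipschitz_on UNIV (R n)" "\<And>n x. \<bar>R n x\<bar> \<le> B / lam"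
    "\<And>n x. x \<in> EN n \<Longrightarrow> R n x = resolvent (PN n) lam (f n) x" by metis
  have gB: "\<bar>g x\<bar> \<le> B" for x by (rule bounded_pointwise_limit[of f B g x, OF fB lim])
  have g_lip: "bdd_lip g" by (rule bdd_lipI[OF lipschitz_pointwise_limit[OF lip lim] gB])
  have key: "G = resolvent P lam g" if s: "strict_mono (s :: nat \<Rightarrow> nat)" and G: "\<And>x. (\<lambda>n. R (s n) x) \<longlonglongrightarrow> G x" for s G
  proof (rule unique[OF lam g_lip])
    have GB: "\<bar>G x\<bar> \<le> B / lam" for x by (rule bounded_pointwise_limit[of "\<lambda>n. R (s n)" "B / lam" G x, OF R(2) G])
    show "bdd_lip G" by (rule bdd_lipI[OF lipschitz_pointwise_limit[of "K * L" "\<lambda>n. R (s n)", OF R(1) G] GB])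
    fix \<psi> assume \<psi>: "\<psi> \<in> C"
    \<comment> \<open>The measures live on \<open>EN (s n)\<close>, where the extension equals the
      resolvent; the equation therefore passes to the extension.\<close>
    have eq: "- cint (SigN (s n) \<psi>) (\<lambda>x. complex_of_real (R (s n) x) * \<psi> x) +
      complex_of_real lam * cint (mN (s n), \<lambda>_. 1) (\<lambda>x. complex_of_real (R (s n) x) * \<psi> x)
      = cint (mN (s n), \<lambda>_. 1) (\<lambda>x. complex_of_real (f (s n) x) * \<psi> x)" for n
    proof -
      interpret prob_space "mN (s n)" by (rule mN)
      have fm: "f (s n) \<in> borel_measurable (mN (s n))"
        by (rule mN_measurable[OF Cb_measurable[OF Cb_lipschitz[OF lip fB]]])
      have "integrable (mN (s n)) (\<lambda>x. (f (s n) x)\<^sup>2)"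
      proof (rule integrable_const_bound[where B = "B\<^sup>2"])
        show "AE x in mN (s n). norm ((f (s n) x)\<^sup>2) \<le> B\<^sup>2"
          using fB by (intro AE_I2) (metis abs_ge_zero norm_power power_mono real_norm_def)
      qed (use fm in measurable)
      note eq = eqN[OF \<psi> lam fm this, unfolded resolvent_eq_def]
      have 1: "cint (SigN (s n) \<psi>) (\<lambda>x. complex_of_real (R (s n) x) * \<psi> x) = 
        cint (SigN (s n) \<psi>) (\<lambda>x. complex_of_real (resolvent (PN (s n)) lam (f (s n)) x) * \<psi> x)"
        unfolding cint_def 
        by (rule Bochner_Integration.integral_cong[OF refl]) (simp add: R(3) cmeasure_space[OF SigN[OF \<psi>]])
      have 2: "cint (mN (s n), \<lambda>_. 1) (\<lambda>x. complex_of_real (R (s n) x) * \<psi> x) = 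
        (\<integral>x. complex_of_real (resolvent (PN (s n)) lam (f (s n)) x) * \<psi> x \<partial>mN (s n))"
        unfolding cint_def fst_conv
        by (rule Bochner_Integration.integral_cong[OF refl]) (simp add: R(3) space_mN)
      show ?thesis
        unfolding 1 2 eq by (simp add: cint_def)
    qed
    have w1: "weak_conv_cm (\<lambda>n. SigN (s n) \<psi>) (Sig \<psi>)" and w2: "weak_conv_cm (\<lambda>n. (mN (s n), \<lambda>_. 1)) (m, \<lambda>_. 1)"
      using Sig_conv[OF \<psi>] weak_conv_m LIMSEQ_subseq_LIMSEQ[OF _ s]
      unfolding weak_conv_cm_def o_def by (blast, blast)
    note c1 = cint_equilipschitz_tendsto[where S = "\<lambda>n. EN (s n)", OF sep SigN[OF \<psi>] Sig[OF \<psi>] w1 C[OF \<psi>] R(1) R(2) G]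
    note c2 = cint_equilipschitz_tendsto[where S = "\<lambda>n. EN (s n)", OF sep cmeasure_mN cmeasure_m w2 C[OF \<psi>] R(1) R(2) G]
    have lim': "(\<lambda>n. f (s n) x) \<longlonglongrightarrow> g x" for x
      using LIMSEQ_subseq_LIMSEQ[OF lim s] by (simp add: o_def)
    note c3 = cint_equilipschitz_tendsto[where S = "\<lambda>n. EN (s n)", OF sep cmeasure_mN cmeasure_m w2 C[OF \<psi>] lip fB lim']
    have "- cint (Sig \<psi>) (\<lambda>x. complex_of_real (G x) * \<psi> x) + complex_of_real lam * cint (m, \<lambda>_. 1) (\<lambda>x. complex_of_real (G x) * \<psi> x)
      = cint (m, \<lambda>_. 1) (\<lambda>x. complex_of_real (g x) * \<psi> x)"
    proof (rule LIMSEQ_unique)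
      show "(\<lambda>n. cint (mN (s n), \<lambda>_. 1) (\<lambda>x. complex_of_real (f (s n) x) * \<psi> x)) \<longlonglongrightarrow> 
         - cint (Sig \<psi>) (\<lambda>x. complex_of_real (G x) * \<psi> x) + complex_of_real lam * cint (m, \<lambda>_. 1) (\<lambda>x. complex_of_real (G x) * \<psi> x)"
        unfolding eq[symmetric] by (intro tendsto_intros c1 c2)
    qed (rule c3)
    then show "resolvent_eq (Sig \<psi>) \<psi> m lam G g" by (simp add: resolvent_eq_def cint_def)
  qed
  have "(\<lambda>n. R n x) \<longlonglongrightarrow> resolvent P lam g x" for x
  proof (rule LIMSEQ_if_subsubsequences)
    fix s :: "nat \<Rightarrow> nat" assume s: "strict_mono s"
    obtain r G where r: "strict_mono (r :: nat \<Rightarrow> nat)" "\<And>x. (\<lambda>n. R (s (r n)) x) \<longlonglongrightarrow> G x"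
      using pointwise_convergent_subsequence[OF sep, of "K * L" "\<lambda>n. R (s n)" "B / lam"] R(1,2) by metis
    have "G = resolvent P lam g"
      using key[of "s \<circ> r" G] r s by (simp add: strict_mono_o)
    then show "\<exists>r. strict_mono r \<and> (\<lambda>n. R (s (r n)) x) \<longlonglongrightarrow> resolvent P lam g x"
      using r by blast
  qed
  then show thesis using that[OF R(1,2,3)] by blast
qed

text \<open>The brackets are Lipschitz on all of \<open>E\<close> with one constant for all
  \<open>n\<close>, as passing to the limit requires, but enclose \<open>vN n\<close> only on
  \<open>EN n\<close>. Their nonnegativity allows brackets to be multiplied, and the bound
  \<open>c\<close> controls the width of the product.\<close>

definition squeeze :: "real \<Rightarrow> real \<Rightarrow> (nat \<Rightarrow> 'e \<Rightarrow> real) \<Rightarrow> ('e \<Rightarrow> real) \<Rightarrow> 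
    (nat \<Rightarrow> 'e \<Rightarrow> real) \<Rightarrow> (nat \<Rightarrow> 'e \<Rightarrow> real) \<Rightarrow> ('e \<Rightarrow> real) \<Rightarrow> ('e \<Rightarrow> real) \<Rightarrow> bool" where
  "squeeze c L vN v aN bN a b \<longleftrightarrow>
     (\<forall>n. L-lipschitz_on UNIV (aN n) \<and> L-lipschitz_on UNIV (bN n)) \<and>
     (\<forall>n x. 0 \<le> aN n x \<and> aN n x \<le> c \<and> 0 \<le> bN n x \<and> bN n x \<le> c) \<and>
     (\<forall>x. (\<lambda>n. aN n x) \<longlonglongrightarrow> a x) \<and> (\<forall>x. (\<lambda>n. bN n x) \<longlonglongrightarrow> b x) \<and>
     (\<forall>n. \<forall>x\<in>EN n. aN n x \<le> vN n x \<and> vN n x \<le> bN n x) \<and> (\<forall>x. a x \<le> v x \<and> v x \<le> b x)"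

text \<open>\<open>c\<close> is fixed before \<epsilon>, the Lipschitz constant after it: products
  need bounds that do not depend on the accuracy. The width is measured under \<open>m\<close>
  alone; the measures \<open>mN\<close> are reached through convergence of the integrals of the
  brackets.\<close>

definition squeezed :: "(nat \<Rightarrow> 'e \<Rightarrow> real) \<Rightarrow> ('e \<Rightarrow> real) \<Rightarrow> bool" where
  "squeezed vN v \<longleftrightarrow> (\<exists>c\<ge>0. \<forall>\<epsilon>>0. \<exists>L aN bN a b. squeeze c L vN v aN bN a b \<and> (\<integral>x. b x - a x \<partial>m) \<le> \<epsilon>)"

lemma squeezeD:
  assumes "squeeze c L vN v aN bN a b"
  shows "L-lipschitz_on UNIV (aN n)" "L-lipschitz_on UNIV (bN n)" 
    "0 \<le> aN n x" "aN n x \<le> c" "0 \<le> bN n x" "bN n x \<le> c" "\<bar>aN n x\<bar> \<le> c" "\<bar>bN n x\<bar> \<le> c"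
    "(\<lambda>n. aN n x) \<longlonglongrightarrow> a x" "(\<lambda>n. bN n x) \<longlonglongrightarrow> b x"
    "x \<in> EN n \<Longrightarrow> aN n x \<le> vN n x" "x \<in> EN n \<Longrightarrow> vN n x \<le> bN n x" "a x \<le> v x" "v x \<le> b x" "a x \<le> b x"
  using assms order_trans[of "a x" "v x" "b x"] unfolding squeeze_def by auto

lemma squeeze_limits:
  assumes "squeeze c L vN v aN bN a b"
  shows "L-lipschitz_on UNIV a" "L-lipschitz_on UNIV b" "0 \<le> a x" "a x \<le> c" "0 \<le> b x" "b x \<le> c"
    "integrable m a" "integrable m b" "a \<in> Cb" "b \<in> Cb"
proof -
  note d = squeezeD[OF assms]
  interpret prob_space m by (rule m)
  show La: "L-lipschitz_on UNIV a" by (rule lipschitz_pointwise_limit[OF d(1) d(9)])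
  show Lb: "L-lipschitz_on UNIV b" by (rule lipschitz_pointwise_limit[OF d(2) d(10)])
  show a: "0 \<le> a x" "a x \<le> c" for x 
    using LIMSEQ_le_const[OF d(9)] LIMSEQ_le_const2[OF d(9)] d(3,4) by auto
  show b: "0 \<le> b x" "b x \<le> c" for x 
    using LIMSEQ_le_const[OF d(10)] LIMSEQ_le_const2[OF d(10)] d(5,6) by auto
  show Ca: "a \<in> Cb" by (rule Cb_lipschitz[OF La, of c]) (use a in simp)
  show Cb': "b \<in> Cb" by (rule Cb_lipschitz[OF Lb, of c]) (use b in simp)
  show "integrable m a" by (rule integrable_const_bound[where B = c]) (use a m_measurable[OF Cb_measurable[OF Ca]] in auto)
  show "integrable m b" by (rule integrable_const_bound[where B = c]) (use b m_measurable[OF Cb_measurable[OF Cb']] in auto)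
qed

text \<open>The integrals of both brackets converge by \<open>integral_tendsto\<close>. Half of
  \<open>e\<close> is spent on that and half on the width of the limit bracket.\<close>

lemma squeezed_integral:
  assumes sq: "squeezed vN v" and vm: "\<And>n. vN n \<in> borel_measurable (mN n)" and v: "v \<in> borel_measurable borel"
  shows "(\<lambda>n. \<integral>x. vN n x \<partial>mN n) \<longlonglongrightarrow> (\<integral>x. v x \<partial>m)"
proof (rule LIMSEQ_I)
  fix e :: real assume e: "e > 0"
  from sq obtain c where c: "\<And>\<epsilon>. \<epsilon> > 0 \<Longrightarrow> \<exists>L aN bN a b. squeeze c L vN v aN bN a b \<and> (\<integral>x. b x - a x \<partial>m) \<le> \<epsilon>"
    unfolding squeezed_def by blast
  have e2: "e/2 > 0" using e by simp
  obtain L aN bN a b where s: "squeeze c L vN v aN bN a b" and i: "(\<integral>x. b x - a x \<partial>m) \<le> e/2"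
    using c[OF e2] by blast
  note d = squeezeD[OF s] and l = squeeze_limits[OF s]
  have ia: "(\<lambda>n. \<integral>x. aN n x \<partial>mN n) \<longlonglongrightarrow> (\<integral>x. a x \<partial>m)" by (rule integral_tendsto[OF d(1,7,9)])
  have ib: "(\<lambda>n. \<integral>x. bN n x \<partial>mN n) \<longlonglongrightarrow> (\<integral>x. b x \<partial>m)" by (rule integral_tendsto[OF d(2,8,10)])
  have vb: "0 \<le> v x" "v x \<le> c" for x using d(13,14)[of x] l(3,6)[of x] by auto
  have iv: "integrable m v"
  proof -
    interpret prob_space m by (rule m)
    show ?thesis by (rule integrable_const_bound[where B = c]) (use vb m_measurable[OF v] in auto)
  qed
  have v1: "(\<integral>x. a x \<partial>m) \<le> (\<integral>x. v x \<partial>m)" "(\<integral>x. v x \<partial>m) \<le> (\<integral>x. b x \<partial>m)"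
    by (rule integral_mono[OF l(7) iv d(13)], rule integral_mono[OF iv l(8) d(14)])
  have v2: "(\<integral>x. aN n x \<partial>mN n) \<le> (\<integral>x. vN n x \<partial>mN n)" "(\<integral>x. vN n x \<partial>mN n) \<le> (\<integral>x. bN n x \<partial>mN n)" for n
  proof -
    interpret prob_space "mN n" by (rule mN)
    have vNb: "\<bar>vN n x\<bar> \<le> c" if "x \<in> EN n" for x
      using d(11,12)[OF that] d(3,6)[of n x] by auto
    have 1: "integrable (mN n) (aN n)" "integrable (mN n) (bN n)" "integrable (mN n) (vN n)"
      using mN_measurable[OF Cb_measurable[OF Cb_lipschitz[OF d(1) d(7)]]] d(7)
        mN_measurable[OF Cb_measurable[OF Cb_lipschitz[OF d(2) d(8)]]] d(8) vm[of n] vNb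
      by (auto intro!: integrable_const_bound[where B = c] simp: space_mN)
    show "(\<integral>x. aN n x \<partial>mN n) \<le> (\<integral>x. vN n x \<partial>mN n)" "(\<integral>x. vN n x \<partial>mN n) \<le> (\<integral>x. bN n x \<partial>mN n)"
      by (rule integral_mono[OF 1(1,3)], simp add: space_mN d(11), rule integral_mono[OF 1(3,2)], simp add: space_mN d(12))
  qed
  have ab: "(\<integral>x. b x \<partial>m) - (\<integral>x. a x \<partial>m) \<le> e/2" using i l(7,8) by simp
  have "\<forall>\<^sub>F n in sequentially. dist (\<integral>x. aN n x \<partial>mN n) (\<integral>x. a x \<partial>m) < e/2"
    "\<forall>\<^sub>F n in sequentially. dist (\<integral>x. bN n x \<partial>mN n) (\<integral>x. b x \<partial>m) < e/2"
    using tendstoD[OF ia e2] tendstoD[OF ib e2] .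
  then have "\<forall>\<^sub>F n in sequentially. norm ((\<integral>x. vN n x \<partial>mN n) - (\<integral>x. v x \<partial>m)) < e"
  proof eventually_elim
    case (elim n)
    then show ?case using v1 v2[of n] ab unfolding dist_real_def real_norm_def by linarith
  qed
  then show "\<exists>no. \<forall>n\<ge>no. norm ((\<integral>x. vN n x \<partial>mN n) - (\<integral>x. v x \<partial>m)) < e"
    by (simp add: eventually_sequentially)
qed

text \<open>Infimal convolutions of \<open>g\<close> and of \<open>1 - g\<close> give Lipschitz
  functions on both sides of \<open>g\<close>, and bounded convergence closes the gap in
  \<open>L^1(m)\<close>. One bracket serves every \<open>n\<close>, with a constant that depends on
  the accuracy.\<close>

lemma squeezed_const:
  assumes g: "continuous_on UNIV g" and g01: "\<And>x. 0 \<le> g x" "\<And>x. g x \<le> 1"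
  shows "squeezed (\<lambda>_. g) g"
  unfolding squeezed_def
proof (rule exI[of _ 1], intro conjI allI impI)
  fix \<epsilon> :: real assume \<epsilon>: "\<epsilon> > 0"
  interpret prob_space m by (rule m)
  have gb: "\<bar>g x\<bar> \<le> 1" "\<bar>1 - g x\<bar> \<le> 1" for x using g01[of x] by auto
  obtain h where h: "\<And>n::nat. (real n)-lipschitz_on UNIV (h n)" "\<And>n x. h n x \<le> g x"
    "\<And>n x. \<bar>h n x\<bar> \<le> 1" "\<And>x. (\<lambda>n. h n x) \<longlonglongrightarrow> g x"
    using lipschitz_approx_below[OF g gb(1)] by blast
  have g': "continuous_on UNIV (\<lambda>x. 1 - g x)" by (intro continuous_intros g)
  obtain k where k: "\<And>n::nat. (real n)-lipschitz_on UNIV (k n)" "\<And>n x. k n x \<le> 1 - g x"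
    "\<And>n x. \<bar>k n x\<bar> \<le> 1" "\<And>x. (\<lambda>n. k n x) \<longlonglongrightarrow> 1 - g x"
    using lipschitz_approx_below[OF g' gb(2)] by blast
  \<comment> \<open>Clamping below at 0 puts the minorants of \<open>g\<close> and
    \<open>1 - g\<close> into \<open>[0, 1]\<close>; the second is then reflected into a majorant of
    \<open>g\<close>.\<close>
  define a where "a n x = max 0 (h n x)" for n x
  define b where "b n x = 1 - max 0 (k n x)" for n x
  have lip: "(real n)-lipschitz_on UNIV (a n)" "(real n)-lipschitz_on UNIV (b n)" for n
    using lipschitz_onD[OF h(1)[of n]] lipschitz_onD[OF k(1)[of n]]
    by (auto intro!: lipschitz_onI simp: a_def b_def dist_real_def max_def abs_if split: if_splits)
       (smt (verit, ccfv_SIG))+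
  have bd: "0 \<le> a n x" "a n x \<le> 1" "0 \<le> b n x" "b n x \<le> 1" "a n x \<le> g x" "g x \<le> b n x" for n x
    using h(2,3)[of n x] k(2,3)[of n x] g01[of x] by (auto simp: a_def b_def abs_le_iff)
  have la: "(\<lambda>n. a n x) \<longlonglongrightarrow> g x" for x
    using tendsto_max[OF tendsto_const[of 0] h(4)[of x]] g01(1)[of x] by (simp add: a_def)
  have lb: "(\<lambda>n. b n x) \<longlonglongrightarrow> g x" for x
    using tendsto_diff[OF tendsto_const[of 1] tendsto_max[OF tendsto_const[of 0] k(4)[of x]]] g01(2)[of x] by (simp add: b_def)
  have Cab: "a n \<in> Cb" "b n \<in> Cb" for n
    using Cb_lipschitz[OF lip(1), of n 1] Cb_lipschitz[OF lip(2), of n 1] bd by auto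
  have "(\<lambda>n. \<integral>x. b n x - a n x \<partial>m) \<longlonglongrightarrow> (\<integral>x. 0 \<partial>m)"
  proof (rule integral_dominated_convergence[where w = "\<lambda>_. 1"])
    show "(\<lambda>x. b n x - a n x) \<in> borel_measurable m" for n
      using m_measurable[OF Cb_measurable] Cab by measurable
    have "(\<lambda>n. b n x - a n x) \<longlonglongrightarrow> 0" for x
      using tendsto_diff[OF lb[of x] la[of x]] by simp
    then show "AE x in m. (\<lambda>n. b n x - a n x) \<longlonglongrightarrow> 0" by simp
    show "AE x in m. norm (b n x - a n x) \<le> 1" for n
      using bd by (intro AE_I2) (smt (verit) real_norm_def)
  qed auto
  then have "\<forall>\<^sub>F n in sequentially. (\<integral>x. b n x - a n x \<partial>m) < \<epsilon>"
    using \<epsilon> by (intro order_tendstoD(2)) auto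
  then obtain n where n: "(\<integral>x. b n x - a n x \<partial>m) < \<epsilon>" by (auto simp: eventually_sequentially)
  have "squeeze 1 (real n) (\<lambda>_. g) g (\<lambda>_. a n) (\<lambda>_. b n) (a n) (b n)"
    unfolding squeeze_def using lip bd by auto
  then show "\<exists>L aN bN a b. squeeze 1 L (\<lambda>_. g) g aN bN a b \<and> (\<integral>x. b x - a x \<partial>m) \<le> \<epsilon>"
    using n by (intro exI conjI) (assumption, simp)
qed simp

lemma squeezed_add:
  assumes "squeezed vN v" "squeezed wN w"
  shows "squeezed (\<lambda>n x. vN n x + wN n x) (\<lambda>x. v x + w x)"
proof -
  obtain c where c: "c \<ge> 0" "\<And>\<epsilon>. \<epsilon> > 0 \<Longrightarrow> \<exists>L aN bN a b. squeeze c L vN v aN bN a b \<and> (\<integral>x. b x - a x \<partial>m) \<le> \<epsilon>"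
    using assms(1) unfolding squeezed_def by blast
  obtain d where d: "d \<ge> 0" "\<And>\<epsilon>. \<epsilon> > 0 \<Longrightarrow> \<exists>L aN bN a b. squeeze d L wN w aN bN a b \<and> (\<integral>x. b x - a x \<partial>m) \<le> \<epsilon>"
    using assms(2) unfolding squeezed_def by blast
  show ?thesis
    unfolding squeezed_def
  proof (rule exI[of _ "c + d"], intro conjI allI impI)
    fix \<epsilon> :: real assume "\<epsilon> > 0"
    then have e2: "\<epsilon>/2 > 0" by simp
    obtain L aN bN a b where s: "squeeze c L vN v aN bN a b" and i: "(\<integral>x. b x - a x \<partial>m) \<le> \<epsilon>/2" using c(2)[OF e2] by blast
    obtain L' aN' bN' a' b' where s': "squeeze d L' wN w aN' bN' a' b'" and i': "(\<integral>x. b' x - a' x \<partial>m) \<le> \<epsilon>/2" using d(2)[OF e2] by blast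
    have "squeeze (c + d) (L + L') (\<lambda>n x. vN n x + wN n x) (\<lambda>x. v x + w x) 
      (\<lambda>n x. aN n x + aN' n x) (\<lambda>n x. bN n x + bN' n x) (\<lambda>x. a x + a' x) (\<lambda>x. b x + b' x)"
      using squeezeD[OF s] squeezeD[OF s'] unfolding squeeze_def
      by (auto intro!: lipschitz_on_add tendsto_add add_mono)
    moreover have "(\<integral>x. b x + b' x - (a x + a' x) \<partial>m) \<le> \<epsilon>"
      using i i' squeeze_limits(7,8)[OF s] squeeze_limits(7,8)[OF s'] by simp
    ultimately show "\<exists>L aN bN a b. squeeze (c + d) L (\<lambda>n x. vN n x + wN n x) (\<lambda>x. v x + w x) aN bN a b \<and> (\<integral>x. b x - a x \<partial>m) \<le> \<epsilon>"
      by blast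
  qed (use c d in simp)
qed

text \<open>Nonnegative brackets may be multiplied. The width of the product is written as
  \<open>b (b' - a') + a' (b - a)\<close> and bounded through \<open>c\<close> and
  \<open>d\<close>.\<close>

lemma squeezed_mult:
  assumes "squeezed vN v" "squeezed wN w"
  shows "squeezed (\<lambda>n x. vN n x * wN n x) (\<lambda>x. v x * w x)"
proof -
  obtain c where c: "c \<ge> 0" "\<And>\<epsilon>. \<epsilon> > 0 \<Longrightarrow> \<exists>L aN bN a b. squeeze c L vN v aN bN a b \<and> (\<integral>x. b x - a x \<partial>m) \<le> \<epsilon>"
    using assms(1) unfolding squeezed_def by blast
  obtain d where d: "d \<ge> 0" "\<And>\<epsilon>. \<epsilon> > 0 \<Longrightarrow> \<exists>L aN bN a b. squeeze d L wN w aN bN a b \<and> (\<integral>x. b x - a x \<partial>m) \<le> \<epsilon>"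
    using assms(2) unfolding squeezed_def by blast
  show ?thesis
    unfolding squeezed_def
  proof (rule exI[of _ "c * d"], intro conjI allI impI)
    fix \<epsilon> :: real assume \<epsilon>: "\<epsilon> > 0"
    \<comment> \<open>The product has width at most \<open>(c + d) * \<delta>\<close>; the summand 1
      keeps the denominator positive.\<close>
    define \<delta> where "\<delta> = \<epsilon> / (c + d + 1)"
    have \<delta>: "\<delta> > 0" using \<epsilon> c d by (simp add: \<delta>_def)
    have \<delta>': "(c + d) * \<delta> \<le> \<epsilon>"
    proof -
      have "(c + d) * \<delta> \<le> (c + d + 1) * \<delta>" using \<delta> by (simp add: algebra_simps)
      also have "\<dots> = \<epsilon>" using c d by (simp add: \<delta>_def)
      finally show ?thesis .
    qed
    obtain L aN bN a b where s: "squeeze c L vN v aN bN a b" and i: "(\<integral>x. b x - a x \<partial>m) \<le> \<delta>" using c(2)[OF \<delta>] by blast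
    obtain L' aN' bN' a' b' where s': "squeeze d L' wN w aN' bN' a' b'" and i': "(\<integral>x. b' x - a' x \<partial>m) \<le> \<delta>" using d(2)[OF \<delta>] by blast
    note D = squeezeD[OF s] and D' = squeezeD[OF s'] and l = squeeze_limits[OF s] and l' = squeeze_limits[OF s']
    have "squeeze (c * d) (c * L' + d * L) (\<lambda>n x. vN n x * wN n x) (\<lambda>x. v x * w x) 
      (\<lambda>n x. aN n x * aN' n x) (\<lambda>n x. bN n x * bN' n x) (\<lambda>x. a x * a' x) (\<lambda>x. b x * b' x)"
      unfolding squeeze_def
    proof (intro conjI allI ballI)
      fix n x
      show "(c * L' + d * L)-lipschitz_on UNIV (\<lambda>x. aN n x * aN' n x)" by (rule lipschitz_on_mult_bounded[OF D(1,7) D'(1,7)])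
      show "(c * L' + d * L)-lipschitz_on UNIV (\<lambda>x. bN n x * bN' n x)" by (rule lipschitz_on_mult_bounded[OF D(2,8) D'(2,8)])
      show "0 \<le> aN n x * aN' n x" "0 \<le> bN n x * bN' n x" using D D' by auto
      show "aN n x * aN' n x \<le> c * d" "bN n x * bN' n x \<le> c * d" using D D' c d by (auto intro!: mult_mono)
      show "(\<lambda>n. aN n x * aN' n x) \<longlonglongrightarrow> a x * a' x" "(\<lambda>n. bN n x * bN' n x) \<longlonglongrightarrow> b x * b' x" 
        by (intro tendsto_mult D D')+
      show "a x * a' x \<le> v x * w x" "v x * w x \<le> b x * b' x"
        using D(13,14)[of x] D'(13,14)[of x] l(3,5)[of x] l'(3,5)[of x] by (auto intro!: mult_mono intro: order_trans)
    next
      fix n x assume x: "x \<in> EN n"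
      show "aN n x * aN' n x \<le> vN n x * wN n x" "vN n x * wN n x \<le> bN n x * bN' n x"
        using D(11,12)[OF x] D'(11,12)[OF x] D(3,5)[of n x] D'(3,5)[of n x] by (auto intro!: mult_mono intro: order_trans)
    qed
    moreover have "(\<integral>x. b x * b' x - a x * a' x \<partial>m) \<le> \<epsilon>"
    proof -
      interpret prob_space m by (rule m)
      have int: "integrable m (\<lambda>x. f x * h x)" if "f \<in> Cb" "h \<in> Cb" for f h
      proof -
        have fh: "(\<lambda>x. f x * h x) \<in> Cb" by (rule Cb_mult[OF that])
        obtain B where "\<forall>x. \<bar>f x * h x\<bar> \<le> B" using Cb_bound[OF fh] by blast
        then show ?thesis
          by (intro integrable_const_bound[where B = B]) (use m_measurable[OF Cb_measurable[OF fh]] in auto)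
      qed
      have "(\<integral>x. b x * b' x - a x * a' x \<partial>m) \<le> (\<integral>x. c * (b' x - a' x) + d * (b x - a x) \<partial>m)"
      proof (rule integral_mono)
        fix x
        have "b x * b' x - a x * a' x = b x * (b' x - a' x) + a' x * (b x - a x)" by (simp add: algebra_simps)
        also have "\<dots> \<le> c * (b' x - a' x) + d * (b x - a x)"
          using D(15)[of x] D'(15)[of x] l(6)[of x] l'(4)[of x] by (intro add_mono mult_right_mono) auto
        finally show "b x * b' x - a x * a' x \<le> c * (b' x - a' x) + d * (b x - a x)" .
      qed (use int l(9,10) l'(9,10) l(7,8) l'(7,8) in auto)
      also have "\<dots> = c * (\<integral>x. b' x - a' x \<partial>m) + d * (\<integral>x. b x - a x \<partial>m)"
        using l(7,8) l'(7,8) by simp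
      also have "\<dots> \<le> c * \<delta> + d * \<delta>" using i i' c d by (intro add_mono mult_left_mono) auto
      finally show ?thesis using \<delta>' by (simp add: algebra_simps)
    qed
    ultimately show "\<exists>L aN bN a b. squeeze (c * d) L (\<lambda>n x. vN n x * wN n x) (\<lambda>x. v x * w x) aN bN a b \<and> (\<integral>x. b x - a x \<partial>m) \<le> \<epsilon>"
      by blast
  qed (use c d in simp)
qed

lemma squeezed_sum:
  assumes "finite J" "J \<noteq> {}" "\<And>j. j \<in> J \<Longrightarrow> squeezed (vN j) (v j)"
  shows "squeezed (\<lambda>n x. \<Sum>j\<in>J. vN j n x) (\<lambda>x. \<Sum>j\<in>J. v j x)"
  using assms
proof (induction J rule: finite_ne_induct)
  case (insert k F)
  then show ?case using squeezed_add[of "vN k" "v k" "\<lambda>n x. \<Sum>j\<in>F. vN j n x" "\<lambda>x. \<Sum>j\<in>F. v j x"] by simp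
qed simp

text \<open>Monotonicity transports the brackets, \<open>resolvent_tendsto\<close> keeps them
  equi-Lipschitz and convergent, and stationarity of \<open>m\<close> controls the new width. On
  \<open>EN n\<close> only \<open>vN n\<close> is known to be measurable in time, so it has to be
  the larger function in \<open>resolvent_mono\<close>, once directly and once after reflection at
  \<open>c\<close>.\<close>

lemma squeezed_resolvent:
  assumes lam: "lam > 0" and sq: "squeezed vN v"
    and vNm: "\<And>n. vN n \<in> borel_measurable (restrict_space borel (EN n))" and vm: "v \<in> borel_measurable borel"
    and tmN: "\<And>n x. x \<in> EN n \<Longrightarrow> time_measurable (PN n) (vN n) x" and tm: "\<And>x. time_measurable P v x"
  shows "squeezed (\<lambda>n. resolvent (PN n) lam (vN n)) (resolvent P lam v)"
proof -
  obtain c where c: "c \<ge> 0" "\<And>\<epsilon>. \<epsilon> > 0 \<Longrightarrow> \<exists>L aN bN a b. squeeze c L vN v aN bN a b \<and> (\<integral>x. b x - a x \<partial>m) \<le> \<epsilon>"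
    using sq unfolding squeezed_def by blast
  show ?thesis
    unfolding squeezed_def
  proof (rule exI[of _ "c / lam"], intro conjI allI impI)
    fix \<epsilon> :: real assume "\<epsilon> > 0"
    \<comment> \<open>Chosen because the resolvent divides the width by \<open>lam\<close>.\<close>
    then have \<epsilon>: "\<epsilon> * lam > 0" using lam by simp
    obtain L aN bN a b where s: "squeeze c L vN v aN bN a b" and i: "(\<integral>x. b x - a x \<partial>m) \<le> \<epsilon> * lam" using c(2)[OF \<epsilon>] by blast
    note D = squeezeD[OF s] and l = squeeze_limits[OF s]
    have lipc: "L-lipschitz_on UNIV (\<lambda>x. c - f x)" if "L-lipschitz_on UNIV f" for f :: "'e \<Rightarrow> real"
      by (rule lipschitz_onI) (use lipschitz_onD[OF that] lipschitz_on_nonneg[OF that] in \<open>auto simp: dist_real_def abs_minus_commute\<close>)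
    obtain R1 L1 where R1: "\<And>n. L1-lipschitz_on UNIV (R1 n)" "\<And>n x. \<bar>R1 n x\<bar> \<le> c / lam"
      "\<And>n x. x \<in> EN n \<Longrightarrow> R1 n x = resolvent (PN n) lam (aN n) x" "\<And>x. (\<lambda>n. R1 n x) \<longlonglongrightarrow> resolvent P lam a x"
      using resolvent_tendsto[OF lam D(1,7,9)] by metis
    have cb: "\<bar>c - bN n x\<bar> \<le> c" for n x using D(5,6)[of n x] by simp
    obtain R2 L2 where R2: "\<And>n. L2-lipschitz_on UNIV (R2 n)" "\<And>n x. \<bar>R2 n x\<bar> \<le> c / lam"
      "\<And>n x. x \<in> EN n \<Longrightarrow> R2 n x = resolvent (PN n) lam (\<lambda>x. c - bN n x) x" 
      "\<And>x. (\<lambda>n. R2 n x) \<longlonglongrightarrow> resolvent P lam (\<lambda>x. c - b x) x"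
      using resolvent_tendsto[OF lam lipc[OF D(2)] cb tendsto_diff[OF tendsto_const D(10)]] by metis
    \<comment> \<open>The upper bound is \<open>c / lam - R (c - bN)\<close> rather than \<open>R bN\<close>: should the time integral of \<open>c - bN\<close> be the
      junk value \<open>0\<close>, it is still an upper bound.\<close>
    define u where "u n x = max 0 (min (c / lam) (R1 n x))" for n x
    define w where "w n x = c / lam - max 0 (min (c / lam) (R2 n x))" for n x
    define LL where "LL = max L1 L2"
    have c0: "c / lam \<ge> 0" using c lam by simp
    have cl: "L-lipschitz_on UNIV (\<lambda>x. max 0 (min (c / lam) (f x)))" if "L-lipschitz_on UNIV f" for f :: "'e \<Rightarrow> real" and L
    proof (rule lipschitz_onI)
      fix x y
      have "\<bar>f x - f y\<bar> \<le> L * dist x y" using lipschitz_onD[OF that, of x y] by (simp add: dist_real_def)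
      then show "dist (max 0 (min (c / lam) (f x))) (max 0 (min (c / lam) (f y))) \<le> L * dist x y"
        unfolding dist_real_def by linarith
    qed (rule lipschitz_on_nonneg[OF that])
    have lip: "LL-lipschitz_on UNIV (u n)" "LL-lipschitz_on UNIV (w n)" for n
    proof -
      show "LL-lipschitz_on UNIV (u n)"
        unfolding u_def by (rule cl, rule lipschitz_on_le[OF R1(1)]) (simp add: LL_def)
      have "LL-lipschitz_on UNIV (\<lambda>x. max 0 (min (c / lam) (R2 n x)))"
        by (rule cl, rule lipschitz_on_le[OF R2(1)]) (simp add: LL_def)
      then show "LL-lipschitz_on UNIV (w n)"
        unfolding w_def by (intro lipschitz_onI) 
          (auto simp: dist_real_def abs_minus_commute dest: lipschitz_onD lipschitz_on_nonneg)
    qed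
    have am: "a \<in> borel_measurable borel" "b \<in> borel_measurable borel"
      using Cb_measurable l(9,10) by auto
    \<comment> \<open>Paths of the limit process are cadlag in \<open>E\<close> itself, so bounded
      continuous functions are right continuous along them; this makes both limit brackets
      measurable in time.\<close>
    have rc: "continuous (at_right t) (\<lambda>s. f (\<omega> s))" if "f \<in> Cb" "\<omega> \<in> {\<omega>. cadlag \<omega>}" "t \<ge> 0" for f :: "'e \<Rightarrow> real" and \<omega> t
    proof -
      have "continuous (at_right t) \<omega>" using that by (auto simp: cadlag_def)
      moreover have "isCont f (\<omega> t)" using Cb_cont[OF that(1)] by (simp add: continuous_on_eq_continuous_at)
      ultimately show ?thesis by (simp add: continuous_within isCont_tendsto_compose)
    qed
    have ta: "time_measurable P a x" and tb: "time_measurable P b x" for x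
      using lm.time_measurableI[OF am(1) l(3) rc[OF l(9)]] lm.time_measurableI[OF am(2) l(5) rc[OF l(10)]] by auto
    have vb: "0 \<le> v x" "v x \<le> c" for x using D(13,14)[of x] l(3,6)[of x] by auto
    have Ra: "0 \<le> resolvent P lam a x \<and> resolvent P lam a x \<le> resolvent P lam v x" for x
      by (rule lm.resolvent_mono[OF lam, where c = c]) (use am vm D(13) vb l(3) tm in auto)
    have Rb: "resolvent P lam v x \<le> resolvent P lam b x" for x
      using lm.resolvent_mono[OF lam UNIV_I, of v b c x] am vm D(14) vb l(6) tb by auto
    have bb: "\<forall>y\<in>UNIV. \<bar>b y\<bar> \<le> c" using l(5,6) by auto
    have Rcb: "resolvent P lam (\<lambda>y. c - b y) x = c / lam - resolvent P lam b x" for x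
      by (rule lm.resolvent_const_minus(1)[OF lam UNIV_I _ bb c(1) tb]) (use am in simp)
    have Rbc: "resolvent P lam b x \<le> c / lam" for x
      using lm.resolvent_bound[OF lam UNIV_I bb c(1), of x] by auto
    have Rvc: "resolvent P lam v x \<le> c / lam" for x using Rb[of x] Rbc[of x] by simp
    have "squeeze (c / lam) LL (\<lambda>n. resolvent (PN n) lam (vN n)) (resolvent P lam v) u w (resolvent P lam a) (resolvent P lam b)"
      unfolding squeeze_def
    proof (intro conjI allI ballI lip Ra[THEN conjunct2] Rb)
      fix n x
      show "0 \<le> u n x" "u n x \<le> c / lam" "0 \<le> w n x" "w n x \<le> c / lam" using c0 by (auto simp: u_def w_def)
      \<comment> \<open>The extensions may be negative off \<open>EN n\<close>, hence the clamping.
        It disappears in the limit, whose values lie in \<open>[0, c / lam]\<close>.\<close>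
      have "(\<lambda>n. u n x) \<longlonglongrightarrow> max 0 (min (c / lam) (resolvent P lam a x))"
        unfolding u_def by (intro tendsto_intros R1(4))
      then show "(\<lambda>n. u n x) \<longlonglongrightarrow> resolvent P lam a x" using Ra[of x] Rvc[of x] by simp
      have "(\<lambda>n. w n x) \<longlonglongrightarrow> c / lam - max 0 (min (c / lam) (resolvent P lam (\<lambda>x. c - b x) x))"
        unfolding w_def by (intro tendsto_intros R2(4))
      then show "(\<lambda>n. w n x) \<longlonglongrightarrow> resolvent P lam b x" 
        using Ra[of x] Rb[of x] Rbc[of x] by (simp add: Rcb)
    next
      fix n x assume x: "x \<in> EN n"
      interpret mp: markov_paths "EN n" "\<Omega>N n" "PN n" by (rule pre_markov)
      have meas: "aN n \<in> borel_measurable (restrict_space borel (EN n))" 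
        "(\<lambda>y. c - bN n y) \<in> borel_measurable (restrict_space borel (EN n))"
        using Cb_measurable[OF Cb_lipschitz[OF D(1) D(7)]] Cb_measurable[OF Cb_lipschitz[OF lipc[OF D(2)] cb]]
        by (auto intro: measurable_restrict_space1)
      have vNb: "\<forall>y\<in>EN n. \<bar>vN n y\<bar> \<le> c" 
      proof
        fix y assume "y \<in> EN n"
        then show "\<bar>vN n y\<bar> \<le> c" using D(11,12)[of y n] D(3,6)[of n y] by auto
      qed
      note tc = mp.resolvent_const_minus[OF lam x vNm vNb c(1) tmN[OF x], of c]
      have "0 \<le> resolvent (PN n) lam (aN n) x \<and> resolvent (PN n) lam (aN n) x \<le> resolvent (PN n) lam (vN n) x"
        by (rule mp.resolvent_mono[OF lam x meas(1) vNm, where c = c]) (use D vNb tmN[OF x] in \<open>auto intro: order_trans\<close>)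
      then show "u n x \<le> resolvent (PN n) lam (vN n) x"
        using R1(3)[OF x] by (auto simp: u_def)
      have "0 \<le> resolvent (PN n) lam (\<lambda>y. c - bN n y) x \<and> 
        resolvent (PN n) lam (\<lambda>y. c - bN n y) x \<le> resolvent (PN n) lam (\<lambda>y. c - vN n y) x"
      proof (rule mp.resolvent_mono[OF lam x meas(2), where c = c])
        show "\<forall>y\<in>EN n. 0 \<le> c - bN n y \<and> c - bN n y \<le> c - vN n y \<and> c - vN n y \<le> c"
          using D(6) D(12) order_trans[OF D(3) D(11)] by auto
      qed (use vNm tc(2) in auto)
      then show "resolvent (PN n) lam (vN n) x \<le> w n x"
        using R2(2)[of n x] unfolding tc(1) by (auto simp: w_def R2(3)[OF x] abs_le_iff)
    qed
    moreover have "(\<integral>x. resolvent P lam b x - resolvent P lam a x \<partial>m) \<le> \<epsilon>"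
    proof -
      note ra = lm.integral_resolvent_stationary[OF refl m stat lam am(1) l(3) l(4) rc[OF l(9)]]
      note rb = lm.integral_resolvent_stationary[OF refl m stat lam am(2) l(5) l(6) rc[OF l(10)]]
      have "(\<integral>x. resolvent P lam b x - resolvent P lam a x \<partial>m) = (\<integral>x. b x - a x \<partial>m) / lam"
        using ra rb l(7,8) by (simp add: diff_divide_distrib)
      also have "\<dots> \<le> \<epsilon>" using i lam by (simp add: divide_le_eq)
      finally show ?thesis .
    qed
    ultimately show "\<exists>L aN bN a b. squeeze (c / lam) L (\<lambda>n. resolvent (PN n) lam (vN n)) (resolvent P lam v) aN bN a b \<and> 
      (\<integral>x. b x - a x \<partial>m) \<le> \<epsilon>" by blast
  qed (use c lam in simp)
qed

lemma squeezed_cong: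
  assumes "squeezed vN v" "\<And>n x. x \<in> EN n \<Longrightarrow> vN n x = wN n x" "v = w"
  shows "squeezed wN w"
proof -
  have "squeeze c L vN v aN bN a b = squeeze c L wN w aN bN a b" for c L aN bN a b
    unfolding squeeze_def using assms(2,3) by auto
  then show ?thesis using assms(1) unfolding squeezed_def by simp
qed

text \<open>Induction over proper subsets of \<open>J\<close>: \<open>moment_eq_resolvent\<close>
  builds the moment from observables and smaller moments by products, sums and one resolvent, all of
  which preserve \<open>squeezed\<close>. The empty moment is the constant 1.\<close>

lemma moment_squeezed:
  fixes l :: "'i \<Rightarrow> real" and g :: "'i \<Rightarrow> 'e \<Rightarrow> real"
  assumes J: "finite J" and l: "\<And>j. l j \<ge> 1" and g: "\<And>j. continuous_on UNIV (g j)"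
    and rc: "\<And>j. right_cont_obs {\<omega>. cadlag \<omega>} (g j)" and rcN: "\<And>j n. right_cont_obs (\<Omega>N n) (g j)"
  shows "squeezed (\<lambda>n. moment (PN n) l g J) (moment P l g J)"
  using J
proof (induction J rule: finite_psubset_induct)
  case (psubset J)
  have g01: "0 \<le> g j x" "g j x \<le> 1" for j x using rc[of j] by (auto simp: right_cont_obs_def)
  have gm: "g j \<in> borel_measurable borel" for j using rc[of j] by (auto simp: right_cont_obs_def)
  show ?case
  proof (cases "J = {}")
    case True
    have "squeezed (\<lambda>_ _. 1) (\<lambda>_. 1)" by (rule squeezed_const) auto
    then show ?thesis
    proof (rule squeezed_cong)
      show "1 = moment (PN n) l g J x" if "x \<in> EN n" for n x
        using prob_space.prob_space[OF markov_paths.prob[OF pre_markov that]] by (simp add: moment_def True)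
      show "(\<lambda>_. 1) = moment P l g J"
        using prob_space.prob_space[OF lm.prob[OF UNIV_I]] by (simp add: moment_def True fun_eq_iff)
    qed
  next
    case False
    have sum_l: "(\<Sum>j\<in>J. l j) > 0" using psubset.hyps False l by (intro sum_pos) (auto intro: less_le_trans[of 0 1])
    have "squeezed (\<lambda>n. resolvent (PN n) (\<Sum>j\<in>J. l j) (\<lambda>y. \<Sum>j\<in>J. g j y * moment (PN n) l g (J - {j}) y))
       (resolvent P (\<Sum>j\<in>J. l j) (\<lambda>y. \<Sum>j\<in>J. g j y * moment P l g (J - {j}) y))"
    proof (rule squeezed_resolvent[OF sum_l])
      show "squeezed (\<lambda>n y. \<Sum>j\<in>J. g j y * moment (PN n) l g (J - {j}) y) (\<lambda>y. \<Sum>j\<in>J. g j y * moment P l g (J - {j}) y)"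
        using psubset.hyps False
        by (intro squeezed_sum squeezed_mult squeezed_const g g01 psubset.IH) auto
      show "(\<lambda>y. \<Sum>j\<in>J. g j y * moment (PN n) l g (J - {j}) y) \<in> borel_measurable (restrict_space borel (EN n))" for n
        by (intro borel_measurable_sum borel_measurable_times measurable_restrict_space1 gm 
            markov_paths.moment_measurable[OF pre_markov] rcN)
      show "(\<lambda>y. \<Sum>j\<in>J. g j y * moment P l g (J - {j}) y) \<in> borel_measurable borel"
        using lm.moment_measurable[where l = l and g = g, OF rc] gm by simp
      show "time_measurable (PN n) (\<lambda>y. \<Sum>j\<in>J. g j y * moment (PN n) l g (J - {j}) y) x" if "x \<in> EN n" for n x
        by (rule markov_paths.moment_eq_resolvent(2)[OF pre_markov psubset.hyps(1) False rcN l that])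
      show "time_measurable P (\<lambda>y. \<Sum>j\<in>J. g j y * moment P l g (J - {j}) y) x" for x
        by (rule lm.moment_eq_resolvent(2)[OF psubset.hyps(1) False rc l UNIV_I])
    qed
    then show ?thesis
    proof (rule squeezed_cong)
      show "resolvent (PN n) (\<Sum>j\<in>J. l j) (\<lambda>y. \<Sum>j\<in>J. g j y * moment (PN n) l g (J - {j}) y) x = moment (PN n) l g J x"
        if "x \<in> EN n" for n x
        by (rule markov_paths.moment_eq_resolvent(1)[OF pre_markov psubset.hyps(1) False rcN l that, symmetric])
      show "resolvent P (\<Sum>j\<in>J. l j) (\<lambda>y. \<Sum>j\<in>J. g j y * moment P l g (J - {j}) y) = moment P l g J"
        by (rule ext, rule lm.moment_eq_resolvent(1)[OF psubset.hyps(1) False rc l UNIV_I, symmetric])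
    qed
  qed
qed

lemma moment_tendsto:
  fixes l :: "'i \<Rightarrow> real" and g :: "'i \<Rightarrow> 'e \<Rightarrow> real"
  assumes "finite J" "\<And>j. l j \<ge> 1" "\<And>j. continuous_on UNIV (g j)"
    "\<And>j. right_cont_obs {\<omega>. cadlag \<omega>} (g j)" "\<And>j n. right_cont_obs (\<Omega>N n) (g j)"
  shows "(\<lambda>n. \<integral>x. moment (PN n) l g J x \<partial>mN n) \<longlonglongrightarrow> (\<integral>x. moment P l g J x \<partial>m)"
proof (rule squeezed_integral[OF moment_squeezed[OF assms]])
  show "moment (PN n) l g J \<in> borel_measurable (mN n)" for n
    unfolding measurable_cong_sets[OF mN(2) refl] by (rule markov_paths.moment_measurable[OF pre_markov assms(5)])
  show "moment P l g J \<in> borel_measurable borel"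
    using lm.moment_measurable[where l = l and g = g, OF assms(4)] by simp
qed

end

section \<open>Discounted functionals on the Skorokhod space\<close>

text \<open>Fix levels \<open>p < q\<close>. Immediately to the left of a point of
  \<open>A p q\<close> the function stays below \<open>p\<close>, so no other point of
  \<open>A p q\<close> lies there, and a rational number in that gap determines the point.\<close>

lemma cadlag_upward_jumps_countable:
  fixes \<phi> :: "real \<Rightarrow> real"
  assumes l: "\<And>t. t > 0 \<Longrightarrow> (\<phi> \<longlongrightarrow> l t) (at_left t)"
  shows "countable {t. t > 0 \<and> l t < \<phi> t}"
proof -
  define A where "A p q = {t. t > 0 \<and> l t < p \<and> q < \<phi> t}" for p q :: real
  have "countable (A p q)" if pq: "p < q" for p q
  proof -
    have "\<exists>r\<in>\<rat>. r < t \<and> (\<forall>s\<in>A p q. s < t \<longrightarrow> s < r)" if t: "t \<in> A p q" for t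
    proof -
      have "\<forall>\<^sub>F s in at_left t. \<phi> s < p"
        using l[of t] t by (intro order_tendstoD(2)) (auto simp: A_def)
      then obtain b where b: "b < t" "\<And>s. b < s \<Longrightarrow> s < t \<Longrightarrow> \<phi> s < p"
        unfolding eventually_at_left_field by blast
      obtain r where r: "r \<in> \<rat>" "b < r" "r < t" using Rats_dense_in_real[OF b(1)] by blast
      have "s < r" if s: "s \<in> A p q" "s < t" for s
      proof (rule ccontr)
        assume "\<not> s < r"
        then have "\<phi> s < p" using r s by (intro b(2)) auto
        then show False using s pq by (simp add: A_def)
      qed
      then show ?thesis using r by blast
    qed
    then obtain r where r: "\<And>t. t \<in> A p q \<Longrightarrow> r t \<in> \<rat> \<and> r t < t \<and> (\<forall>s\<in>A p q. s < t \<longrightarrow> s < r t)"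
      by metis
    have "inj_on r (A p q)"
    proof (rule linorder_inj_onI')
      show "r s \<noteq> r t" if "s \<in> A p q" "t \<in> A p q" "s < t" for s t
        using r[OF that(1)] r[OF that(2)] that by force
    qed
    moreover have "countable (r ` A p q)"
      by (rule countable_subset[OF _ countable_rat]) (use r in auto)
    ultimately show ?thesis by (rule countable_image_inj_on[rotated])
  qed
  then have "countable (\<Union>(p, q)\<in>{(p, q). p \<in> \<rat> \<and> q \<in> \<rat> \<and> p < q}. A p q)"
    by (intro countable_UN countable_subset[OF _ countable_SIGMA[OF countable_rat, of "\<lambda>_. \<rat>"]]) (auto simp: countable_rat)
  moreover have "{t. t > 0 \<and> l t < \<phi> t} \<subseteq> (\<Union>(p, q)\<in>{(p, q). p \<in> \<rat> \<and> q \<in> \<rat> \<and> p < q}. A p q)"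
  proof
    fix t assume t: "t \<in> {t. t > 0 \<and> l t < \<phi> t}"
    then obtain p where p: "p \<in> \<rat>" "l t < p" "p < \<phi> t" using Rats_dense_in_real by auto
    then obtain q where q: "q \<in> \<rat>" "p < q" "q < \<phi> t" using Rats_dense_in_real by auto
    show "t \<in> (\<Union>(p, q)\<in>{(p, q). p \<in> \<rat> \<and> q \<in> \<rat> \<and> p < q}. A p q)"
      using t p q by (intro UN_I[of "(p, q)"]) (auto simp: A_def)
  qed
  ultimately show ?thesis by (rule countable_subset[rotated])
qed

text \<open>By right continuity, a discontinuity is a left limit that differs from the value: an
  upward jump of \<open>\<phi>\<close> or of \<open>- \<phi>\<close>.\<close>

lemma cadlag_discontinuities_countable:
  fixes \<phi> :: "real \<Rightarrow> real"
  assumes "cadlag \<phi>"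
  shows "countable {t. t > 0 \<and> \<not> isCont \<phi> t}"
proof -
  obtain l where l: "\<And>t. t > 0 \<Longrightarrow> (\<phi> \<longlongrightarrow> l t) (at_left t)"
    using assms unfolding cadlag_def by metis
  have "countable {t. t > 0 \<and> - l t < - \<phi> t}"
    by (rule cadlag_upward_jumps_countable[of "\<lambda>t. - \<phi> t"]) (intro tendsto_minus l)
  then have "countable ({t. t > 0 \<and> l t < \<phi> t} \<union> {t. t > 0 \<and> - l t < - \<phi> t})"
    using cadlag_upward_jumps_countable[OF l] by simp
  moreover have "{t. t > 0 \<and> \<not> isCont \<phi> t} \<subseteq> {t. t > 0 \<and> l t < \<phi> t} \<union> {t. t > 0 \<and> - l t < - \<phi> t}"
  proof (rule ccontr)
    assume "\<not> ?thesis"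
    then obtain t where t: "t > 0" "\<not> isCont \<phi> t" "l t = \<phi> t" by force
    have "continuous (at_right t) \<phi>" using assms t(1) by (simp add: cadlag_def)
    then have "(\<phi> \<longlongrightarrow> \<phi> t) (at t)"
      using l[OF t(1)] t(3) by (simp add: continuous_within filterlim_split_at)
    then show False using t(2) by (simp add: isCont_def)
  qed
  ultimately show ?thesis by (rule countable_subset[rotated])
qed

section \<open>Discounted functionals along Skorokhod convergent paths\<close>

lemma cadlag_compose:
  fixes g :: "'f::metric_space \<Rightarrow> 'h::metric_space"
  assumes g: "continuous_on UNIV g" and \<omega>: "cadlag \<omega>"
  shows "cadlag (\<lambda>t. g (\<omega> t))"
  unfolding cadlag_def
proof (intro conjI allI impI)
  have gc: "isCont g y" for y using g by (simp add: continuous_on_eq_continuous_at)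
  fix t :: real assume "t \<ge> 0"
  then have "continuous (at_right t) \<omega>" using \<omega> by (simp add: cadlag_def)
  then show "continuous (at_right t) (\<lambda>s. g (\<omega> s))"
    using gc by (simp add: continuous_within isCont_tendsto_compose)
next
  have gc: "isCont g y" for y using g by (simp add: continuous_on_eq_continuous_at)
  fix t :: real assume "t > 0"
  then obtain l where "(\<omega> \<longlongrightarrow> l) (at_left t)" using \<omega> by (auto simp: cadlag_def)
  then have "((\<lambda>t. g (\<omega> t)) \<longlongrightarrow> g l) (at_left t)" using gc isCont_tendsto_compose by blast
  then show "\<exists>l. ((\<lambda>t. g (\<omega> t)) \<longlongrightarrow> l) (at_left t)" ..
qed

lemma right_cont_obs_cadlag:
  fixes g :: "'f::metric_space \<Rightarrow> real"
  assumes "continuous_on UNIV g" "\<And>x. 0 \<le> g x" "\<And>x. g x \<le> 1" "\<And>\<omega>. \<omega> \<in> \<Omega> \<Longrightarrow> cadlag \<omega>"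
  shows "right_cont_obs \<Omega> g"
  using assms(2,3) cadlag_compose[OF assms(1) assms(4)] borel_measurable_continuous_onI[OF assms(1)]
  by (auto simp: right_cont_obs_def cadlag_def)

lemma discounted_eq_integral:
  assumes "l \<ge> 1" "right_cont_obs \<Omega> g" "\<omega> \<in> \<Omega>"
  shows "enn2real (discounted l g \<omega>) = (\<integral>s. (if 0 \<le> s then exp (- l * s) * g (\<omega> (max 0 s)) else 0) \<partial>lborel)"
    and "integrable lborel (\<lambda>s. if 0 \<le> s then exp (- l * s) * g (\<omega> (max 0 s)) else 0)"
proof -
  note path_measurable[OF assms(2,3), measurable]
  have g: "0 \<le> g x" "g x \<le> 1" for x using assms(2) by (auto simp: right_cont_obs_def)
  have "(\<integral>s. (if 0 \<le> s then exp (- l * s) * g (\<omega> (max 0 s)) else 0) \<partial>lborel) =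
    enn2real (\<integral>\<^sup>+s. ennreal (if 0 \<le> s then exp (- l * s) * g (\<omega> (max 0 s)) else 0) \<partial>lborel)"
    by (rule integral_eq_nn_integral) (use g in auto)
  also have "(\<integral>\<^sup>+s. ennreal (if 0 \<le> s then exp (- l * s) * g (\<omega> (max 0 s)) else 0) \<partial>lborel) = discounted l g \<omega>"
    unfolding discounted_def by (rule nn_integral_cong) auto
  finally show "enn2real (discounted l g \<omega>) = (\<integral>s. (if 0 \<le> s then exp (- l * s) * g (\<omega> (max 0 s)) else 0) \<partial>lborel)" ..
  show "integrable lborel (\<lambda>s. if 0 \<le> s then exp (- l * s) * g (\<omega> (max 0 s)) else 0)"
  proof (rule Bochner_Integration.integrable_bound)
    show "integrable lborel (\<lambda>s::real. if 0 \<le> s then exp (- l * s) else 0)"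
      by (rule exp_tail_integral(1)) (use assms(1) in simp)
    show "AE s in lborel. norm (if 0 \<le> s then exp (- l * s) * g (\<omega> (max 0 s)) else 0) \<le> norm (if 0 \<le> s then exp (- l * s) else 0)"
      using g by (intro AE_I2) (auto simp: abs_mult intro: mult_left_le)
    show "(\<lambda>s. if 0 \<le> s then exp (- l * s) * g (\<omega> (max 0 s)) else 0) \<in> borel_measurable lborel"
      by (simp add: path_measurable[OF assms(2,3)])
  qed
qed

text \<open>The time change is undone: \<open>u n\<close> is the time that \<open>lam n\<close>
  sends to \<open>t\<close>. It tends to \<open>t\<close>, and continuity of the observed limit path
  at \<open>t\<close> absorbs the displacement.\<close>

lemma sko_conv_pointwise:
  fixes g :: "'f::metric_space \<Rightarrow> real"
  assumes g: "1-lipschitz_on UNIV g" and sk: "sko_conv xs x" and t: "t > 0" and ct: "isCont (\<lambda>s. g (x s)) t"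
  shows "(\<lambda>n. g (xs n t)) \<longlonglongrightarrow> g (x t)"
proof -
  from sk obtain lam where lam: "\<forall>n. strict_mono_on {0..} (lam n) \<and> continuous_on {0..} (lam n) \<and> lam n ` {0..} = {0..}"
    and id: "\<forall>\<epsilon>>0. \<forall>\<^sub>F n in sequentially. \<forall>t\<ge>0. \<bar>lam n t - t\<bar> \<le> \<epsilon>"
    and cl: "\<forall>T\<ge>0. \<forall>\<epsilon>>0. \<forall>\<^sub>F n in sequentially. \<forall>t\<in>{0..T}. dist (xs n (lam n t)) (x t) \<le> \<epsilon>"
    unfolding sko_conv_def by (elim exE conjE) (rule that)
  have surj: "lam n ` {0..} = {0..}" for n using lam by simp
  have "\<exists>u\<ge>0. lam n u = t" for n
  proof -
    have "t \<in> lam n ` {0..}" using surj[of n] t by simp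
    then show ?thesis by auto
  qed
  then obtain u where u: "\<And>n. u n \<ge> 0" "\<And>n. lam n (u n) = t" by metis
  have ul: "u \<longlonglongrightarrow> t"
  proof (rule tendstoI)
    fix e :: real assume "e > 0"
    then have "\<forall>\<^sub>F n in sequentially. \<forall>t\<ge>0. \<bar>lam n t - t\<bar> \<le> e/2" by (intro id[rule_format]) simp
    then show "\<forall>\<^sub>F n in sequentially. dist (u n) t < e"
    proof eventually_elim
      case (elim n)
      then have "\<bar>t - u n\<bar> \<le> e/2" using u by metis
      then show ?case using \<open>e > 0\<close> unfolding dist_real_def by linarith
    qed
  qed
  have 1: "(\<lambda>n. g (x (u n))) \<longlonglongrightarrow> g (x t)" by (rule isCont_tendsto_compose[OF ct ul])
  have 2: "(\<lambda>n. g (xs n t) - g (x (u n))) \<longlonglongrightarrow> 0"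
  proof (rule tendstoI)
    fix e :: real assume e: "e > 0"
    \<comment> \<open>The window up to \<open>t + 1\<close> eventually contains
      \<open>u n\<close>.\<close>
    then have a: "\<forall>\<^sub>F n in sequentially. \<forall>s\<in>{0..t+1}. dist (xs n (lam n s)) (x s) \<le> e/2" using t by (intro cl[rule_format]) auto
    have b: "\<forall>\<^sub>F n in sequentially. u n < t + 1" using ul by (rule order_tendstoD) simp
    from a b show "\<forall>\<^sub>F n in sequentially. dist (g (xs n t) - g (x (u n))) 0 < e"
    proof eventually_elim
      case (elim n)
      then have "dist (xs n (lam n (u n))) (x (u n)) \<le> e/2" using u(1) by auto
      then have "dist (xs n t) (x (u n)) \<le> e/2" by (simp add: u(2))
      then have "dist (g (xs n t)) (g (x (u n))) \<le> e/2" using lipschitz_onD[OF g, of "xs n t" "x (u n)"] by simp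
      then show ?case using e by (simp add: dist_real_def)
    qed
  qed
  show ?thesis using tendsto_add[OF 2 1] by simp
qed

text \<open>The integral ignores time 0 and the countably many discontinuities of the observed limit
  path; at all other positive times \<open>sko_conv_pointwise\<close> applies, and dominated
  convergence concludes.\<close>

lemma discounted_sko_tendsto:
  fixes g :: "'f::metric_space \<Rightarrow> real"
  assumes g: "1-lipschitz_on UNIV g" "\<And>x. 0 \<le> g x" "\<And>x. g x \<le> 1" and l: "l \<ge> 1"
    and xs: "\<And>n. cadlag (xs n)" and x: "cadlag x" and sk: "sko_conv xs x"
  shows "(\<lambda>n. enn2real (discounted l g (xs n))) \<longlonglongrightarrow> enn2real (discounted l g x)"
proof -
  have gc: "continuous_on UNIV g" using g(1) by (rule lipschitz_on_continuous_on)
  have rc: "right_cont_obs {\<omega>. cadlag \<omega>} g" by (rule right_cont_obs_cadlag[OF gc g(2,3)]) simp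
  have e: "enn2real (discounted l g \<omega>) = (\<integral>s. (if 0 \<le> s then exp (- l * s) * g (\<omega> (max 0 s)) else 0) \<partial>lborel)" 
    and i: "integrable lborel (\<lambda>s. if 0 \<le> s then exp (- l * s) * g (\<omega> (max 0 s)) else 0)" if "cadlag \<omega>" for \<omega>
    using discounted_eq_integral[OF l rc] that by auto
  show ?thesis
    unfolding e[OF xs] e[OF x]
  proof (rule integral_dominated_convergence[where w = "\<lambda>s. if 0 \<le> s then exp (- l * s) else 0"])
    show "integrable lborel (\<lambda>s::real. if 0 \<le> s then exp (- l * s) else 0)"
      by (rule exp_tail_integral(1)) (use l in simp)
    show "AE s in lborel. norm (if 0 \<le> s then exp (- l * s) * g (xs n (max 0 s)) else 0) \<le> (if 0 \<le> s then exp (- l * s) else 0)" for n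
      using g(2,3) by (intro AE_I2) (auto simp: abs_mult intro: mult_left_le)
    let ?D = "insert 0 {t. t > 0 \<and> \<not> isCont (\<lambda>s. g (x s)) t}"
    have "countable ?D"
      using cadlag_discontinuities_countable[OF cadlag_compose[OF gc x]] by simp
    then have "AE s in lborel. s \<notin> ?D" by (intro AE_not_in countable_imp_null_set_lborel)
    then show "AE s in lborel. (\<lambda>n. if 0 \<le> s then exp (- l * s) * g (xs n (max 0 s)) else 0) \<longlonglongrightarrow>
        (if 0 \<le> s then exp (- l * s) * g (x (max 0 s)) else 0)"
    proof eventually_elim
      case (elim s)
      show ?case
      proof (cases "s > 0")
        case True
        then have "(\<lambda>n. g (xs n s)) \<longlonglongrightarrow> g (x s)" using elim by (intro sko_conv_pointwise[OF g(1) sk]) auto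
        then show ?thesis using True by (auto intro!: tendsto_intros)
      next
        case False
        then have "s < 0" using elim by auto
        then show ?thesis by simp
      qed
    qed
  qed (use i[OF xs] i[OF x] in \<open>auto intro: borel_measurable_integrable\<close>)
qed

text \<open>Lerch's uniqueness theorem: \<open>y = exp (- s)\<close> turns the rates
  \<open>Suc n\<close> into powers on \<open>[0, 1]\<close>, where polynomials are dense. If
  \<open>h t > 0\<close>, a bump supported where \<open>h\<close> is positive gives a contradiction.
  Equality of two functions results from applying this to their difference in both orders.\<close>

lemma laplace_moments_zero:
  fixes h :: "real \<Rightarrow> real"
  assumes hm: "(\<lambda>s. h (max 0 s)) \<in> borel_measurable borel" and hb: "\<And>s. s \<ge> 0 \<Longrightarrow> \<bar>h s\<bar> \<le> 1"
    and rc: "\<And>t. t \<ge> 0 \<Longrightarrow> continuous (at_right t) h"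
    and z: "\<And>n::nat. (\<integral>s. (if 0 \<le> s then exp (- real (Suc n) * s) * h (max 0 s) else 0) \<partial>lborel) = 0"
    and t: "t \<ge> 0"
  shows "h t \<le> 0"
proof (rule ccontr)
  note hm[measurable]
  assume "\<not> h t \<le> 0"
  then have pos: "h t > 0" by simp
  have "(h \<longlongrightarrow> h t) (at_right t)" using rc[OF t] by (simp add: continuous_within)
  then have "\<forall>\<^sub>F s in at_right t. 0 < h s" by (rule order_tendstoD) (rule pos)
  then obtain b where b: "b > t" "\<And>s. t < s \<Longrightarrow> s < b \<Longrightarrow> 0 < h s"
    unfolding eventually_at_right_field by blast
  \<comment> \<open>Positive part of a parabola in \<open>y = exp (- s)\<close> whose zeros
    correspond to \<open>s = t\<close> and \<open>s = b\<close>.\<close>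
  define c where "c y = max 0 ((y - exp (- b)) * (exp (- t) - y))" for y :: real
  have cc: "continuous_on S c" for S unfolding c_def by (intro continuous_intros)
  have c_pos: "c (exp (- s)) > 0 \<longleftrightarrow> t < s \<and> s < b" for s
  proof -
    have "c (exp (- s)) > 0 \<longleftrightarrow> (exp (- s) - exp (- b)) * (exp (- t) - exp (- s)) > 0" by (auto simp: c_def)
    also have "\<dots> \<longleftrightarrow> t < s \<and> s < b" using b(1) by (auto simp: zero_less_mult_iff)
    finally show ?thesis .
  qed
  have c0: "0 \<le> c y" for y by (simp add: c_def)
  define I where "I f = (\<integral>s. (if 0 \<le> s then exp (- s) * f (exp (- s)) * h (max 0 s) else 0) \<partial>lborel)" for f :: "real \<Rightarrow> real"
  have int: "integrable lborel (\<lambda>s. if 0 \<le> s then exp (- s) * f (exp (- s)) * h (max 0 s) else 0)" 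
    if f: "continuous_on UNIV f" for f :: "real \<Rightarrow> real"
  proof -
    have [measurable]: "f \<in> borel_measurable borel" using f by (rule borel_measurable_continuous_onI)
    have "bounded (f ` {0..1})" by (intro compact_imp_bounded compact_continuous_image continuous_on_subset[OF f]) auto
    then obtain B where "\<forall>z\<in>f ` {0..1}. norm z \<le> B" unfolding bounded_iff by blast
    then have B: "\<And>y. y \<in> {0..1} \<Longrightarrow> \<bar>f y\<bar> \<le> B" by auto
    show ?thesis
    proof (rule Bochner_Integration.integrable_bound)
      show "integrable lborel (\<lambda>s::real. B * (if 0 \<le> s then exp (- 1 * s) else 0))"
        using exp_tail_integral(1)[of 1] by simp
      show "AE s in lborel. norm (if 0 \<le> s then exp (- s) * f (exp (- s)) * h (max 0 s) else 0) \<le> norm (B * (if 0 \<le> s then exp (- 1 * s) else 0))"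
      proof (rule AE_I2)
        fix s :: real
        show "norm (if 0 \<le> s then exp (- s) * f (exp (- s)) * h (max 0 s) else 0) \<le> norm (B * (if 0 \<le> s then exp (- 1 * s) else 0))"
        proof (cases "0 \<le> s")
          case True
          have "\<bar>f (exp (- s))\<bar> * \<bar>h s\<bar> \<le> B * 1" using B[of "exp (- s)"] hb[OF True] True
            by (intro mult_mono) (auto intro: order_trans[OF abs_ge_zero])
          then have "exp (- s) * (\<bar>f (exp (- s))\<bar> * \<bar>h s\<bar>) \<le> exp (- s) * \<bar>B\<bar>" by (intro mult_left_mono) auto
          then show ?thesis using True by (simp add: abs_mult mult_ac)
        qed simp
      qed
    qed measurable
  qed
  \<comment> \<open>The integrable weight \<open>exp (- s)\<close> in \<open>I\<close> absorbs one
    power, which is why the rates start at 1.\<close>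
  have Ipow: "I (\<lambda>y. y ^ n) = 0" for n
  proof -
    have "exp (- s) * exp (- s) ^ n = exp (- real (Suc n) * s)" for s :: real
    proof -
      have "exp (- s) * exp (- s) ^ n = exp (- s) ^ Suc n" by (rule power_Suc[symmetric])
      also have "\<dots> = exp (real (Suc n) * (- s))" by (rule exp_of_nat_mult[symmetric])
      finally show ?thesis by (simp only: mult_minus_left mult_minus_right)
    qed
    then show ?thesis unfolding I_def using z[of n] by (simp only:)
  qed
  have Ipoly: "I p = 0" if p: "real_polynomial_function p" for p
  proof -
    obtain a n where p': "p = (\<lambda>x. \<Sum>i\<le>n. a i * x ^ i)" using p unfolding real_polynomial_function_iff_sum by blast
    have "I p = (\<integral>s. (\<Sum>i\<le>n. a i * (if 0 \<le> s then exp (- s) * exp (- s) ^ i * h (max 0 s) else 0)) \<partial>lborel)"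
      unfolding I_def p'
    proof (rule Bochner_Integration.integral_cong[OF refl])
      fix s
      show "(if 0 \<le> s then exp (- s) * (\<Sum>i\<le>n. a i * exp (- s) ^ i) * h (max 0 s) else 0) =
         (\<Sum>i\<le>n. a i * (if 0 \<le> s then exp (- s) * exp (- s) ^ i * h (max 0 s) else 0))"
        by (cases "0 \<le> s") (simp_all add: sum_distrib_left sum_distrib_right mult_ac)
    qed
    also have "\<dots> = (\<Sum>i\<le>n. a i * I (\<lambda>y. y ^ i))"
      unfolding I_def
      by (subst Bochner_Integration.integral_sum) (auto intro!: integrable_mult_right int continuous_intros)
    finally show ?thesis by (simp add: Ipow)
  qed
  have "\<bar>I c\<bar> \<le> e" if e: "e > 0" for e
  proof -
    obtain p where p: "real_polynomial_function p" "\<And>y. y \<in> {0..1} \<Longrightarrow> \<bar>c y - p y\<bar> < e"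
      using Stone_Weierstrass_real_polynomial_function[of "{0..1::real}" c e] cc e by auto
    have pc: "continuous_on UNIV p" using p(1)
      by (metis continuous_on_polymonial_function real_polynomial_function_eq)
    have "I c = I c - I p" by (simp add: Ipoly[OF p(1)])
    also have "\<dots> = (\<integral>s. (if 0 \<le> s then exp (- s) * c (exp (- s)) * h (max 0 s) else 0) -
        (if 0 \<le> s then exp (- s) * p (exp (- s)) * h (max 0 s) else 0) \<partial>lborel)"
      unfolding I_def by (rule Bochner_Integration.integral_diff[OF int[OF cc] int[OF pc], symmetric])
    also have "\<dots> = (\<integral>s. (if 0 \<le> s then exp (- s) * (c (exp (- s)) - p (exp (- s))) * h (max 0 s) else 0) \<partial>lborel)"
      by (rule Bochner_Integration.integral_cong) (auto simp: algebra_simps)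
    also have "\<bar>\<dots>\<bar> \<le> (\<integral>s. e * (if 0 \<le> s then exp (- 1 * s) else 0) \<partial>lborel)"
    proof (rule order_trans[OF integral_abs_bound integral_mono])
      show "integrable lborel (\<lambda>s. \<bar>if 0 \<le> s then exp (- s) * (c (exp (- s)) - p (exp (- s))) * h (max 0 s) else 0\<bar>)"
        by (rule integrable_abs, rule int) (intro continuous_intros cc pc)
      show "integrable lborel (\<lambda>s::real. e * (if 0 \<le> s then exp (- 1 * s) else 0))"
        using exp_tail_integral(1)[of 1] by simp
      fix s :: real
      show "\<bar>if 0 \<le> s then exp (- s) * (c (exp (- s)) - p (exp (- s))) * h (max 0 s) else 0\<bar> \<le> e * (if 0 \<le> s then exp (- 1 * s) else 0)"
      proof (cases "0 \<le> s")
        case True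
        have "\<bar>c (exp (- s)) - p (exp (- s))\<bar> * \<bar>h s\<bar> \<le> e * 1" using p(2)[of "exp (- s)"] hb[OF True] True e
          by (intro mult_mono) auto
        then have "exp (- s) * (\<bar>c (exp (- s)) - p (exp (- s))\<bar> * \<bar>h s\<bar>) \<le> exp (- s) * e" by (intro mult_left_mono) auto
        then show ?thesis using True by (simp add: abs_mult mult_ac)
      qed simp
    qed
    also have "\<dots> = e" using exp_tail_integral(2)[of 1] by simp
    finally show ?thesis .
  qed
  then have I0: "I c = 0" by (meson abs_ge_zero abs_le_zero_iff dense_ge order_antisym)
  have nn: "0 \<le> (if 0 \<le> s then exp (- s) * c (exp (- s)) * h (max 0 s) else 0)" for s
  proof (cases "c (exp (- s)) > 0")
    case True
    then show ?thesis using c_pos[of s] b(2)[of s] t by auto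
  next
    case False
    then have "c (exp (- s)) = 0" using c0[of "exp (- s)"] by simp
    then show ?thesis by simp
  qed
  have "AE s in lborel. (if 0 \<le> s then exp (- s) * c (exp (- s)) * h (max 0 s) else 0) = 0"
    using I0 integral_nonneg_eq_0_iff_AE[OF int[OF cc]] nn by (simp add: I_def)
  then have "AE s in lborel. s \<notin> {t<..<b}"
  proof eventually_elim
    case (elim s)
    show ?case
    proof
      assume s: "s \<in> {t<..<b}"
      then have "c (exp (- s)) > 0" "h s > 0" "s \<ge> 0" using c_pos b(2) t by auto
      then show False using elim by auto
    qed
  qed
  then have "emeasure lborel {t<..<b} = 0" by (subst (asm) AE_iff_measurable[of "{t<..<b}"]) auto
  then show False using b(1) by simp
qed

lemma discounted_separates:
  assumes rc: "right_cont_obs \<Omega> g" and w: "\<omega> \<in> \<Omega>" "\<omega>' \<in> \<Omega>"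
    and eq: "\<And>n::nat. enn2real (discounted (real (Suc n)) g \<omega>) = enn2real (discounted (real (Suc n)) g \<omega>')" and t: "t \<ge> 0"
  shows "g (\<omega> t) = g (\<omega>' t)"
proof -
  have main: "g (\<omega> t) \<le> g (\<omega>' t)" if w: "\<omega> \<in> \<Omega>" "\<omega>' \<in> \<Omega>"
    and eq: "\<And>n::nat. enn2real (discounted (real (Suc n)) g \<omega>) = enn2real (discounted (real (Suc n)) g \<omega>')" for \<omega> \<omega>'
  proof -
    have g: "0 \<le> g x" "g x \<le> 1" for x using rc by (auto simp: right_cont_obs_def)
    have "g (\<omega> t) - g (\<omega>' t) \<le> 0"
    proof (rule laplace_moments_zero[where h = "\<lambda>s. g (\<omega> s) - g (\<omega>' s)" and t = t])
      show "(\<lambda>s. g (\<omega> (max 0 s)) - g (\<omega>' (max 0 s))) \<in> borel_measurable borel"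
        by (intro borel_measurable_diff path_measurable[OF rc] w)
      show "\<bar>g (\<omega> s) - g (\<omega>' s)\<bar> \<le> 1" for s using g[of "\<omega> s"] g[of "\<omega>' s"] by (simp add: abs_le_iff)
      show "continuous (at_right s) (\<lambda>s. g (\<omega> s) - g (\<omega>' s))" if "s \<ge> 0" for s
        using rc w that by (intro continuous_diff) (auto simp: right_cont_obs_def)
      fix n :: nat
      have s1: "real (Suc n) \<ge> 1" by simp
      have "(\<integral>s. (if 0 \<le> s then exp (- real (Suc n) * s) * (g (\<omega> (max 0 s)) - g (\<omega>' (max 0 s))) else 0) \<partial>lborel) =
        (\<integral>s. (if 0 \<le> s then exp (- real (Suc n) * s) * g (\<omega> (max 0 s)) else 0) - 
              (if 0 \<le> s then exp (- real (Suc n) * s) * g (\<omega>' (max 0 s)) else 0) \<partial>lborel)"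
        by (rule Bochner_Integration.integral_cong) (auto simp: right_diff_distrib)
      also have "\<dots> = 0"
        using discounted_eq_integral[OF s1 rc w(1)] discounted_eq_integral[OF s1 rc w(2)] eq[of n]
        by (subst Bochner_Integration.integral_diff) auto
      finally show "(\<integral>s. (if 0 \<le> s then exp (- real (Suc n) * s) * (g (\<omega> (max 0 s)) - g (\<omega>' (max 0 s))) else 0) \<partial>lborel) = 0" .
    qed (rule t)
    then show ?thesis by simp
  qed
  show ?thesis using main[OF w eq] main[OF w(2,1) eq[symmetric]] by simp
qed

section \<open>From moments to weak convergence\<close>

text \<open>These are all polynomials in finitely many coordinates. Taking multiplication by a
  single coordinate as a constructor fits the mixed moments, which are indexed by lists of
  coordinates.\<close>

inductive coordinate_polynomial :: "((nat \<Rightarrow> real) \<Rightarrow> real) \<Rightarrow> bool" where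
  const: "coordinate_polynomial (\<lambda>_. c)"
| add: "coordinate_polynomial p \<Longrightarrow> coordinate_polynomial q \<Longrightarrow> coordinate_polynomial (\<lambda>y. p y + q y)"
| coord: "coordinate_polynomial p \<Longrightarrow> coordinate_polynomial (\<lambda>y. y k * p y)"

lemma coordinate_polynomial_mult:
  assumes "coordinate_polynomial p" "coordinate_polynomial q"
  shows "coordinate_polynomial (\<lambda>y. p y * q y)"
  using assms
proof (induction p rule: coordinate_polynomial.induct)
  case (const c)
  then show ?case
  proof (induction q rule: coordinate_polynomial.induct)
    case (const d)
    show ?case by (rule coordinate_polynomial.const)
  next
    case (add p q)
    then show ?case using coordinate_polynomial.add[of "\<lambda>y. c * p y" "\<lambda>y. c * q y"] by (simp add: distrib_left)
  next
    case (coord p k)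
    then show ?case using coordinate_polynomial.coord[of "\<lambda>y. c * p y" k] by (simp add: mult.left_commute)
  qed
next
  case (add p p')
  then show ?case using coordinate_polynomial.add[of "\<lambda>y. p y * q y" "\<lambda>y. p' y * q y"] by (simp add: distrib_right)
next
  case (coord p k)
  then show ?case using coordinate_polynomial.coord[of "\<lambda>y. p y * q y" k] by (simp add: mult.assoc)
qed

lemma coordinate_polynomial_continuous:
  "coordinate_polynomial p \<Longrightarrow> continuous_on S p"
  by (induction p rule: coordinate_polynomial.induct)
    (auto intro!: continuous_intros intro: continuous_on_subset[OF continuous_on_product_coordinates])

lemma coordinate_polynomial_dense:
  fixes f :: "(nat \<Rightarrow> real) \<Rightarrow> real"
  assumes "compact S" "continuous_on S f" "e > 0"
  obtains p where "coordinate_polynomial p" "\<And>y. y \<in> S \<Longrightarrow> \<bar>f y - p y\<bar> < e"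
proof -
  interpret function_ring_on "Collect coordinate_polynomial" S
  proof
    show "\<exists>f\<in>Collect coordinate_polynomial. f x \<noteq> f y" if ne: "x \<noteq> y" for x y :: "nat \<Rightarrow> real"
    proof -
      obtain k where k: "x k \<noteq> y k" using ne by (auto simp: fun_eq_iff)
      have "coordinate_polynomial (\<lambda>y. y k * 1)" by (intro coordinate_polynomial.intros)
      then show ?thesis using k by (intro bexI[of _ "\<lambda>y. y k * 1"]) auto
    qed
  qed (use assms in \<open>auto intro: coordinate_polynomial.intros coordinate_polynomial_continuous coordinate_polynomial_mult\<close>)
  show thesis using Stone_Weierstrass_basic[OF assms(2,3)] that by auto
qed

lemma compact_unit_cube: "compact {y::nat \<Rightarrow> real. \<forall>k. 0 \<le> y k \<and> y k \<le> 1}"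
proof -
  have "{y::nat \<Rightarrow> real. \<forall>k. 0 \<le> y k \<and> y k \<le> 1} = PiE UNIV (\<lambda>_. {0..1})" by auto
  then show ?thesis
    using compactin_PiE[of "\<lambda>_::nat. euclidean :: real topology" UNIV "\<lambda>_. {0..1}"]
    by (simp add: euclidean_product_topology)
qed

lemma polynomial_moments_tendsto:
  fixes \<mu> :: "nat \<Rightarrow> 'w measure" and \<Phi> :: "'w \<Rightarrow> nat \<Rightarrow> real"
  assumes \<mu>: "\<And>n. prob_space (\<mu> n)" and \<nu>: "prob_space \<nu>"
    and m: "\<And>n. \<Phi> \<in> borel_measurable (\<mu> n)" "\<Phi> \<in> borel_measurable \<nu>"
    and cube: "\<And>w k. 0 \<le> \<Phi> w k" "\<And>w k. \<Phi> w k \<le> 1"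
    and mom: "\<And>ks. (\<lambda>n. \<integral>w. prod_list (map (\<Phi> w) ks) \<partial>\<mu> n) \<longlonglongrightarrow> (\<integral>w. prod_list (map (\<Phi> w) ks) \<partial>\<nu>)"
    and G: "continuous_on UNIV (G :: _ \<Rightarrow> real)"
  shows "(\<lambda>n. \<integral>w. G (\<Phi> w) \<partial>\<mu> n) \<longlonglongrightarrow> (\<integral>w. G (\<Phi> w) \<partial>\<nu>)"
proof -
  let ?Q = "{y::nat \<Rightarrow> real. \<forall>k. 0 \<le> y k \<and> y k \<le> 1}"
  have Q: "\<Phi> w \<in> ?Q" for w using cube by auto
  have int: "integrable M (\<lambda>w. f (\<Phi> w))" if M: "prob_space M" and "\<Phi> \<in> borel_measurable M" and f: "continuous_on UNIV f" 
    for M :: "'w measure" and f :: "(nat \<Rightarrow> real) \<Rightarrow> real"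
  proof -
    interpret prob_space M by (rule M)
    have "bounded (f ` ?Q)" by (intro compact_imp_bounded compact_continuous_image continuous_on_subset[OF f] compact_unit_cube) auto
    then obtain B where "\<forall>z\<in>f ` ?Q. norm z \<le> B" unfolding bounded_iff by blast
    then have B: "norm (f (\<Phi> w)) \<le> B" for w using Q[of w] by blast
    have "(\<lambda>w. f (\<Phi> w)) \<in> borel_measurable M"
      by (rule measurable_compose[OF that(2) borel_measurable_continuous_onI[OF f]])
    then show ?thesis by (intro integrable_const_bound[where B = B]) (use B in auto)
  qed
  have mon: "continuous_on UNIV (\<lambda>y::nat \<Rightarrow> real. prod_list (map y ks))" for ks
    by (induction ks) (auto intro!: continuous_intros)
  \<comment> \<open>A monomial prefix \<open>ks\<close> is carried along, because the coordinate
    factor met in the induction moves into it.\<close>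
  have poly: "(\<lambda>n. \<integral>w. prod_list (map (\<Phi> w) ks) * p (\<Phi> w) \<partial>\<mu> n) \<longlonglongrightarrow> (\<integral>w. prod_list (map (\<Phi> w) ks) * p (\<Phi> w) \<partial>\<nu>)"
    if "coordinate_polynomial p" for p ks
    using that
  proof (induction p arbitrary: ks rule: coordinate_polynomial.induct)
    case (const c)
    show ?case using tendsto_mult_right[OF mom[of ks], of c] by simp
  next
    case (add p q)
    have c: "continuous_on UNIV (\<lambda>y. prod_list (map y ks) * p y)" "continuous_on UNIV (\<lambda>y. prod_list (map y ks) * q y)"
      by (intro continuous_on_mult mon coordinate_polynomial_continuous add.hyps)+
    have *: "(\<integral>w. prod_list (map (\<Phi> w) ks) * (p (\<Phi> w) + q (\<Phi> w)) \<partial>M) =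
      (\<integral>w. prod_list (map (\<Phi> w) ks) * p (\<Phi> w) \<partial>M) + (\<integral>w. prod_list (map (\<Phi> w) ks) * q (\<Phi> w) \<partial>M)"
      if "prob_space M" "\<Phi> \<in> borel_measurable M" for M
      unfolding distrib_left by (rule Bochner_Integration.integral_add[OF int[OF that c(1)] int[OF that c(2)]])
    show ?case unfolding *[OF \<mu> m(1)] *[OF \<nu> m(2)] by (intro tendsto_add add.IH)
  next
    case (coord p k)
    show ?case using coord.IH[of "k # ks"] by (simp add: mult_ac)
  qed
  show ?thesis
  proof (rule LIMSEQ_I)
    fix e :: real assume "e > 0"
    then have e3: "e/3 > 0" by simp
    obtain p where p: "coordinate_polynomial p" "\<And>y. y \<in> ?Q \<Longrightarrow> \<bar>G y - p y\<bar> < e/3"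
      using coordinate_polynomial_dense[OF compact_unit_cube continuous_on_subset[OF G subset_UNIV] e3] by blast
    have close: "\<bar>(\<integral>w. G (\<Phi> w) \<partial>M) - (\<integral>w. p (\<Phi> w) \<partial>M)\<bar> \<le> e/3" if M: "prob_space M" "\<Phi> \<in> borel_measurable M" for M
    proof -
      interpret prob_space M by (rule M)
      have pc: "continuous_on UNIV p" by (rule coordinate_polynomial_continuous[OF p(1)])
      have "(\<integral>w. G (\<Phi> w) \<partial>M) - (\<integral>w. p (\<Phi> w) \<partial>M) = (\<integral>w. G (\<Phi> w) - p (\<Phi> w) \<partial>M)"
        by (rule Bochner_Integration.integral_diff[OF int[OF M G] int[OF M pc], symmetric])
      also have "\<bar>\<dots>\<bar> \<le> (\<integral>w. \<bar>G (\<Phi> w) - p (\<Phi> w)\<bar> \<partial>M)" by (rule integral_abs_bound)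
      also have "\<dots> \<le> e/3"
      proof (rule integral_le_const)
        show "integrable M (\<lambda>w. \<bar>G (\<Phi> w) - p (\<Phi> w)\<bar>)"
          by (intro integrable_abs Bochner_Integration.integrable_diff int M G pc)
        show "AE w in M. \<bar>G (\<Phi> w) - p (\<Phi> w)\<bar> \<le> e/3" by (rule AE_I2) (rule less_imp_le[OF p(2)[OF Q]])
      qed
      finally show ?thesis .
    qed
    have "(\<lambda>n. \<integral>w. p (\<Phi> w) \<partial>\<mu> n) \<longlonglongrightarrow> (\<integral>w. p (\<Phi> w) \<partial>\<nu>)" using poly[OF p(1), of "[]"] by simp
    then have "\<forall>\<^sub>F n in sequentially. dist (\<integral>w. p (\<Phi> w) \<partial>\<mu> n) (\<integral>w. p (\<Phi> w) \<partial>\<nu>) < e/3"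
      by (rule tendstoD) (rule e3)
    then have "\<forall>\<^sub>F n in sequentially. norm ((\<integral>w. G (\<Phi> w) \<partial>\<mu> n) - (\<integral>w. G (\<Phi> w) \<partial>\<nu>)) < e"
    proof eventually_elim
      case (elim n)
      then show ?case using close[OF \<mu> m(1), of n] close[OF \<nu> m(2)] unfolding dist_real_def real_norm_def by linarith
    qed
    then show "\<exists>no. \<forall>n\<ge>no. norm ((\<integral>w. G (\<Phi> w) \<partial>\<mu> n) - (\<integral>w. G (\<Phi> w) \<partial>\<nu>)) < e"
      by (simp add: eventually_sequentially)
  qed
qed

lemma sko_compact_image:
  fixes \<Phi> :: "(real \<Rightarrow> 'f::metric_space) \<Rightarrow> 'b::metric_space"
  assumes K: "sko_compact K"
    and sko: "\<And>xs x. (\<And>n. cadlag (xs n)) \<Longrightarrow> cadlag x \<Longrightarrow> sko_conv xs x \<Longrightarrow> (\<lambda>n. \<Phi> (xs n)) \<longlonglongrightarrow> \<Phi> x"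
  shows "compact (\<Phi> ` K)"
  unfolding compact_eq_seq_compact_metric seq_compact_def
proof (intro allI impI)
  fix f :: "nat \<Rightarrow> 'b" assume "\<forall>n. f n \<in> \<Phi> ` K"
  then have "\<forall>n. \<exists>x. x \<in> K \<and> f n = \<Phi> x" by auto
  then obtain xs where xs: "\<And>n. xs n \<in> K" "\<And>n. f n = \<Phi> (xs n)" by metis
  obtain r x where r: "strict_mono (r::nat \<Rightarrow> nat)" "x \<in> K" "sko_conv (xs \<circ> r) x"
    using K xs(1) unfolding sko_compact_def by blast
  have "cadlag ((xs \<circ> r) n)" "cadlag x" for n using K xs(1) r(2) by (auto simp: sko_compact_def)
  then have "(\<lambda>n. \<Phi> ((xs \<circ> r) n)) \<longlonglongrightarrow> \<Phi> x" by (rule sko) (rule r(3))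
  then have "(f \<circ> r) \<longlonglongrightarrow> \<Phi> x" by (simp add: o_def xs(2))
  then show "\<exists>l\<in>\<Phi> ` K. \<exists>r. strict_mono r \<and> (f \<circ> r) \<longlonglongrightarrow> l"
    using r(1,2) by (intro bexI[of _ "\<Phi> x"] exI[of _ r]) auto
qed

text \<open>Prokhorov's theorem on the Skorokhod space is avoided: a compact set of paths is embedded by \<open>\<Phi>\<close> into the
  Hilbert cube, where Stone--Weierstrass turns convergence of moments into weak convergence.\<close>
lemma tight_moments_tendsto:
  fixes \<Phi> :: "(real \<Rightarrow> 'f::metric_space) \<Rightarrow> nat \<Rightarrow> real" and F :: "(real \<Rightarrow> 'f) \<Rightarrow> real"
  assumes \<mu>: "\<And>n. prob_space (\<mu> n)" "\<And>n. sets (\<mu> n) = sets (path_space {\<omega>. cadlag \<omega>})"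
    and \<nu>: "prob_space \<nu>" "sets \<nu> = sets (path_space {\<omega>. cadlag \<omega>})"
    and m: "\<Phi> \<in> borel_measurable (path_space {\<omega>. cadlag \<omega>})"
    and cube: "\<And>w k. 0 \<le> \<Phi> w k" "\<And>w k. \<Phi> w k \<le> 1"
    and mom: "\<And>ks. (\<lambda>n. \<integral>w. prod_list (map (\<Phi> w) ks) \<partial>\<mu> n) \<longlonglongrightarrow> (\<integral>w. prod_list (map (\<Phi> w) ks) \<partial>\<nu>)"
    and sko: "\<And>xs x. (\<And>n. cadlag (xs n)) \<Longrightarrow> cadlag x \<Longrightarrow> sko_conv xs x \<Longrightarrow> (\<lambda>n. \<Phi> (xs n)) \<longlonglongrightarrow> \<Phi> x"
    and sep: "\<And>x y t. cadlag x \<Longrightarrow> cadlag y \<Longrightarrow> \<Phi> x = \<Phi> y \<Longrightarrow> t \<ge> 0 \<Longrightarrow> x t = y t"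
    and tight: "\<And>\<epsilon>. \<epsilon> > 0 \<Longrightarrow> \<epsilon> < 1 \<Longrightarrow> \<exists>K. sko_compact K \<and> (\<forall>n. measure (\<mu> n) {w \<in> space (\<mu> n). \<Phi> w \<in> \<Phi> ` K} \<ge> 1 - \<epsilon>)"
    and F: "bounded (F ` {\<omega>. cadlag \<omega>})" "F \<in> borel_measurable (path_space {\<omega>. cadlag \<omega>})" "sko_continuous F"
  shows "(\<lambda>n. \<integral>w. F w \<partial>\<mu> n) \<longlonglongrightarrow> (\<integral>w. F w \<partial>\<nu>)"
proof -
  let ?D = "{\<omega>. cadlag \<omega>} :: (real \<Rightarrow> 'f) set"
  have m\<mu>: "\<Phi> \<in> borel_measurable (\<mu> n)" and F\<mu>: "F \<in> borel_measurable (\<mu> n)" for n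
    using m F(2) by (simp_all add: measurable_cong_sets[OF \<mu>(2) refl])
  have m\<nu>: "\<Phi> \<in> borel_measurable \<nu>" and F\<nu>: "F \<in> borel_measurable \<nu>"
    using m F(2) by (simp_all add: measurable_cong_sets[OF \<nu>(2) refl])
  have sp\<mu>: "space (\<mu> n) = ?D" for n using sets_eq_imp_space_eq[OF \<mu>(2)] by simp
  have sp\<nu>: "space \<nu> = ?D" using sets_eq_imp_space_eq[OF \<nu>(2)] by simp
  note weak = polynomial_moments_tendsto[OF \<mu>(1) \<nu>(1) m\<mu> m\<nu> cube mom]
  obtain c0 where "\<forall>z\<in>F ` ?D. norm z \<le> c0" using F(1) unfolding bounded_iff by blast
  then have Fc0: "\<bar>F x\<bar> \<le> c0" if "cadlag x" for x using that by auto
  define c where "c = max c0 1"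
  have c: "c \<ge> 1" and Fc: "cadlag x \<Longrightarrow> \<bar>F x\<bar> \<le> c" for x using Fc0[of x] by (auto simp: c_def)
  \<comment> \<open>Paths with equal image can differ at negative times only. The constant sequence
    \<open>x\<close> then also converges to \<open>y\<close>, and continuity of \<open>F\<close>
    equates the two values.\<close>
  have F_eq: "F x = F y" if xy: "cadlag x" "cadlag y" "\<Phi> x = \<Phi> y" for x y
  proof -
    have "sko_conv (\<lambda>_. x) y"
      unfolding sko_conv_def
      using sep[OF xy] by (intro exI[of _ "\<lambda>_ t. t"]) (auto simp: strict_mono_on_def)
    then have "(\<lambda>n::nat. F x) \<longlonglongrightarrow> F y" 
      using F(3)[unfolded sko_continuous_def, rule_format, of "\<lambda>_. x" y] xy by simp
    then show ?thesis by (rule LIMSEQ_unique[OF tendsto_const])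
  qed
  \<comment> \<open>On \<open>Y\<close> the approximation errs by at most \<epsilon>; off
    \<open>Y\<close> it errs by at most \<open>2 * c\<close>, on a set of measure at most
    \<epsilon>. This is counted once for \<open>\<mu> n\<close> and once for \<open>\<nu>\<close>;
    the last \<epsilon> is the convergence of the integrals of \<open>q\<close>.\<close>
  have approx: "\<forall>\<^sub>F n in sequentially. \<bar>(\<integral>w. F w \<partial>\<mu> n) - (\<integral>w. F w \<partial>\<nu>)\<bar> \<le> 2 * (\<epsilon> + 2 * c * \<epsilon>) + \<epsilon>"
    if \<epsilon>: "\<epsilon> > 0" "\<epsilon> < 1" for \<epsilon>
  proof -
    obtain K where K: "sko_compact K" and KN: "\<And>n. measure (\<mu> n) {w \<in> space (\<mu> n). \<Phi> w \<in> \<Phi> ` K} \<ge> 1 - \<epsilon>"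
      using tight[OF \<epsilon>] by blast
    have KD: "\<And>x. x \<in> K \<Longrightarrow> cadlag x" using K by (auto simp: sko_compact_def)
    have Kseq: "\<exists>(r::nat \<Rightarrow> nat) x. strict_mono r \<and> x \<in> K \<and> sko_conv (xs \<circ> r) x" if "\<And>n. xs n \<in> K" for xs
      using K that unfolding sko_compact_def by blast
    define Y where "Y = \<Phi> ` K"
    \<comment> \<open>Here \<open>\<epsilon> < 1\<close> enters. \<open>Y\<close> must be nonempty
      because \<open>infdist\<close> to the empty set is 0, which would spoil the separation of
      points from \<open>Y\<close> below.\<close>
    have Yne: "Y \<noteq> {}"
    proof
      assume "Y = {}"
      then show False using KN[of 0] \<epsilon> by (simp add: Y_def)
    qed
    have Ycomp: "compact Y" unfolding Y_def by (rule sko_compact_image[OF K sko])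
    \<comment> \<open>\<open>F\<close> read on the image of \<open>K\<close>; by \<open>F_eq\<close>
      the chosen preimage is immaterial.\<close>
    define Ft where "Ft y = F (SOME x. x \<in> K \<and> \<Phi> x = y)" for y
    have Ft: "Ft (\<Phi> x) = F x" if "cadlag x" "\<Phi> x \<in> Y" for x
    proof -
      have "\<exists>z. z \<in> K \<and> \<Phi> z = \<Phi> x" using that(2) by (auto simp: Y_def)
      then have "(SOME z. z \<in> K \<and> \<Phi> z = \<Phi> x) \<in> K \<and> \<Phi> (SOME z. z \<in> K \<and> \<Phi> z = \<Phi> x) = \<Phi> x" by (rule someI_ex)
      then show ?thesis unfolding Ft_def using KD that(1) by (intro F_eq) auto
    qed
    \<comment> \<open>Compactness supplies continuity: along any subsequence the preimages in
      \<open>K\<close> accumulate at a path whose image is \<open>y\<close>, and \<open>F\<close> is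
      continuous there.\<close>
    have Ftc: "continuous_on Y Ft"
      unfolding continuous_on_sequentially
    proof (intro allI ballI impI, elim conjE)
      fix f y assume y: "y \<in> Y" and f: "\<forall>n. f n \<in> Y" "f \<longlonglongrightarrow> y"
      show "(Ft \<circ> f) \<longlonglongrightarrow> Ft y"
      proof (rule LIMSEQ_if_subsubsequences)
        fix s :: "nat \<Rightarrow> nat" assume s: "strict_mono s"
        have "\<forall>n. \<exists>x. x \<in> K \<and> f n = \<Phi> x" using f by (auto simp: Y_def)
        then obtain xs where xs: "\<And>n. xs n \<in> K" "\<And>n. f n = \<Phi> (xs n)" by metis
        obtain r x where r: "strict_mono (r::nat \<Rightarrow> nat)" "x \<in> K" "sko_conv ((\<lambda>n. xs (s n)) \<circ> r) x" 
          using Kseq[of "\<lambda>n. xs (s n)"] xs(1) by blast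
        have cx: "cadlag (((\<lambda>n. xs (s n)) \<circ> r) n)" for n using KD xs(1) by simp
        have "(\<lambda>n. \<Phi> (((\<lambda>n. xs (s n)) \<circ> r) n)) \<longlonglongrightarrow> \<Phi> x" by (rule sko[OF cx KD[OF r(2)] r(3)])
        moreover have "(\<lambda>n. f (s (r n))) \<longlonglongrightarrow> y"
          using LIMSEQ_subseq_LIMSEQ[OF f(2) strict_mono_o[OF s r(1)]] by (simp add: o_def)
        ultimately have "\<Phi> x = y" by (simp add: o_def xs(2)) (rule LIMSEQ_unique)
        moreover have "(\<lambda>n. F (((\<lambda>n. xs (s n)) \<circ> r) n)) \<longlonglongrightarrow> F x"
          using F(3) cx KD[OF r(2)] r(3) unfolding sko_continuous_def by blast
        ultimately have "(\<lambda>n. (Ft \<circ> f) (s (r n))) \<longlonglongrightarrow> Ft y"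
          using Ft[OF KD[OF r(2)]] y Ft[OF KD[OF xs(1)]] xs(1) by (simp add: o_def xs(2) Y_def)
        then show "\<exists>r. strict_mono r \<and> (\<lambda>n. (Ft \<circ> f) (s (r n))) \<longlonglongrightarrow> Ft y" using r(1) by blast
      qed
    qed
    obtain p where p: "coordinate_polynomial p" "\<And>y. y \<in> Y \<Longrightarrow> \<bar>Ft y - p y\<bar> < \<epsilon>"
      using coordinate_polynomial_dense[OF Ycomp Ftc \<epsilon>(1)] by blast
    \<comment> \<open>Clamping to \<open>[- c, c]\<close>, which contains the values of
      \<open>F\<close>, does not increase the error on \<open>Y\<close> and bounds it off
      \<open>Y\<close>.\<close>
    define q where "q y = max (- c) (min c (p y))" for y
    have qc: "continuous_on UNIV q"
      unfolding q_def by (intro continuous_intros coordinate_polynomial_continuous p(1))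
    have qb: "\<bar>q y\<bar> \<le> c" for y using c by (auto simp: q_def)
    have qF: "\<bar>F x - q (\<Phi> x)\<bar> \<le> \<epsilon>" if "cadlag x" "\<Phi> x \<in> Y" for x
      using p(2)[OF that(2)] Fc[OF that(1)] Ft[OF that] unfolding q_def by (auto simp: abs_le_iff)
    have close: "\<bar>(\<integral>w. F w \<partial>M) - (\<integral>w. q (\<Phi> w) \<partial>M)\<bar> \<le> \<epsilon> + 2 * c * \<epsilon>"
      if M: "prob_space M" "space M = ?D" and Mm: "\<Phi> \<in> borel_measurable M" "F \<in> borel_measurable M" 
        and MY: "measure M {w \<in> space M. \<Phi> w \<in> Y} \<ge> 1 - \<epsilon>" for M
    proof -
      interpret prob_space M by (rule M)
      have qm: "(\<lambda>w. q (\<Phi> w)) \<in> borel_measurable M"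
        by (rule measurable_compose[OF Mm(1) borel_measurable_continuous_onI[OF qc]])
      define A where "A = {w \<in> space M. \<Phi> w \<notin> Y}"
      have Ym: "{w \<in> space M. \<Phi> w \<in> Y} \<in> sets M"
        using measurable_sets[OF Mm(1), of Y] compact_imp_closed[OF Ycomp] by (simp add: vimage_def Int_def conj_commute)
      have A: "A \<in> sets M" "measure M A \<le> \<epsilon>"
      proof -
        have "A = space M - {w \<in> space M. \<Phi> w \<in> Y}" by (auto simp: A_def)
        then show "A \<in> sets M" "measure M A \<le> \<epsilon>" using Ym MY prob_compl[OF Ym] by auto
      qed
      have iA: "integrable M (indicator A :: _ \<Rightarrow> real)"
        by (rule integrable_real_indicator) (use A in \<open>auto simp: emeasure_eq_measure\<close>)
      have iF: "integrable M F" by (rule integrable_const_bound[where B = c]) (use Fc M Mm in auto)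
      have iq: "integrable M (\<lambda>w. q (\<Phi> w))" by (rule integrable_const_bound[where B = c]) (use qb qm in auto)
      have "(\<integral>w. F w \<partial>M) - (\<integral>w. q (\<Phi> w) \<partial>M) = (\<integral>w. F w - q (\<Phi> w) \<partial>M)" using iF iq by simp
      also have "\<bar>\<dots>\<bar> \<le> (\<integral>w. \<bar>F w - q (\<Phi> w)\<bar> \<partial>M)" by (rule integral_abs_bound)
      also have "\<dots> \<le> (\<integral>w. \<epsilon> + 2 * c * indicator A w \<partial>M)"
      proof (rule integral_mono)
        fix w assume w: "w \<in> space M"
        show "\<bar>F w - q (\<Phi> w)\<bar> \<le> \<epsilon> + 2 * c * indicator A w"
        proof (cases "\<Phi> w \<in> Y")
          case True
          then show ?thesis using qF[of w] w M(2) by (simp add: A_def)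
        next
          case False
          have "\<bar>F w - q (\<Phi> w)\<bar> \<le> \<bar>F w\<bar> + \<bar>q (\<Phi> w)\<bar>" by (rule abs_triangle_ineq4)
          also have "\<dots> \<le> 2 * c" using Fc[of w] qb[of "\<Phi> w"] w M(2) by simp
          finally show ?thesis using False w \<epsilon>(1) by (simp add: A_def)
        qed
      next
        show "integrable M (\<lambda>w. \<epsilon> + 2 * c * indicator A w)" by (intro iA Bochner_Integration.integrable_add integrable_const integrable_mult_right)
      qed (use iF iq in auto)
      also have "\<dots> = \<epsilon> + 2 * c * measure M A" using A iA by (simp add: prob_space Int_absorb2 sets.sets_into_space)
      also have "\<dots> \<le> \<epsilon> + 2 * c * \<epsilon>" using A(2) c by (intro add_left_mono mult_left_mono) auto
      finally show ?thesis .
    qed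
    have closeN: "\<bar>(\<integral>w. F w \<partial>\<mu> n) - (\<integral>w. q (\<Phi> w) \<partial>\<mu> n)\<bar> \<le> \<epsilon> + 2 * c * \<epsilon>" for n
      by (rule close[OF \<mu>(1) sp\<mu> m\<mu> F\<mu>]) (use KN[of n] in \<open>simp add: Y_def\<close>)
    \<comment> \<open>As in the portmanteau theorem, the limit inherits the mass of
      \<open>Y\<close>: the continuous functions \<open>h j\<close> vanish on \<open>Y\<close>, have
      integral at most \<epsilon> under every \<open>\<mu> n\<close>, and tend to the indicator of
      the complement.\<close>
    have \<nu>Y: "measure \<nu> {w \<in> space \<nu>. \<Phi> w \<in> Y} \<ge> 1 - \<epsilon>"
    proof -
      interpret prob_space \<nu> by (rule \<nu>)
      define h where "h j y = min 1 (real j * infdist y Y)" for j :: nat and y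
      have hc: "continuous_on UNIV (h j)" for j
        unfolding h_def by (intro continuous_intros)
      have h01: "0 \<le> h j y" "h j y \<le> 1" for j y by (auto simp: h_def infdist_nonneg)
      have hm: "(\<lambda>w. h j (\<Phi> w)) \<in> borel_measurable \<nu>" for j
        by (rule measurable_compose[OF m\<nu> borel_measurable_continuous_onI[OF hc]])
      have hN: "(\<integral>w. h j (\<Phi> w) \<partial>\<mu> n) \<le> \<epsilon>" for j n
      proof -
        interpret N: prob_space "\<mu> n" by (rule \<mu>)
        have Ym: "{w \<in> space (\<mu> n). \<Phi> w \<in> Y} \<in> sets (\<mu> n)"
          using measurable_sets[OF m\<mu>, of Y] compact_imp_closed[OF Ycomp] by (simp add: vimage_def Int_def conj_commute)
        have iY: "integrable (\<mu> n) (indicator {w \<in> space (\<mu> n). \<Phi> w \<in> Y} :: _ \<Rightarrow> real)"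
          by (rule integrable_real_indicator) (use Ym in \<open>auto simp: N.emeasure_eq_measure\<close>)
        have hm': "(\<lambda>w. h j (\<Phi> w)) \<in> borel_measurable (\<mu> n)"
          by (rule measurable_compose[OF m\<mu> borel_measurable_continuous_onI[OF hc]])
        have "(\<integral>w. h j (\<Phi> w) \<partial>\<mu> n) \<le> (\<integral>w. 1 - indicator {w \<in> space (\<mu> n). \<Phi> w \<in> Y} w \<partial>\<mu> n)"
        proof (rule integral_mono)
          show "integrable (\<mu> n) (\<lambda>w. h j (\<Phi> w))"
            by (rule N.integrable_const_bound[where B = 1]) (use h01 hm' in auto)
          show "h j (\<Phi> w) \<le> 1 - indicator {w \<in> space (\<mu> n). \<Phi> w \<in> Y} w" if "w \<in> space (\<mu> n)" for w
            using h01 that by (auto simp: indicator_def h_def)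
        next
          show "integrable (\<mu> n) (\<lambda>w. 1 - indicator {w \<in> space (\<mu> n). \<Phi> w \<in> Y} w :: real)"
            by (intro iY Bochner_Integration.integrable_diff N.integrable_const)
        qed
        also have "\<dots> = 1 - measure (\<mu> n) {w \<in> space (\<mu> n). \<Phi> w \<in> Y}"
          using Ym iY by (simp add: N.prob_space Int_absorb2 sets.sets_into_space)
        also have "\<dots> \<le> \<epsilon>" using KN[of n] by (simp add: Y_def)
        finally show ?thesis .
      qed
      have h\<nu>: "(\<integral>w. h j (\<Phi> w) \<partial>\<nu>) \<le> \<epsilon>" for j
        by (rule LIMSEQ_le_const2[OF weak[OF hc]]) (use hN in auto)
      have Ym: "{w \<in> space \<nu>. \<Phi> w \<in> Y} \<in> sets \<nu>"
        using measurable_sets[OF m\<nu>, of Y] compact_imp_closed[OF Ycomp] by (simp add: vimage_def Int_def conj_commute)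
      have "(\<lambda>j. \<integral>w. h j (\<Phi> w) \<partial>\<nu>) \<longlonglongrightarrow> (\<integral>w. 1 - indicator {w \<in> space \<nu>. \<Phi> w \<in> Y} w \<partial>\<nu>)"
      proof (rule integral_dominated_convergence[where w = "\<lambda>_. 1"])
        show "AE w in \<nu>. (\<lambda>j. h j (\<Phi> w)) \<longlonglongrightarrow> 1 - indicator {w \<in> space \<nu>. \<Phi> w \<in> Y} w"
        proof (rule AE_I2)
          fix w assume w: "w \<in> space \<nu>"
          show "(\<lambda>j. h j (\<Phi> w)) \<longlonglongrightarrow> 1 - indicator {w \<in> space \<nu>. \<Phi> w \<in> Y} w"
          proof (cases "\<Phi> w \<in> Y")
            case True
            then show ?thesis using w by (simp add: h_def)
          next
            case False
            then have d: "infdist (\<Phi> w) Y > 0"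
              using in_closed_iff_infdist_zero[OF compact_imp_closed[OF Ycomp] Yne] infdist_nonneg[of "\<Phi> w" Y]
              by (metis antisym_conv2 order_le_less)
            obtain J :: nat where J: "1 / infdist (\<Phi> w) Y \<le> real J" using real_arch_simple by blast
            have "h j (\<Phi> w) = 1" if "j \<ge> J" for j
            proof -
              have "1 \<le> real J * infdist (\<Phi> w) Y" using J d by (simp add: divide_le_eq)
              also have "\<dots> \<le> real j * infdist (\<Phi> w) Y" using that d by (intro mult_right_mono) auto
              finally show ?thesis by (simp add: h_def)
            qed
            then have "\<forall>\<^sub>F j in sequentially. h j (\<Phi> w) = 1" by (auto simp: eventually_sequentially)
            then show ?thesis using False by (simp add: tendsto_eventually)
          qed
        qed
        show "(\<lambda>w. 1 - indicator {w \<in> space \<nu>. \<Phi> w \<in> Y} w :: real) \<in> borel_measurable \<nu>" using Ym by simp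
      qed (use h01 hm in auto)
      then have "(\<integral>w. 1 - indicator {w \<in> space \<nu>. \<Phi> w \<in> Y} w \<partial>\<nu>) \<le> \<epsilon>"
        by (rule LIMSEQ_le_const2) (use h\<nu> in auto)
      moreover have "integrable \<nu> (indicator {w \<in> space \<nu>. \<Phi> w \<in> Y} :: _ \<Rightarrow> real)"
        by (rule integrable_real_indicator) (use Ym in \<open>auto simp: emeasure_eq_measure\<close>)
      ultimately show ?thesis using Ym by (simp add: prob_space Int_absorb2 sets.sets_into_space)
    qed
    have close\<nu>: "\<bar>(\<integral>w. F w \<partial>\<nu>) - (\<integral>w. q (\<Phi> w) \<partial>\<nu>)\<bar> \<le> \<epsilon> + 2 * c * \<epsilon>"
      by (rule close[OF \<nu>(1) sp\<nu> m\<nu> F\<nu> \<nu>Y])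
    have "\<forall>\<^sub>F n in sequentially. dist (\<integral>w. q (\<Phi> w) \<partial>\<mu> n) (\<integral>w. q (\<Phi> w) \<partial>\<nu>) < \<epsilon>"
      by (rule tendstoD[OF weak[OF qc] \<epsilon>(1)])
    then show ?thesis
    proof eventually_elim
      case (elim n)
      have "\<bar>a - b\<bar> \<le> 2 * d + \<epsilon>" if "\<bar>x - y\<bar> < \<epsilon>" "\<bar>a - x\<bar> \<le> d" "\<bar>b - y\<bar> \<le> d" for a b x y d :: real
        using that by linarith
      from this[OF elim[unfolded dist_real_def] closeN close\<nu>] show ?case .
    qed
  qed
  show ?thesis
  proof (rule tendstoI)
    fix e :: real assume e: "e > 0"
    \<comment> \<open>\<open>3 * \<epsilon> + 4 * c * \<epsilon>\<close> has to stay below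
      \<open>e\<close>, and the bound 1/2 ensures \<open>\<epsilon> < 1\<close>.\<close>
    define \<epsilon> where "\<epsilon> = min (1/2) (e / (4 * c + 4))"
    have \<epsilon>: "\<epsilon> > 0" "\<epsilon> < 1" using e c by (auto simp: \<epsilon>_def)
    have "\<epsilon> \<le> e / (4 * c + 4)" by (simp add: \<epsilon>_def)
    then have "\<epsilon> * (4 * c + 4) \<le> e" using c by (simp add: le_divide_eq)
    then have "2 * (\<epsilon> + 2 * c * \<epsilon>) + \<epsilon> < e" using \<epsilon> by (simp add: algebra_simps)
    then show "\<forall>\<^sub>F n in sequentially. dist (\<integral>w. F w \<partial>\<mu> n) (\<integral>w. F w \<partial>\<nu>) < e"
      using approx[OF \<epsilon>] by (auto elim!: eventually_mono simp: dist_real_def)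
  qed
qed

section \<open>Convergence in law\<close>

lemma cadlag_shift:
  fixes \<omega> :: "real \<Rightarrow> 'a::topological_space"
  assumes "cadlag \<omega>" "t \<ge> 0"
  shows "cadlag (\<lambda>s. \<omega> (t + s))"
  unfolding cadlag_def
proof (intro conjI allI impI)
  fix s :: real assume s: "s \<ge> 0"
  have "filterlim (\<lambda>s. t + s) (at_right (t + s)) (at_right s)"
    unfolding filterlim_at by (auto intro!: tendsto_intros eventually_at_right_less[THEN eventually_mono])
  moreover have "(\<omega> \<longlongrightarrow> \<omega> (t + s)) (at_right (t + s))"
    using assms s by (simp add: cadlag_def continuous_within)
  ultimately show "continuous (at_right s) (\<lambda>s. \<omega> (t + s))"
    unfolding continuous_within by (rule filterlim_compose[rotated])
next
  fix s :: real assume s: "s > 0"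
  have "filterlim (\<lambda>s. t + s) (at_left (t + s)) (at_left s)"
    unfolding filterlim_at by (auto intro!: tendsto_intros simp: eventually_at_left_field intro: exI[of _ "s - 1"])
  moreover obtain l where "(\<omega> \<longlongrightarrow> l) (at_left (t + s))"
    using assms s unfolding cadlag_def by (meson add_nonneg_pos)
  ultimately show "\<exists>l. ((\<lambda>s. \<omega> (t + s)) \<longlongrightarrow> l) (at_left s)"
    using filterlim_compose by blast
qed

lemma dist_sequence_separates:
  fixes e :: "nat \<Rightarrow> 'f::metric_space"
  assumes e: "closure (range e) = UNIV" and eq: "\<And>i. min 1 (dist x (e i)) = min 1 (dist y (e i))"
  shows "x = y"
proof (rule ccontr)
  assume "x \<noteq> y"
  \<comment> \<open>At most 1/2, so the truncation is inactive within distance \<open>r\<close>, and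
    at most half of \<open>dist x y\<close>, so the triangle inequality gives a
    contradiction.\<close>
  define r where "r = min 1 (dist x y) / 2"
  have r: "r > 0" "r < 1" "2 * r \<le> dist x y" using \<open>x \<noteq> y\<close> by (auto simp: r_def min_def)
  have "x \<in> closure (range e)" using e by simp
  then obtain i where i: "dist (e i) x < r" using r(1) unfolding closure_approachable by blast
  then have "dist y (e i) < r" using eq[of i] r(2) by (auto simp: dist_commute min_def split: if_splits)
  then have "dist x y < 2 * r" using i dist_triangle[of x y "e i"] by (simp add: dist_commute)
  then show False using r(3) by simp
qed

context markov_paths
begin

lemma initial_law:
  fixes H :: "(real \<Rightarrow> 'e) \<Rightarrow> real"
  assumes \<mu>: "prob_space \<mu>" "sets \<mu> = sets (restrict_space borel S)"
  shows "prob_space (\<mu> \<bind> P)" "sets (\<mu> \<bind> P) = sets (path_space \<Omega>)" 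
    and "H \<in> borel_measurable (path_space \<Omega>) \<Longrightarrow> (\<And>\<omega>. \<bar>H \<omega>\<bar> \<le> B) \<Longrightarrow> 
      (\<integral>\<omega>. H \<omega> \<partial>(\<mu> \<bind> P)) = (\<integral>x. \<integral>\<omega>. H \<omega> \<partial>P x \<partial>\<mu>)"
proof -
  interpret prob_space \<mu> by (rule \<mu>)
  have sp: "space \<mu> = S" using sets_eq_imp_space_eq[OF \<mu>(2)] by simp
  have K: "P \<in> measurable \<mu> (subprob_algebra (path_space \<Omega>))"
    using kernel unfolding measurable_cong_sets[OF \<mu>(2) refl] .
  show "prob_space (\<mu> \<bind> P)"
    by (rule prob_space_bind[OF AE_I2 K]) (simp add: prob sp)
  show "sets (\<mu> \<bind> P) = sets (path_space \<Omega>)"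
    by (rule sets_bind[OF _ not_empty]) (simp add: sets_P sp)
  assume H: "H \<in> borel_measurable (path_space \<Omega>)" and HB: "\<And>\<omega>. \<bar>H \<omega>\<bar> \<le> B"
  show "(\<integral>\<omega>. H \<omega> \<partial>(\<mu> \<bind> P)) = (\<integral>x. \<integral>\<omega>. H \<omega> \<partial>P x \<partial>\<mu>)"
  proof (rule integral_bind[OF H HB K finite_measure_axioms])
    show "AE x in \<mu>. emeasure (P x) (space (P x)) \<le> ennreal 1"
      by (rule AE_I2) (simp add: prob_space.emeasure_space_1[OF prob] sp)
  qed
qed

end

theorem theorem2p6:
  fixes m :: "'e::metric_space measure"
    and P :: "'e \<Rightarrow> (real \<Rightarrow> 'e) measure"
    and EN :: "nat \<Rightarrow> 'e set"
    and mN :: "nat \<Rightarrow> 'e measure"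
    and PN :: "nat \<Rightarrow> 'e \<Rightarrow> (real \<Rightarrow> 'e) measure"
    and \<iota> :: "'e \<Rightarrow> 'f::polish_space"
  assumes separable: "\<exists>D::'e set. countable D \<and> closure D = UNIV"
    and m_prob: "prob_space m" and m_sets: "sets m = sets borel"
    and m_full: "\<forall>U::'e set. open U \<and> U \<noteq> {} \<longrightarrow> emeasure m U > 0"
    and u_markov: "markov_family UNIV {\<omega>. cadlag \<omega>} P"
    and m_stat: "invariant_measure m P"
    and L2_strong_cont: "\<forall>f. bdd_meas f \<longrightarrow>
          ((\<lambda>t. \<integral>x. (trans_op P t f x - f x)\<^sup>2 \<partial>m) \<longlongrightarrow> 0) (at_right 0)"
    and mN_prob: "\<forall>N\<ge>1. prob_space (mN N) \<and> sets (mN N) = sets (restrict_space borel (EN N))"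
    and mN_full: "\<forall>N\<ge>1. \<forall>U::'e set. open U \<and> U \<inter> EN N \<noteq> {} \<longrightarrow> emeasure (mN N) (U \<inter> EN N) > 0"
    and uN_markov: "\<forall>N\<ge>1. markov_family (EN N) {\<omega>. (\<forall>t\<ge>0. \<omega> t \<in> EN N) \<and> cadlag (\<iota> \<circ> \<omega>)} (PN N)"
    and mN_inv: "\<forall>N\<ge>1. invariant_measure (mN N) (PN N)"
    and A1: "\<exists>(C :: ('e \<Rightarrow> complex) set) (Sig :: ('e \<Rightarrow> complex) \<Rightarrow> 'e measure \<times> ('e \<Rightarrow> complex)).
          (\<forall>\<psi>\<in>C. continuous_on UNIV \<psi> \<and> bounded (range \<psi>) \<and> cmeasure_on borel (Sig \<psi>)) \<and>
          (\<forall>lam>0. \<forall>f. bdd_lip f \<longrightarrow>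
              (bdd_lip (resolvent P lam f) \<and> (\<forall>\<psi>\<in>C. resolvent_eq (Sig \<psi>) \<psi> m lam (resolvent P lam f) f)) \<and>
              (\<forall>F. bdd_lip F \<and> (\<forall>\<psi>\<in>C. resolvent_eq (Sig \<psi>) \<psi> m lam F f) \<longrightarrow> F = resolvent P lam f)) \<and>
          (\<exists>SigN :: nat \<Rightarrow> ('e \<Rightarrow> complex) \<Rightarrow> 'e measure \<times> ('e \<Rightarrow> complex).
             \<forall>\<psi>\<in>C. (\<forall>N\<ge>1. cmeasure_on (restrict_space borel (EN N)) (SigN N \<psi>)) \<and>
               (\<forall>N\<ge>1. \<forall>lam>0. \<forall>f. f \<in> borel_measurable (mN N) \<and> integrable (mN N) (\<lambda>x. (f x)\<^sup>2) \<longrightarrow>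
                   resolvent_eq (SigN N \<psi>) \<psi> (mN N) lam (resolvent (PN N) lam f) f) \<and>
               weak_conv_cm (\<lambda>N. SigN N \<psi>) (Sig \<psi>))"
    and A2_proj: "\<forall>N\<ge>1. \<exists>\<pi>::'e \<Rightarrow> 'e. \<forall>x. \<pi> x \<in> EN N \<and> dist x (\<pi> x) = infdist x (EN N)"
    and A2_weak: "weak_conv_pm mN m"
    and A3_embed: "continuous_on UNIV \<iota>" "inj \<iota>"
    and A3_tight: "\<forall>\<epsilon>>0. \<exists>Kc::(real \<Rightarrow> 'f) set. sko_compact Kc \<and>
          (\<forall>N\<ge>1. measure (mN N \<bind> PN N) {\<omega> \<in> space (mN N \<bind> PN N). \<iota> \<circ> \<omega> \<in> Kc} \<ge> 1 - \<epsilon>)"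
    and A4: "\<forall>lam>0. \<exists>C>0. \<forall>N\<ge>1. \<forall>f L. L-lipschitz_on (EN N) f \<longrightarrow>
          (C * L)-lipschitz_on (EN N) (resolvent (PN N) lam f)"
  shows "\<forall>F::(real \<Rightarrow> 'f) \<Rightarrow> real.
           bounded (F ` {\<omega>. cadlag \<omega>}) \<and> F \<in> borel_measurable (path_space {\<omega>. cadlag \<omega>}) \<and> sko_continuous F \<longrightarrow>
           (\<lambda>N. \<integral>\<omega>. F (\<iota> \<circ> \<omega>) \<partial>(mN N \<bind> PN N)) \<longlonglongrightarrow> (\<integral>\<omega>. F (\<iota> \<circ> \<omega>) \<partial>(m \<bind> P))"
proof (intro allI impI)
  fix F :: "(real \<Rightarrow> 'f) \<Rightarrow> real"
  assume F: "bounded (F ` {\<omega>. cadlag \<omega>}) \<and> F \<in> borel_measurable (path_space {\<omega>. cadlag \<omega>}) \<and> sko_continuous F"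
  obtain D :: "'e set" where D: "countable D" "closure D = UNIV" using separable by blast
  from A1 obtain C Sig SigN where
    C: "\<forall>\<psi>\<in>C. continuous_on UNIV \<psi> \<and> bounded (range \<psi>) \<and> cmeasure_on borel (Sig \<psi>)"
    and uniq: "\<forall>lam>0. \<forall>f. bdd_lip f \<longrightarrow>
              (bdd_lip (resolvent P lam f) \<and> (\<forall>\<psi>\<in>C. resolvent_eq (Sig \<psi>) \<psi> m lam (resolvent P lam f) f)) \<and>
              (\<forall>F. bdd_lip F \<and> (\<forall>\<psi>\<in>C. resolvent_eq (Sig \<psi>) \<psi> m lam F f) \<longrightarrow> F = resolvent P lam f)"
    and SigN: "\<forall>\<psi>\<in>C. (\<forall>N\<ge>1. cmeasure_on (restrict_space borel (EN N)) (SigN N \<psi>)) \<and>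
               (\<forall>N\<ge>1. \<forall>lam>0. \<forall>f. f \<in> borel_measurable (mN N) \<and> integrable (mN N) (\<lambda>x. (f x)\<^sup>2) \<longrightarrow>
                   resolvent_eq (SigN N \<psi>) \<psi> (mN N) lam (resolvent (PN N) lam f) f) \<and>
               weak_conv_cm (\<lambda>N. SigN N \<psi>) (Sig \<psi>)"
    by (elim exE conjE) (rule that)
  let ?cad = "{\<omega>. cadlag \<omega>} :: (real \<Rightarrow> 'f) set"
  define \<Omega>N where "\<Omega>N n = {\<omega>. (\<forall>t\<ge>0. \<omega> t \<in> EN (Suc n)) \<and> cadlag (\<iota> \<circ> \<omega>)}" for n
  \<comment> \<open>The index is shifted by one because the hypotheses hold for
    \<open>N \<ge> 1\<close>; the shift is undone at the very end.\<close>
  interpret markov_approximation D m P "\<lambda>n. EN (Suc n)" "\<lambda>n. mN (Suc n)" \<Omega>N "\<lambda>n. PN (Suc n)" C Sig "\<lambda>n. SigN (Suc n)"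
  proof (rule markov_approximation.intro)
    show "countable D" "closure D = UNIV" by fact+
    show "prob_space m" "sets m = sets borel" "invariant_measure m P" by fact+
    show "markov_paths UNIV {\<omega>. cadlag \<omega>} P"
    proof
      show "markov_family UNIV {\<omega>. cadlag \<omega>} P" by (rule u_markov)
      show "(\<lambda>s. \<omega> (t + s)) \<in> {\<omega>. cadlag \<omega>}" if "\<omega> \<in> {\<omega>. cadlag \<omega>}" "0 \<le> t" for \<omega> :: "real \<Rightarrow> 'e" and t
        using cadlag_shift that by auto
    qed
    show "prob_space (mN (Suc n))" "sets (mN (Suc n)) = sets (restrict_space borel (EN (Suc n)))" for n
      using mN_prob by auto
    show "markov_paths (EN (Suc n)) (\<Omega>N n) (PN (Suc n))" for n
    proof
      show "markov_family (EN (Suc n)) (\<Omega>N n) (PN (Suc n))" unfolding \<Omega>N_def using uN_markov by simp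
      show "(\<lambda>s. \<omega> (t + s)) \<in> \<Omega>N n" if "\<omega> \<in> \<Omega>N n" "0 \<le> t" for \<omega> t
        using that cadlag_shift[of "\<iota> \<circ> \<omega>" t] by (auto simp: \<Omega>N_def o_def)
    qed
    show "weak_conv_pm (\<lambda>n. mN (Suc n)) m"
      using A2_weak unfolding weak_conv_pm_def by (auto intro: LIMSEQ_Suc)
    show "continuous_on UNIV \<psi>" "bounded (range \<psi>)" "cmeasure_on borel (Sig \<psi>)"
      "cmeasure_on (restrict_space borel (EN (Suc n))) (SigN (Suc n) \<psi>)" if "\<psi> \<in> C" for \<psi> n
      using C SigN that by auto
    show "F = resolvent P lam f" if "lam > 0" "bdd_lip f" "bdd_lip F" "\<And>\<psi>. \<psi> \<in> C \<Longrightarrow> resolvent_eq (Sig \<psi>) \<psi> m lam F f" for lam f F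
      using uniq that by blast
    show "resolvent_eq (SigN (Suc n) \<psi>) \<psi> (mN (Suc n)) lam (resolvent (PN (Suc n)) lam f) f"
      if "\<psi> \<in> C" "lam > 0" "f \<in> borel_measurable (mN (Suc n))" "integrable (mN (Suc n)) (\<lambda>x. (f x)\<^sup>2)" for \<psi> lam n f
      using SigN that by simp
    show "weak_conv_cm (\<lambda>n. SigN (Suc n) \<psi>) (Sig \<psi>)" if "\<psi> \<in> C" for \<psi>
      using SigN that unfolding weak_conv_cm_def by (auto intro: LIMSEQ_Suc)
    show "\<exists>K>0. \<forall>N f L. L-lipschitz_on (EN (Suc N)) f \<longrightarrow> (K * L)-lipschitz_on (EN (Suc N)) (resolvent (PN (Suc N)) lam f)"
      if lam: "lam > 0" for lam
    proof -
      from A4[THEN spec, THEN mp, OF lam] obtain K where "K > 0"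
        and "\<forall>N\<ge>1. \<forall>f L. L-lipschitz_on (EN N) f \<longrightarrow> (K * L)-lipschitz_on (EN N) (resolvent (PN N) lam f)"
        by (elim exE conjE) (rule that)
      then show ?thesis by (intro exI[of _ K]) simp
    qed
  qed
  have \<iota>m: "\<iota> \<in> borel_measurable borel" using A3_embed(1) by (rule borel_measurable_continuous_onI)
  have \<iota>cad: "cadlag (\<iota> \<circ> \<omega>)" if "cadlag \<omega>" for \<omega>
    using cadlag_compose[OF A3_embed(1) that] by (simp add: o_def)
  obtain E :: "'f set" where E: "countable E" "closure E = UNIV"
  proof -
    obtain E :: "'f set" where E: "countable E" "\<And>X. open X \<Longrightarrow> X \<noteq> {} \<Longrightarrow> \<exists>d\<in>E. d \<in> X"
      by (rule countable_dense_setE) blast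
    have "x \<in> closure E" for x
      unfolding closure_approachable
    proof (intro allI impI)
      fix r :: real assume "r > 0"
      then obtain d where "d \<in> E" "d \<in> ball x r" using E(2)[of "ball x r"] by auto
      then show "\<exists>y\<in>E. dist y x < r" by (auto simp: dist_commute)
    qed
    then show thesis using that[of E] E(1) by auto
  qed
  define e where "e = from_nat_into E"
  have e: "closure (range e) = UNIV" 
    unfolding e_def using E by (subst range_from_nat_into) auto
  \<comment> \<open>Truncated distances to a dense sequence are bounded and 1-Lipschitz, as the
    Skorokhod lemmas ask, and jointly separate points.\<close>
  define g where "g i y = min 1 (dist y (e i))" for i and y :: 'f
  have g_lip: "1-lipschitz_on UNIV (g i)" for i
  proof (rule lipschitz_onI)
    fix x y
    have "\<bar>dist x (e i) - dist y (e i)\<bar> \<le> dist x y"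
      using dist_triangle[of x "e i" y] dist_triangle[of y "e i" x] by (simp add: dist_commute)
    then show "dist (g i x) (g i y) \<le> 1 * dist x y" unfolding g_def dist_real_def by linarith
  qed simp
  have g01: "0 \<le> g i y" "g i y \<le> 1" for i y by (auto simp: g_def)
  have gc: "continuous_on UNIV (g i)" for i using g_lip by (rule lipschitz_on_continuous_on)
  have rc: "right_cont_obs ?cad (g i)" for i by (rule right_cont_obs_cadlag[OF gc g01]) simp
  have g\<iota>c: "continuous_on UNIV (\<lambda>x. g i (\<iota> x))" for i
    by (rule continuous_on_compose2[OF gc A3_embed(1)]) simp
  have rc\<iota>: "right_cont_obs \<Omega> (\<lambda>x. g i (\<iota> x))" if "\<forall>\<omega>\<in>\<Omega>. cadlag (\<iota> \<circ> \<omega>)" for i and \<Omega> :: "(real \<Rightarrow> 'e) set"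
    unfolding right_cont_obs_def
  proof (intro conjI allI ballI impI)
    show "(\<lambda>x. g i (\<iota> x)) \<in> borel_measurable borel" using g\<iota>c by (rule borel_measurable_continuous_onI)
    fix \<omega> and t :: real assume "\<omega> \<in> \<Omega>" "t \<ge> 0"
    then show "continuous (at_right t) (\<lambda>s. g i (\<iota> (\<omega> s)))"
      using rc[of i] that by (auto simp: right_cont_obs_def o_def)
  qed (use g01 in auto)
  \<comment> \<open>Enumerates all pairs of an integer rate, starting at 1, and a member of the
    dense sequence.\<close>
  define lk gk where "lk k = real (Suc (fst (prod_decode k)))" and "gk k = g (snd (prod_decode k))" for k
  define \<Phi> where "\<Phi> w k = enn2real (discounted (lk k) (gk k) w)" for w k
  have lk: "lk k \<ge> 1" for k by (simp add: lk_def)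
  have \<Phi>01: "0 \<le> \<Phi> w k" "\<Phi> w k \<le> 1" for w k
  proof -
    have "discounted (lk k) (gk k) w \<le> 1" by (rule discounted_le[OF lk]) (simp add: gk_def g01)
    from enn2real_mono[OF this] show "\<Phi> w k \<le> 1" by (simp add: \<Phi>_def)
  qed (simp add: \<Phi>_def)
  have \<Phi>m: "\<Phi> \<in> borel_measurable (path_space ?cad)"
    unfolding \<Phi>_def by (rule measurable_coordinatewise_then_product)
      (use discounted_measurable[OF rc] in \<open>simp add: gk_def\<close>)
  have sko: "(\<lambda>n. \<Phi> (xs n)) \<longlonglongrightarrow> \<Phi> x" if "\<And>n. cadlag (xs n)" "cadlag x" "sko_conv xs x" for xs x
    unfolding tendsto_fun_iff \<Phi>_def using that
    by (intro allI discounted_sko_tendsto lk) (auto simp: gk_def g_lip g01)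
  define push where "push M = distr M (path_space ?cad) (\<lambda>\<omega>. \<iota> \<circ> \<omega>)" for M :: "(real \<Rightarrow> 'e) measure"
  have dc: "discounted l h (\<iota> \<circ> \<omega>) = discounted l (\<lambda>x. h (\<iota> x)) \<omega>" for l h \<omega>
    unfolding discounted_def o_def by (rule refl)
  \<comment> \<open>Stated for a general family of path measures, as it serves both the
    approximations and the limit.\<close>
  have law: "prob_space (push (\<mu> \<bind> Q))" "\<And>H :: (real \<Rightarrow> 'f) \<Rightarrow> real. H \<in> borel_measurable (path_space ?cad) \<Longrightarrow> 
      (\<integral>w. H w \<partial>push (\<mu> \<bind> Q)) = (\<integral>\<omega>. H (\<iota> \<circ> \<omega>) \<partial>(\<mu> \<bind> Q))"
    "\<And>ks. (\<integral>w. prod_list (map (\<Phi> w) ks) \<partial>push (\<mu> \<bind> Q)) = 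
      (\<integral>x. moment Q (\<lambda>j. lk (ks ! j)) (\<lambda>j x. gk (ks ! j) (\<iota> x)) {0..<length ks} x \<partial>\<mu>)"
    "(\<lambda>\<omega>. \<iota> \<circ> \<omega>) \<in> measurable (\<mu> \<bind> Q) (path_space ?cad)"
    if mp: "markov_paths S \<Omega> Q" and \<mu>: "prob_space \<mu>" "sets \<mu> = sets (restrict_space borel S)" 
      and cad: "\<forall>\<omega>\<in>\<Omega>. cadlag (\<iota> \<circ> \<omega>)" for S \<Omega> Q \<mu>
  proof -
    interpret mp: markov_paths S \<Omega> Q by (rule mp)
    note il = mp.initial_law[OF \<mu>]
    interpret prob_space "\<mu> \<bind> Q" by (rule il)
    have sp: "space (\<mu> \<bind> Q) = \<Omega>" using sets_eq_imp_space_eq[OF il(2)] by simp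
    have "(\<lambda>\<omega>. \<iota> \<circ> \<omega>) \<in> measurable (path_space \<Omega>) (path_space ?cad)"
      by (rule measurable_into_path_space)
        (use cad in \<open>auto intro: measurable_compose[OF measurable_eval_path_space \<iota>m]\<close>)
    then show im: "(\<lambda>\<omega>. \<iota> \<circ> \<omega>) \<in> measurable (\<mu> \<bind> Q) (path_space ?cad)"
      unfolding measurable_cong_sets[OF il(2) refl] .
    show "prob_space (push (\<mu> \<bind> Q))" unfolding push_def by (rule prob_space_distr[OF im])
    show 2: "(\<integral>w. H w \<partial>push (\<mu> \<bind> Q)) = (\<integral>\<omega>. H (\<iota> \<circ> \<omega>) \<partial>(\<mu> \<bind> Q))" 
      if "H \<in> borel_measurable (path_space ?cad)" for H :: "(real \<Rightarrow> 'f) \<Rightarrow> real"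
      unfolding push_def by (rule integral_distr[OF im that])
    fix ks
    have lm: "(\<lambda>w. prod_list (map (\<Phi> w) ks)) \<in> borel_measurable (path_space ?cad)"
      using measurable_product_then_coordinatewise[OF \<Phi>m] by (induction ks) auto
    \<comment> \<open>\<open>ks\<close> may repeat an index, so the moments are indexed by positions
      in the list; powers of one functional are thus included.\<close>
    have pl: "prod_list (map (\<Phi> (\<iota> \<circ> \<omega>)) ks) = (\<Prod>j\<in>{0..<length ks}. enn2real (discounted (lk (ks ! j)) (\<lambda>x. gk (ks ! j) (\<iota> x)) \<omega>))" for \<omega>
      by (simp add: prod.list_conv_set_nth \<Phi>_def dc)
    have b: "\<bar>\<Prod>j\<in>{0..<length ks}. enn2real (discounted (lk (ks ! j)) (\<lambda>x. gk (ks ! j) (\<iota> x)) \<omega>)\<bar> \<le> 1" for \<omega>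
    proof -
      have "0 \<le> enn2real (discounted (lk k) (\<lambda>x. gk k (\<iota> x)) \<omega>) \<and> enn2real (discounted (lk k) (\<lambda>x. gk k (\<iota> x)) \<omega>) \<le> 1" for k
        using \<Phi>01[of "\<iota> \<circ> \<omega>" k] by (simp add: \<Phi>_def dc)
      then show ?thesis by (auto simp: abs_prod intro!: prod_le_1)
    qed
    have rcg: "right_cont_obs \<Omega> (\<lambda>x. gk k (\<iota> x))" for k unfolding gk_def by (rule rc\<iota>[OF cad])
    show "(\<integral>w. prod_list (map (\<Phi> w) ks) \<partial>push (\<mu> \<bind> Q)) = 
      (\<integral>x. moment Q (\<lambda>j. lk (ks ! j)) (\<lambda>j x. gk (ks ! j) (\<iota> x)) {0..<length ks} x \<partial>\<mu>)"
      unfolding 2[OF lm] pl moment_def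
      by (rule il(3)[OF _ b]) (use discounted_measurable[OF rcg] in measurable)
  qed
  have cadN: "\<forall>\<omega>\<in>\<Omega>N n. cadlag (\<iota> \<circ> \<omega>)" for n by (simp add: \<Omega>N_def)
  have cadL: "\<forall>\<omega>\<in>{\<omega>. cadlag \<omega>}. cadlag (\<iota> \<circ> \<omega>)" using \<iota>cad by simp
  have m': "sets m = sets (restrict_space borel UNIV)" using m_sets by (simp add: sets_restrict_UNIV)
  note lawN = law[OF pre_markov mN(1) mN(2) cadN] and lawL = law[OF limit_markov m_prob m' cadL]
  have "(\<lambda>n. \<integral>w. F w \<partial>push (mN (Suc n) \<bind> PN (Suc n))) \<longlonglongrightarrow> (\<integral>w. F w \<partial>push (m \<bind> P))"
  proof (rule tight_moments_tendsto[OF lawN(1) _ lawL(1) _ \<Phi>m \<Phi>01])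
    show "sets (push (mN (Suc n) \<bind> PN (Suc n))) = sets (path_space ?cad)" for n by (simp add: push_def)
    show "sets (push (m \<bind> P)) = sets (path_space ?cad)" by (simp add: push_def)
    show "(\<lambda>n. \<integral>w. prod_list (map (\<Phi> w) ks) \<partial>push (mN (Suc n) \<bind> PN (Suc n))) \<longlonglongrightarrow> (\<integral>w. prod_list (map (\<Phi> w) ks) \<partial>push (m \<bind> P))" for ks
      unfolding lawN(3) lawL(3)
      by (rule moment_tendsto) (auto simp: lk gk_def g\<iota>c intro!: rc\<iota>[OF cadN] rc\<iota>[OF cadL])
    show "(\<lambda>n. \<Phi> (xs n)) \<longlonglongrightarrow> \<Phi> x" if "\<And>n. cadlag (xs n)" "cadlag x" "sko_conv xs x" for xs x
      by (rule sko[OF that])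
    show "x t = y t" if "cadlag x" "cadlag y" and eq: "\<Phi> x = \<Phi> y" and t: "t \<ge> 0" for x y :: "real \<Rightarrow> 'f" and t
    proof (rule dist_sequence_separates[OF e])
      fix i
      have "enn2real (discounted (real (Suc n)) (g i) x) = enn2real (discounted (real (Suc n)) (g i) y)" for n
        using fun_cong[OF eq, of "prod_encode (n, i)"] by (simp add: \<Phi>_def lk_def gk_def)
      then have "g i (x t) = g i (y t)"
        using that by (intro discounted_separates[OF rc[of i]]) auto
      then show "min 1 (dist (x t) (e i)) = min 1 (dist (y t) (e i))" by (simp add: g_def)
    qed
    show "\<exists>K. sko_compact K \<and> (\<forall>n. 1 - \<epsilon> \<le> measure (push (mN (Suc n) \<bind> PN (Suc n))) 
        {w \<in> space (push (mN (Suc n) \<bind> PN (Suc n))). \<Phi> w \<in> \<Phi> ` K})" if \<epsilon>: "\<epsilon> > 0" "\<epsilon> < 1" for \<epsilon>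
    proof -
      obtain K where K: "sko_compact K" 
        "\<And>N. N \<ge> 1 \<Longrightarrow> measure (mN N \<bind> PN N) {\<omega> \<in> space (mN N \<bind> PN N). \<iota> \<circ> \<omega> \<in> K} \<ge> 1 - \<epsilon>"
        using A3_tight[rule_format, OF \<epsilon>(1)] by blast
      have "1 - \<epsilon> \<le> measure (push (mN (Suc n) \<bind> PN (Suc n))) 
        {w \<in> space (push (mN (Suc n) \<bind> PN (Suc n))). \<Phi> w \<in> \<Phi> ` K}" for n
      proof -
        let ?B = "mN (Suc n) \<bind> PN (Suc n)"
        interpret B: prob_space ?B by (rule markov_paths.initial_law(1)[OF pre_markov mN(1) mN(2)])
        let ?T = "{\<omega> \<in> space ?B. \<iota> \<circ> \<omega> \<in> K}"
        have T: "measure ?B ?T \<ge> 1 - \<epsilon>" by (rule K(2)) simp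
        \<comment> \<open>The event that a path lies in \<open>K\<close> may fail to be measurable.
          It is enlarged to the event that the image under \<open>\<Phi>\<close> lies in the compact
          image of \<open>K\<close>, which is measurable.\<close>
        have YK: "{w \<in> space (path_space ?cad). \<Phi> w \<in> \<Phi> ` K} \<in> sets (path_space ?cad)"
          using measurable_sets[OF \<Phi>m, of "\<Phi> ` K"] compact_imp_closed[OF sko_compact_image[OF K(1) sko]]
          by (simp add: vimage_def Int_def conj_commute)
        have "measure ?B ?T \<le> measure ?B ((\<lambda>\<omega>. \<iota> \<circ> \<omega>) -` {w \<in> space (path_space ?cad). \<Phi> w \<in> \<Phi> ` K} \<inter> space ?B)"
        proof (rule B.finite_measure_mono)
          show "?T \<subseteq> (\<lambda>\<omega>. \<iota> \<circ> \<omega>) -` {w \<in> space (path_space ?cad). \<Phi> w \<in> \<Phi> ` K} \<inter> space ?B"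
            using measurable_space[OF lawN(4)] by auto
          show "(\<lambda>\<omega>. \<iota> \<circ> \<omega>) -` {w \<in> space (path_space ?cad). \<Phi> w \<in> \<Phi> ` K} \<inter> space ?B \<in> sets ?B"
            by (rule measurable_sets[OF lawN(4) YK])
        qed
        also have "\<dots> = measure (push ?B) {w \<in> space (path_space ?cad). \<Phi> w \<in> \<Phi> ` K}"
          unfolding push_def by (rule measure_distr[OF lawN(4) YK, symmetric])
        finally show ?thesis using T by (simp add: push_def)
      qed
      then show ?thesis using K(1) by blast
    qed
  qed (use F in auto)
  then have "(\<lambda>n. \<integral>\<omega>. F (\<iota> \<circ> \<omega>) \<partial>(mN (Suc n) \<bind> PN (Suc n))) \<longlonglongrightarrow> (\<integral>\<omega>. F (\<iota> \<circ> \<omega>) \<partial>(m \<bind> P))"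
    using lawN(2) lawL(2) F by simp
  then show "(\<lambda>N. \<integral>\<omega>. F (\<iota> \<circ> \<omega>) \<partial>(mN N \<bind> PN N)) \<longlonglongrightarrow> (\<integral>\<omega>. F (\<iota> \<circ> \<omega>) \<partial>(m \<bind> P))"
    by (rule LIMSEQ_imp_Suc)
qed

end
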